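(* The theory $\mathrm{PT}^- + \mathrm{INT}\upharpoonright_{\mathrm{tot}}$ does not relatively truth define the theory $\mathrm{PT}^- + \mathrm{INT}$.
   Context: Conventions. $\mathcal{L}_{\mathrm{PA}}$ is the language of Peano Arithmetic $\mathrm{PA}$ and $\mathcal{L}_T=\mathcal{L}_{\mathrm{PA}}\cup\{T\}$ with $T$ a new unary predicate. Syntax is arithmetized inside $\mathrm{PA}$, and symbols for syntactic operations on codes are suppressed. Inside arithmetic, $\phi,\psi$ range over codes of $\mathcal{L}_{\mathrm{PA}}$-sentences; $\phi(v)$ over codes of $\mathcal{L}_{\mathrm{PA}}$-formulae with at most one free variable; $s,t$ over codes of closed arithmetical terms; $v$ over codes of variables. $\underline{x}$ is (the code of) the standard numeral for $x$; $s^\circ$ is the value of the closed term coded by $s$. In the arithmetized language $\neg,\vee,\exists$ are primitive, and $\wedge,\forall$ are abbreviations. $\mathrm{PT}^-$ is the $\mathcal{L}_T$-theory consisting of $\mathrm{PA}$ (induction only for $\mathcal{L}_{\mathrm{PA}}$-formulae) and the axioms: (1a) $\forall s,t\,(T(s=t)\equiv s^\circ=t^\circ)$; (1b) $\forall s,t\,(T(\neg s=t)\equiv s^\circ\neq t^\circ)$; (2a) $\forall\phi,\psi\,(T(\phi\vee\psi)\equiv T(\phi)\vee T(\psi))$; (2b) $\forall\phi,\psi\,(T(\neg(\phi\vee\psi))\equiv T(\neg\phi)\wedge T(\neg\psi))$; (3a) $\forall v\forall\phi(v)\,(T(\exists v\phi)\equiv\exists x\,T(\phi(\underline{x})))$;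 (3b) $\forall v\forall\phi(v)\,(T(\neg\exists v\phi)\equiv\forall x\,T(\neg\phi(\underline{x})))$; (4) $\forall\phi\,(T(\neg\neg\phi)\equiv T(\phi))$; (5) $\forall\phi(v)\,\forall s,t\,(s^\circ=t^\circ\rightarrow(T(\phi(s))\equiv T(\phi(t))))$. Let $\mathrm{INT}(\phi(v))$ abbreviate $\forall x\,\bigl(T(\phi(\underline{x}))\rightarrow T(\phi(\underline{x+1}))\bigr)\rightarrow\bigl(T(\phi(0))\rightarrow\forall x\,T(\phi(\underline{x}))\bigr)$. Let $\mathrm{tot}(\phi(v))$ be "$\phi(v)$ is an $\mathcal{L}_{\mathrm{PA}}$-formula with at most one free variable, and $\forall x\,(T(\phi(\underline{x}))\vee T(\neg\phi(\underline{x})))$". $\mathrm{INT}$ is the sentence $\forall\phi(v)\,\mathrm{INT}(\phi(v))$ and $\mathrm{INT}\upharpoonright_{\mathrm{tot}}$ is the sentence $\forall\phi(v)\,[\mathrm{tot}(\phi(v))\rightarrow\mathrm{INT}(\phi(v))]$. Relative truth definability (Fujimoto). For truth theories $\mathrm{Th}_1,\mathrm{Th}_2$, a sentence $\Theta$ of the language of $\mathrm{Th}_2$ and a formula $\phi(x)$ of the language of $\mathrm{Th}_1$ with precisely one free variable, $\Theta^{\phi(x)}$ denotes the result of substituting $\phi(x)$ for every occurrence of $T_{\mathrm{Th}_2}(x)$ in $\Theta$, where $T_{\mathrm{Th}_2}$ is the truth predicate of $\mathrm{Th}_2$ (renaming variables if necessary; the arithmetical vocabulary is unchanged). $\mathrm{Th}_1$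 relatively truth defines $\mathrm{Th}_2$ iff there is such a formula $\phi(x)$ with $\mathrm{Th}_1\vdash\Theta^{\phi(x)}$ for every axiom $\Theta$ of $\mathrm{Th}_2$. *)

theory Defs
  imports Main
begin

section \<open>First-order syntax\<close>

datatype tm = Var nat | Zero | Succ tm | Add tm tm (infixl "\<^bold>+" 65) | Mul tm tm (infixl "\<^bold>*" 70)

text \<open>
  Formulae of arithmetic extended by one unary predicate \<open>Tr\<close>; negation, disjunction
  and existential quantification are primitive.
\<close>

datatype fm =
    Eql tm tm (infix "\<^bold>=" 50)
  | Tr tm
  | Neg fm ("\<^bold>\<not> _" [40] 40)
  | Dis fm fm (infixr "\<^bold>\<or>" 30)
  | Exi nat fm

abbreviation Con :: "fm \<Rightarrow> fm \<Rightarrow> fm" (infixr "\<^bold>\<and>" 35)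
  where "p \<^bold>\<and> q \<equiv> \<^bold>\<not> (\<^bold>\<not> p \<^bold>\<or> \<^bold>\<not> q)"

abbreviation Imp :: "fm \<Rightarrow> fm \<Rightarrow> fm" (infixr "\<^bold>\<longrightarrow>" 25)
  where "p \<^bold>\<longrightarrow> q \<equiv> \<^bold>\<not> p \<^bold>\<or> q"

abbreviation Iff :: "fm \<Rightarrow> fm \<Rightarrow> fm" (infix "\<^bold>\<longleftrightarrow>" 25)
  where "p \<^bold>\<longleftrightarrow> q \<equiv> (p \<^bold>\<longrightarrow> q) \<^bold>\<and> (q \<^bold>\<longrightarrow> p)"

abbreviation Uni :: "nat \<Rightarrow> fm \<Rightarrow> fm"
  where "Uni n p \<equiv> \<^bold>\<not> Exi n (\<^bold>\<not> p)"

primrec fvt :: "tm \<Rightarrow> nat set" where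
  "fvt (Var n) = {n}"
| "fvt Zero = {}"
| "fvt (Succ s) = fvt s"
| "fvt (s \<^bold>+ t) = fvt s \<union> fvt t"
| "fvt (s \<^bold>* t) = fvt s \<union> fvt t"

primrec fv :: "fm \<Rightarrow> nat set" where
  "fv (s \<^bold>= t) = fvt s \<union> fvt t"
| "fv (Tr t) = fvt t"
| "fv (\<^bold>\<not> p) = fv p"
| "fv (p \<^bold>\<or> q) = fv p \<union> fv q"
| "fv (Exi n p) = fv p - {n}"

primrec substt :: "(nat \<Rightarrow> tm) \<Rightarrow> tm \<Rightarrow> tm" where
  "substt \<sigma> (Var n) = \<sigma> n"
| "substt \<sigma> Zero = Zero"
| "substt \<sigma> (Succ s) = Succ (substt \<sigma> s)"
| "substt \<sigma> (s \<^bold>+ t) = substt \<sigma> s \<^bold>+ substt \<sigma> t"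
| "substt \<sigma> (s \<^bold>* t) = substt \<sigma> s \<^bold>* substt \<sigma> t"

text \<open>
  Simultaneous substitution. A bound variable is renamed exactly when it would capture a
  variable of a substituted term.
\<close>

primrec subst :: "(nat \<Rightarrow> tm) \<Rightarrow> fm \<Rightarrow> fm" where
  "subst \<sigma> (s \<^bold>= t) = (substt \<sigma> s \<^bold>= substt \<sigma> t)"
| "subst \<sigma> (Tr t) = Tr (substt \<sigma> t)"
| "subst \<sigma> (\<^bold>\<not> p) = (\<^bold>\<not> subst \<sigma> p)"
| "subst \<sigma> (p \<^bold>\<or> q) = (subst \<sigma> p \<^bold>\<or> subst \<sigma> q)"
| "subst \<sigma> (Exi n p) =
     (let F = (\<Union>m \<in> fv p - {n}. fvt (\<sigma> m));
          k = (if n \<in> F then Suc (Max F) else n)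
      in Exi k (subst (\<sigma>(n := Var k)) p))"

abbreviation subst1 :: "fm \<Rightarrow> nat \<Rightarrow> tm \<Rightarrow> fm"
  where "subst1 p n t \<equiv> subst (Var(n := t)) p"

primrec arithmetical :: "fm \<Rightarrow> bool" where
  "arithmetical (s \<^bold>= t) = True"
| "arithmetical (Tr t) = False"
| "arithmetical (\<^bold>\<not> p) = arithmetical p"
| "arithmetical (p \<^bold>\<or> q) = (arithmetical p \<and> arithmetical q)"
| "arithmetical (Exi n p) = arithmetical p"

definition univ_closure :: "fm \<Rightarrow> fm"
  where "univ_closure p = foldr Uni (sorted_list_of_set (fv p)) p"

section \<open>Derivability in classical first-order logic with equality\<close>

inductive derives :: "fm set \<Rightarrow> fm \<Rightarrow> bool" (infix "\<turnstile>" 20) where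
  Assm: "p \<in> \<Gamma> \<Longrightarrow> \<Gamma> \<turnstile> p"
| NegI: "insert p \<Gamma> \<turnstile> q \<Longrightarrow> insert p \<Gamma> \<turnstile> \<^bold>\<not> q \<Longrightarrow> \<Gamma> \<turnstile> \<^bold>\<not> p"
| Classical: "insert (\<^bold>\<not> p) \<Gamma> \<turnstile> q \<Longrightarrow> insert (\<^bold>\<not> p) \<Gamma> \<turnstile> \<^bold>\<not> q \<Longrightarrow> \<Gamma> \<turnstile> p"
| DisI1: "\<Gamma> \<turnstile> p \<Longrightarrow> \<Gamma> \<turnstile> p \<^bold>\<or> q"
| DisI2: "\<Gamma> \<turnstile> q \<Longrightarrow> \<Gamma> \<turnstile> p \<^bold>\<or> q"
| DisE: "\<Gamma> \<turnstile> p \<^bold>\<or> q \<Longrightarrow> insert p \<Gamma> \<turnstile> r \<Longrightarrow> insert q \<Gamma> \<turnstile> r \<Longrightarrow> \<Gamma> \<turnstile> r"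
| ExiI: "\<Gamma> \<turnstile> subst1 p n t \<Longrightarrow> \<Gamma> \<turnstile> Exi n p"
| ExiE: "\<Gamma> \<turnstile> Exi n p \<Longrightarrow> insert (subst1 p n (Var m)) \<Gamma> \<turnstile> r \<Longrightarrow>
         m \<notin> fv (Exi n p) \<Longrightarrow> m \<notin> fv r \<Longrightarrow> (\<forall>q \<in> \<Gamma>. m \<notin> fv q) \<Longrightarrow> \<Gamma> \<turnstile> r"
| Refl: "\<Gamma> \<turnstile> t \<^bold>= t"
| Replace: "\<Gamma> \<turnstile> s \<^bold>= t \<Longrightarrow> \<Gamma> \<turnstile> subst1 p n s \<Longrightarrow> \<Gamma> \<turnstile> subst1 p n t"

section \<open>Writing formulae with bound variables\<close>

primrec maxvart :: "tm \<Rightarrow> nat" where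
  "maxvart (Var n) = n"
| "maxvart Zero = 0"
| "maxvart (Succ s) = maxvart s"
| "maxvart (s \<^bold>+ t) = max (maxvart s) (maxvart t)"
| "maxvart (s \<^bold>* t) = max (maxvart s) (maxvart t)"

primrec maxvar :: "fm \<Rightarrow> nat" where
  "maxvar (s \<^bold>= t) = max (maxvart s) (maxvart t)"
| "maxvar (Tr t) = maxvart t"
| "maxvar (\<^bold>\<not> p) = maxvar p"
| "maxvar (p \<^bold>\<or> q) = max (maxvar p) (maxvar q)"
| "maxvar (Exi n p) = max n (maxvar p)"

text \<open>
  \<open>\<^bold>\<exists>x. f x\<close> quantifies a variable whose index exceeds that of every variable, free or
  bound, of \<open>f Zero\<close>, so it differs from all free variables of the body other than \<open>x\<close>.
  A quantifier inside \<open>f\<close> likewise picks an index above that of \<open>x\<close>, so no variable is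
  captured.
\<close>

definition ex :: "(tm \<Rightarrow> fm) \<Rightarrow> fm" (binder "\<^bold>\<exists>" 10)
  where "ex f = (let n = Suc (maxvar (f Zero)) in Exi n (f (Var n)))"

abbreviation all :: "(tm \<Rightarrow> fm) \<Rightarrow> fm" (binder "\<^bold>\<forall>" 10)
  where "all f \<equiv> \<^bold>\<not> (\<^bold>\<exists>x. \<^bold>\<not> f x)"

section \<open>Peano arithmetic\<close>

definition induction_axiom :: "nat \<Rightarrow> fm \<Rightarrow> fm"
  where "induction_axiom n p =
    univ_closure (subst1 p n Zero \<^bold>\<and> Uni n (p \<^bold>\<longrightarrow> subst1 p n (Succ (Var n))) \<^bold>\<longrightarrow> Uni n p)"

definition PA :: "fm set"
  where "PA =
    {\<^bold>\<forall>x. \<^bold>\<not> Succ x \<^bold>= Zero,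
     \<^bold>\<forall>x. \<^bold>\<forall>y. Succ x \<^bold>= Succ y \<^bold>\<longrightarrow> x \<^bold>= y,
     \<^bold>\<forall>x. x \<^bold>+ Zero \<^bold>= x,
     \<^bold>\<forall>x. \<^bold>\<forall>y. x \<^bold>+ Succ y \<^bold>= Succ (x \<^bold>+ y),
     \<^bold>\<forall>x. x \<^bold>* Zero \<^bold>= Zero,
     \<^bold>\<forall>x. \<^bold>\<forall>y. x \<^bold>* Succ y \<^bold>= x \<^bold>* y \<^bold>+ x}
    \<union> {induction_axiom n p | n p. arithmetical p}"

section \<open>Arithmetized syntax\<close>

definition Leq :: "tm \<Rightarrow> tm \<Rightarrow> fm" (infix "\<^bold>\<le>" 50)
  where "Leq s t = (\<^bold>\<exists>z. s \<^bold>+ z \<^bold>= t)"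

text \<open>Goedel's beta function: \<open>r\<close> is the remainder of \<open>a\<close> modulo \<open>1 + (i + 1) * b\<close>.\<close>

definition Beta :: "tm \<Rightarrow> tm \<Rightarrow> tm \<Rightarrow> tm \<Rightarrow> fm"
  where "Beta a b i r = (\<^bold>\<exists>q. a \<^bold>= q \<^bold>* Succ (Succ i \<^bold>* b) \<^bold>+ r \<^bold>\<and> r \<^bold>\<le> Succ i \<^bold>* b)"

abbreviation Mem :: "tm \<Rightarrow> tm \<Rightarrow> tm \<Rightarrow> fm"
  where "Mem a b u \<equiv> Beta a b u (Succ Zero)"

text \<open>
  The pairing \<open>(x + y) * (x + y) + x\<close> is injective and is a term of the language, hence so
  are the constructors on codes. All tags are positive, which makes every code strictly larger
  than the codes of its immediate subexpressions.
\<close>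

definition pair :: "tm \<Rightarrow> tm \<Rightarrow> tm"
  where "pair s t = (s \<^bold>+ t) \<^bold>* (s \<^bold>+ t) \<^bold>+ s"

primrec numeral_tm :: "nat \<Rightarrow> tm" where
  "numeral_tm 0 = Zero"
| "numeral_tm (Suc n) = Succ (numeral_tm n)"

definition cZero :: tm where "cZero = pair (numeral_tm 1) Zero"
definition cVar :: "tm \<Rightarrow> tm" where "cVar i = pair (numeral_tm 2) i"
definition cSucc :: "tm \<Rightarrow> tm" where "cSucc s = pair (numeral_tm 3) s"
definition cAdd :: "tm \<Rightarrow> tm \<Rightarrow> tm" where "cAdd s t = pair (numeral_tm 4) (pair s t)"
definition cMul :: "tm \<Rightarrow> tm \<Rightarrow> tm" where "cMul s t = pair (numeral_tm 5) (pair s t)"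
definition cEql :: "tm \<Rightarrow> tm \<Rightarrow> tm" where "cEql s t = pair (numeral_tm 6) (pair s t)"
definition cNeg :: "tm \<Rightarrow> tm" where "cNeg p = pair (numeral_tm 7) p"
definition cDis :: "tm \<Rightarrow> tm \<Rightarrow> tm" where "cDis p q = pair (numeral_tm 8) (pair p q)"
definition cExi :: "tm \<Rightarrow> tm \<Rightarrow> tm" where "cExi v p = pair (numeral_tm 9) (pair v p)"

definition IsVar :: "tm \<Rightarrow> fm"
  where "IsVar v = (\<^bold>\<exists>i. v \<^bold>= cVar i)"

text \<open>
  Inductive notions are expressed by a finite set, coded by \<open>a\<close> and \<open>b\<close>, which contains \<open>x\<close>
  and each of whose elements below \<open>x\<close> is obtained by some clause from smaller elements.
\<close>

definition IsTerm :: "tm \<Rightarrow> fm"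
  where "IsTerm x = (\<^bold>\<exists>a. \<^bold>\<exists>b. Mem a b x \<^bold>\<and> (\<^bold>\<forall>u. u \<^bold>\<le> x \<^bold>\<and> Mem a b u \<^bold>\<longrightarrow>
      u \<^bold>= cZero
    \<^bold>\<or> IsVar u
    \<^bold>\<or> (\<^bold>\<exists>s. u \<^bold>= cSucc s \<^bold>\<and> Mem a b s)
    \<^bold>\<or> (\<^bold>\<exists>s. \<^bold>\<exists>t. (u \<^bold>= cAdd s t \<^bold>\<or> u \<^bold>= cMul s t) \<^bold>\<and> Mem a b s \<^bold>\<and> Mem a b t)))"

definition IsForm :: "tm \<Rightarrow> fm"
  where "IsForm x = (\<^bold>\<exists>a. \<^bold>\<exists>b. Mem a b x \<^bold>\<and> (\<^bold>\<forall>u. u \<^bold>\<le> x \<^bold>\<and> Mem a b u \<^bold>\<longrightarrow>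
      (\<^bold>\<exists>s. \<^bold>\<exists>t. u \<^bold>= cEql s t \<^bold>\<and> IsTerm s \<^bold>\<and> IsTerm t)
    \<^bold>\<or> (\<^bold>\<exists>p. u \<^bold>= cNeg p \<^bold>\<and> Mem a b p)
    \<^bold>\<or> (\<^bold>\<exists>p. \<^bold>\<exists>q. u \<^bold>= cDis p q \<^bold>\<and> Mem a b p \<^bold>\<and> Mem a b q)
    \<^bold>\<or> (\<^bold>\<exists>v. \<^bold>\<exists>p. u \<^bold>= cExi v p \<^bold>\<and> IsVar v \<^bold>\<and> Mem a b p)))"

text \<open>The variable \<open>v\<close> occurs free in the term or formula \<open>x\<close>.\<close>

definition FreeIn :: "tm \<Rightarrow> tm \<Rightarrow> fm"
  where "FreeIn v x = (\<^bold>\<exists>a. \<^bold>\<exists>b. Mem a b x \<^bold>\<and> (\<^bold>\<forall>u. u \<^bold>\<le> x \<^bold>\<and> Mem a b u \<^bold>\<longrightarrow>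
      u \<^bold>= v
    \<^bold>\<or> (\<^bold>\<exists>p. (u \<^bold>= cSucc p \<^bold>\<or> u \<^bold>= cNeg p) \<^bold>\<and> Mem a b p)
    \<^bold>\<or> (\<^bold>\<exists>p. \<^bold>\<exists>q. (u \<^bold>= cAdd p q \<^bold>\<or> u \<^bold>= cMul p q \<^bold>\<or> u \<^bold>= cEql p q \<^bold>\<or> u \<^bold>= cDis p q)
          \<^bold>\<and> (Mem a b p \<^bold>\<or> Mem a b q))
    \<^bold>\<or> (\<^bold>\<exists>w. \<^bold>\<exists>p. u \<^bold>= cExi w p \<^bold>\<and> \<^bold>\<not> w \<^bold>= v \<^bold>\<and> Mem a b p)))"

definition IsClosedTerm :: "tm \<Rightarrow> fm"
  where "IsClosedTerm x = (IsTerm x \<^bold>\<and> (\<^bold>\<forall>v. IsVar v \<^bold>\<longrightarrow> \<^bold>\<not> FreeIn v x))"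

definition IsSent :: "tm \<Rightarrow> fm"
  where "IsSent x = (IsForm x \<^bold>\<and> (\<^bold>\<forall>v. IsVar v \<^bold>\<longrightarrow> \<^bold>\<not> FreeIn v x))"

text \<open>
  The quantification ``for all formulae \<open>p(v)\<close> with at most one free variable'' ranges over
  the pairs of a variable \<open>v\<close> and a formula \<open>p\<close> in which no variable other than \<open>v\<close> is free.
\<close>

definition IsForm1 :: "tm \<Rightarrow> tm \<Rightarrow> fm"
  where "IsForm1 v x = (IsVar v \<^bold>\<and> IsForm x \<^bold>\<and> (\<^bold>\<forall>w. IsVar w \<^bold>\<and> FreeIn w x \<^bold>\<longrightarrow> w \<^bold>= v))"

text \<open>
  Recursively defined functions are expressed by a finite function, coded by \<open>a\<close> and \<open>b\<close>,
  that satisfies the recursion equations up to the argument.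
\<close>

text \<open>\<open>y\<close> is the code of the standard numeral for \<open>x\<close>.\<close>

definition Num :: "tm \<Rightarrow> tm \<Rightarrow> fm"
  where "Num x y = (\<^bold>\<exists>a. \<^bold>\<exists>b. Beta a b Zero cZero
    \<^bold>\<and> (\<^bold>\<forall>i. Succ i \<^bold>\<le> x \<^bold>\<longrightarrow> (\<^bold>\<exists>r. Beta a b i r \<^bold>\<and> Beta a b (Succ i) (cSucc r)))
    \<^bold>\<and> Beta a b x y)"

text \<open>\<open>y\<close> is the value of the closed term \<open>x\<close>.\<close>

definition Val :: "tm \<Rightarrow> tm \<Rightarrow> fm"
  where "Val x y = (\<^bold>\<exists>a. \<^bold>\<exists>b. Beta a b x y \<^bold>\<and> (\<^bold>\<forall>u. u \<^bold>\<le> x \<^bold>\<longrightarrow>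
      (u \<^bold>= cZero \<^bold>\<longrightarrow> Beta a b u Zero)
    \<^bold>\<and> (\<^bold>\<forall>s. u \<^bold>= cSucc s \<^bold>\<longrightarrow> (\<^bold>\<exists>m. Beta a b s m \<^bold>\<and> Beta a b u (Succ m)))
    \<^bold>\<and> (\<^bold>\<forall>s. \<^bold>\<forall>t. u \<^bold>= cAdd s t \<^bold>\<longrightarrow>
          (\<^bold>\<exists>m. \<^bold>\<exists>n. Beta a b s m \<^bold>\<and> Beta a b t n \<^bold>\<and> Beta a b u (m \<^bold>+ n)))
    \<^bold>\<and> (\<^bold>\<forall>s. \<^bold>\<forall>t. u \<^bold>= cMul s t \<^bold>\<longrightarrow>
          (\<^bold>\<exists>m. \<^bold>\<exists>n. Beta a b s m \<^bold>\<and> Beta a b t n \<^bold>\<and> Beta a b u (m \<^bold>* n)))))"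

text \<open>
  \<open>y\<close> is the result of replacing the free occurrences of the variable \<open>v\<close> in the term or
  formula \<open>x\<close> by \<open>s\<close>. It is only used for closed \<open>s\<close>, so nothing can be captured.
\<close>

definition Sub :: "tm \<Rightarrow> tm \<Rightarrow> tm \<Rightarrow> tm \<Rightarrow> fm"
  where "Sub x v s y = (\<^bold>\<exists>a. \<^bold>\<exists>b. Beta a b x y \<^bold>\<and> (\<^bold>\<forall>u. u \<^bold>\<le> x \<^bold>\<longrightarrow>
      (u \<^bold>= cZero \<^bold>\<longrightarrow> Beta a b u cZero)
    \<^bold>\<and> (u \<^bold>= v \<^bold>\<longrightarrow> Beta a b u s)
    \<^bold>\<and> (IsVar u \<^bold>\<and> \<^bold>\<not> u \<^bold>= v \<^bold>\<longrightarrow> Beta a b u u)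
    \<^bold>\<and> (\<^bold>\<forall>p. u \<^bold>= cSucc p \<^bold>\<longrightarrow> (\<^bold>\<exists>m. Beta a b p m \<^bold>\<and> Beta a b u (cSucc m)))
    \<^bold>\<and> (\<^bold>\<forall>p. \<^bold>\<forall>q. u \<^bold>= cAdd p q \<^bold>\<longrightarrow>
          (\<^bold>\<exists>m. \<^bold>\<exists>n. Beta a b p m \<^bold>\<and> Beta a b q n \<^bold>\<and> Beta a b u (cAdd m n)))
    \<^bold>\<and> (\<^bold>\<forall>p. \<^bold>\<forall>q. u \<^bold>= cMul p q \<^bold>\<longrightarrow>
          (\<^bold>\<exists>m. \<^bold>\<exists>n. Beta a b p m \<^bold>\<and> Beta a b q n \<^bold>\<and> Beta a b u (cMul m n)))
    \<^bold>\<and> (\<^bold>\<forall>p. \<^bold>\<forall>q. u \<^bold>= cEql p q \<^bold>\<longrightarrow>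
          (\<^bold>\<exists>m. \<^bold>\<exists>n. Beta a b p m \<^bold>\<and> Beta a b q n \<^bold>\<and> Beta a b u (cEql m n)))
    \<^bold>\<and> (\<^bold>\<forall>p. u \<^bold>= cNeg p \<^bold>\<longrightarrow> (\<^bold>\<exists>m. Beta a b p m \<^bold>\<and> Beta a b u (cNeg m)))
    \<^bold>\<and> (\<^bold>\<forall>p. \<^bold>\<forall>q. u \<^bold>= cDis p q \<^bold>\<longrightarrow>
          (\<^bold>\<exists>m. \<^bold>\<exists>n. Beta a b p m \<^bold>\<and> Beta a b q n \<^bold>\<and> Beta a b u (cDis m n)))
    \<^bold>\<and> (\<^bold>\<forall>p. u \<^bold>= cExi v p \<^bold>\<longrightarrow> Beta a b u u)
    \<^bold>\<and> (\<^bold>\<forall>w. \<^bold>\<forall>p. u \<^bold>= cExi w p \<^bold>\<and> \<^bold>\<not> w \<^bold>= v \<^bold>\<longrightarrow>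
          (\<^bold>\<exists>m. Beta a b p m \<^bold>\<and> Beta a b u (cExi w m)))))"

section \<open>The truth theories\<close>

definition SameVal :: "tm \<Rightarrow> tm \<Rightarrow> fm"
  where "SameVal s t = (\<^bold>\<exists>x. Val s x \<^bold>\<and> Val t x)"

text \<open>\<open>T(p(s))\<close> for a closed term \<open>s\<close> substituted for \<open>v\<close>.\<close>

definition TrSub :: "tm \<Rightarrow> tm \<Rightarrow> tm \<Rightarrow> fm"
  where "TrSub p v s = (\<^bold>\<exists>y. Sub p v s y \<^bold>\<and> Tr y)"

text \<open>\<open>T(p(x))\<close> with the numeral for \<open>x\<close> substituted for \<open>v\<close>.\<close>

definition TrNum :: "tm \<Rightarrow> tm \<Rightarrow> tm \<Rightarrow> fm"
  where "TrNum p v x = (\<^bold>\<exists>s. Num x s \<^bold>\<and> TrSub p v s)"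

definition PT_minus :: "fm set"
  where "PT_minus = PA \<union>
    {\<^bold>\<forall>s. \<^bold>\<forall>t. IsClosedTerm s \<^bold>\<and> IsClosedTerm t \<^bold>\<longrightarrow> (Tr (cEql s t) \<^bold>\<longleftrightarrow> SameVal s t),
     \<^bold>\<forall>s. \<^bold>\<forall>t. IsClosedTerm s \<^bold>\<and> IsClosedTerm t \<^bold>\<longrightarrow> (Tr (cNeg (cEql s t)) \<^bold>\<longleftrightarrow> \<^bold>\<not> SameVal s t),
     \<^bold>\<forall>p. \<^bold>\<forall>q. IsSent p \<^bold>\<and> IsSent q \<^bold>\<longrightarrow> (Tr (cDis p q) \<^bold>\<longleftrightarrow> Tr p \<^bold>\<or> Tr q),
     \<^bold>\<forall>p. \<^bold>\<forall>q. IsSent p \<^bold>\<and> IsSent q \<^bold>\<longrightarrow> (Tr (cNeg (cDis p q)) \<^bold>\<longleftrightarrow> Tr (cNeg p) \<^bold>\<and> Tr (cNeg q)),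
     \<^bold>\<forall>v. \<^bold>\<forall>p. IsForm1 v p \<^bold>\<longrightarrow> (Tr (cExi v p) \<^bold>\<longleftrightarrow> (\<^bold>\<exists>x. TrNum p v x)),
     \<^bold>\<forall>v. \<^bold>\<forall>p. IsForm1 v p \<^bold>\<longrightarrow> (Tr (cNeg (cExi v p)) \<^bold>\<longleftrightarrow> (\<^bold>\<forall>x. TrNum (cNeg p) v x)),
     \<^bold>\<forall>p. IsSent p \<^bold>\<longrightarrow> (Tr (cNeg (cNeg p)) \<^bold>\<longleftrightarrow> Tr p),
     \<^bold>\<forall>v. \<^bold>\<forall>p. \<^bold>\<forall>s. \<^bold>\<forall>t. IsForm1 v p \<^bold>\<and> IsClosedTerm s \<^bold>\<and> IsClosedTerm t \<^bold>\<longrightarrow>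
       (SameVal s t \<^bold>\<longrightarrow> (TrSub p v s \<^bold>\<longleftrightarrow> TrSub p v t))}"

definition Int_at :: "tm \<Rightarrow> tm \<Rightarrow> fm"
  where "Int_at v p = ((\<^bold>\<forall>x. TrNum p v x \<^bold>\<longrightarrow> TrNum p v (Succ x)) \<^bold>\<longrightarrow>
    (TrNum p v Zero \<^bold>\<longrightarrow> (\<^bold>\<forall>x. TrNum p v x)))"

definition Tot :: "tm \<Rightarrow> tm \<Rightarrow> fm"
  where "Tot v p = (IsForm1 v p \<^bold>\<and> (\<^bold>\<forall>x. TrNum p v x \<^bold>\<or> TrNum (cNeg p) v x))"

definition INT_all :: fm
  where "INT_all = (\<^bold>\<forall>v. \<^bold>\<forall>p. IsForm1 v p \<^bold>\<longrightarrow> Int_at v p)"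

definition INT_tot :: fm
  where "INT_tot = (\<^bold>\<forall>v. \<^bold>\<forall>p. Tot v p \<^bold>\<longrightarrow> Int_at v p)"

section \<open>Relative truth definability\<close>

text \<open>
  Replaces every \<open>Tr t\<close> by the formula \<open>p\<close> with \<open>t\<close> put for its free variable \<open>n\<close>. As \<open>p\<close>
  has no other free variable, a quantifier outside \<open>Tr t\<close> cannot capture a variable of \<open>p\<close>.
\<close>

primrec replace_truth :: "nat \<Rightarrow> fm \<Rightarrow> fm \<Rightarrow> fm" where
  "replace_truth n p (s \<^bold>= t) = (s \<^bold>= t)"
| "replace_truth n p (Tr t) = subst1 p n t"
| "replace_truth n p (\<^bold>\<not> q) = (\<^bold>\<not> replace_truth n p q)"
| "replace_truth n p (q \<^bold>\<or> r) = (replace_truth n p q \<^bold>\<or> replace_truth n p r)"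
| "replace_truth n p (Exi m q) = Exi m (replace_truth n p q)"

definition relatively_truth_defines :: "fm set \<Rightarrow> fm set \<Rightarrow> bool"
  where "relatively_truth_defines Th1 Th2 \<longleftrightarrow>
    (\<exists>n p. fv p = {n} \<and> (\<forall>\<Theta> \<in> Th2. Th1 \<turnstile> replace_truth n p \<Theta>))"

end

theory Submission
  imports Defs "HOL-Library.Function_Algebras" "HOL-Number_Theory.Cong"
begin

text \<open>
  The theory \<open>PT\<^sup>- + INT\<restriction>tot\<close> has a model \<open>(M, T)\<close> in which the truth predicate is determined by the
  arithmetical structure of \<open>M\<close>, whereas no truth predicate of that kind can satisfy full internal
  induction over \<open>M\<close>. A formula that relatively truth defines the stronger theory would define such
  a predicate in \<open>(M, T)\<close>, which is impossible.

  Let \<open>M\<close> be an ultrapower of the standard model over a free ultrafilter on the natural numbers.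
  As \<open>M\<close> satisfies true arithmetic, all facts about coded syntax have to be checked in the standard
  model only (\<open>Los\<close>), and \<open>M\<close> realizes all countable types (\<open>saturation\<close>). Let \<open>T\<close> consist of the
  sentences of \<open>M\<close> that are obtained in some standard number \<open>N\<close> of steps by reading the positive
  truth axioms from right to left. Saturation turns ``for every \<open>x\<close> some standard rank suffices'' into
  a rank that suffices for all \<open>x\<close>. This yields the axiom for negated quantifiers, and it makes the
  extension of a total formula internal, hence inductive (\<open>Tmin_PT_minus\<close>, \<open>Tmin_INT_tot\<close>). Truth of
  rank at most \<open>N\<close> is arithmetically definable for each standard \<open>N\<close>. So a back-and-forth argument
  shows that tuples with the same arithmetical type satisfy the same formulae in \<open>(M, T)\<close>
  (\<open>same_type_Tmin\<close>); in particular this applies to every set \<open>T'\<close> defined in \<open>(M, T)\<close>.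

  Suppose that \<open>T'\<close> satisfies \<open>PT\<^sup>- + INT\<close>. Let \<open>\<theta>\<^sub>0, \<theta>\<^sub>1, \<dots>\<close> enumerate the arithmetical formulae, let
  \<open>\<chi>\<^sub>j(x, y)\<close> say that \<open>x\<close> and \<open>y\<close> agree on \<open>\<theta>\<^sub>j\<close>, and consider the formula of nonstandard length
  \<open>k = 0 \<or> (\<chi>\<^sub>0 \<and> (k = 1 \<or> (\<chi>\<^sub>1 \<and> \<dots>)))\<close>.
  It needs no negation of its nonstandard parts. For each standard \<open>j\<close> it can be unfolded \<open>j\<close> times by means
  of the truth axioms. Hence, according to \<open>T'\<close>, it expresses agreement on \<open>\<theta>\<^sub>0, \<dots>, \<theta>\<^bsub>k-1\<^esub>\<close> if \<open>k\<close> is standard, while for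
  nonstandard \<open>k\<close> it implies agreement on every \<open>\<theta>\<^sub>j\<close> (\<open>ev_agree_standard\<close>, \<open>ev_agree_nonstandard\<close>). By the
  pigeonhole principle, for each standard \<open>k\<close> there are \<open>x < y\<close> that agree in this sense. Internal
  induction gives overspill: such \<open>x < y\<close> exist for some nonstandard \<open>k\<close> as well
  (\<open>has_twins_nonstandard\<close>). A second induction, downwards from a bound, gives a least such \<open>x\<close>
  (\<open>has_twins_greatest\<close>). But then \<open>x\<close> is the only element with a property expressed by means of \<open>T'\<close>,
  although \<open>y\<close> has the same arithmetical type as \<open>x\<close>. Both uses of induction concern formulae that
  are not known to be total, nor is \<open>T'\<close> known to be consistent on them.
\<close>

section \<open>Semantics and soundness\<close>

primrec tval :: "(nat \<Rightarrow> 'a::semiring_1) \<Rightarrow> tm \<Rightarrow> 'a" where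
  "tval e (Var n) = e n"
| "tval e Zero = 0"
| "tval e (Succ s) = tval e s + 1"
| "tval e (s \<^bold>+ t) = tval e s + tval e t"
| "tval e (s \<^bold>* t) = tval e s * tval e t"

text \<open>
  Equality is interpreted by an arbitrary relation \<open>E\<close>: in the ultrapower below, elements are
  sequences of numbers and equality is equality almost everywhere.
\<close>

primrec sat :: "('a \<Rightarrow> 'a \<Rightarrow> bool) \<Rightarrow> ('a::semiring_1 \<Rightarrow> bool) \<Rightarrow> (nat \<Rightarrow> 'a) \<Rightarrow> fm \<Rightarrow> bool" where
  "sat E T e (s \<^bold>= t) = E (tval e s) (tval e t)"
| "sat E T e (Tr t) = T (tval e t)"
| "sat E T e (\<^bold>\<not> p) = (\<not> sat E T e p)"
| "sat E T e (p \<^bold>\<or> q) = (sat E T e p \<or> sat E T e q)"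
| "sat E T e (Exi n p) = (\<exists>x. sat E T (e(n := x)) p)"

lemma finite_fvt [simp]: "finite (fvt t)"
  by (induction t) auto

lemma finite_fv [simp]: "finite (fv p)"
  by (induction p) auto

lemma tval_cong: "(\<And>i. i \<in> fvt t \<Longrightarrow> e i = e' i) \<Longrightarrow> tval e t = tval e' t"
  by (induction t) auto

lemma sat_cong: "(\<And>i. i \<in> fv p \<Longrightarrow> e i = e' i) \<Longrightarrow> sat E T e p = sat E T e' p"
proof (induction p arbitrary: e e')
  case (Eql s t)
  then show ?case using tval_cong[of s e e'] tval_cong[of t e e'] by simp
next
  case (Tr t)
  then show ?case using tval_cong[of t e e'] by simp
next
  case (Exi n p)
  have "sat E T (e(n := x)) p = sat E T (e'(n := x)) p" for x
    by (rule Exi.IH) (use Exi.prems in auto)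
  then show ?case by simp
next
  case (Neg p)
  then show ?case by (metis fv.simps(3) sat.simps(3))
next
  case (Dis p q)
  then show ?case by (metis UnCI fv.simps(4) sat.simps(4))
qed

lemma sat_arithmetical: "arithmetical p \<Longrightarrow> sat E T e p = sat E T' e p"
  by (induction p arbitrary: e) auto

lemma tval_substt: "tval e (substt \<sigma> t) = tval (\<lambda>i. tval e (\<sigma> i)) t"
  by (induction t) auto

lemma sat_subst: "sat E T e (subst \<sigma> p) = sat E T (\<lambda>i. tval e (\<sigma> i)) p"
proof (induction p arbitrary: e \<sigma>)
  case (Exi n p)
  define F where "F = (\<Union>m \<in> fv p - {n}. fvt (\<sigma> m))"
  define k where "k = (if n \<in> F then Suc (Max F) else n)"
  have "finite F" by (simp add: F_def)
  then have "k \<notin> F"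
    using Max_ge[of F "Suc (Max F)"] by (auto simp: k_def simp del: Max_ge)
  have "sat E T (e(k := x)) (subst (\<sigma>(n := Var k)) p)
      = sat E T ((\<lambda>i. tval e (\<sigma> i))(n := x)) p" for x
    unfolding Exi.IH
  proof (rule sat_cong)
    fix i assume i: "i \<in> fv p"
    show "tval (e(k := x)) ((\<sigma>(n := Var k)) i) = ((\<lambda>i. tval e (\<sigma> i))(n := x)) i"
    proof (cases "i = n")
      case False
      then have "k \<notin> fvt (\<sigma> i)"
        using i \<open>k \<notin> F\<close> by (auto simp: F_def)
      then have "tval (e(k := x)) (\<sigma> i) = tval e (\<sigma> i)"
        by (intro tval_cong) auto
      then show ?thesis using False by simp
    qed simp
  qed
  moreover have "subst \<sigma> (Exi n p) = Exi k (subst (\<sigma>(n := Var k)) p)"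
    by (simp add: F_def k_def Let_def)
  ultimately show ?case by simp
qed (simp_all add: tval_substt)

lemma tval_fun_upd_Var: "(\<lambda>i. tval e ((Var(n := t)) i)) = e(n := tval e t)"
  by auto

lemma sat_subst1: "sat E T e (subst1 p n t) = sat E T (e(n := tval e t)) p"
  unfolding sat_subst tval_fun_upd_Var ..

text \<open>
  Substituting a formula for the truth predicate amounts to reinterpreting the predicate by the
  set that this formula defines. The hypothesis says that \<open>p\<close> depends on the variable \<open>n\<close>
  alone, so that the value of \<open>p\<close> is unaffected by the quantifiers above an occurrence of \<open>Tr\<close>.
\<close>

lemma sat_replace_truth:
  assumes "\<And>e e'. e n = e' n \<Longrightarrow> sat E T e p = sat E T e' p"
  shows "sat E T e (replace_truth n p q) = sat E (\<lambda>x. sat E T (d(n := x)) p) e q"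
proof (induction q arbitrary: e)
  case (Tr t)
  have "sat E T (e(n := tval e t)) p = sat E T (d(n := tval e t)) p"
    by (rule assms) simp
  then show ?case by (simp add: sat_subst1 del: fun_upd_apply)
qed auto

lemma arithmetical_subst [simp]: "arithmetical (subst \<sigma> p) = arithmetical p"
  by (induction p arbitrary: \<sigma>) (auto simp: Let_def)

lemma arithmetical_replace_truth:
  "arithmetical p \<Longrightarrow> arithmetical (replace_truth n p q)"
  by (induction q) auto

text \<open>
  Where equality is not the identity, the replacement rule is sound if the interpretation of
  every formula respects the relation that interprets equality.
\<close>

theorem soundness:
  assumes "\<Gamma> \<turnstile> p"
    and refl: "\<And>x. E x x"
    and cong: "\<And>x y e n p. E x y \<Longrightarrow> sat E T (e(n := x)) p \<Longrightarrow> sat E T (e(n := y)) p"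
    and "\<And>q. q \<in> \<Gamma> \<Longrightarrow> sat E T e q"
  shows "sat E T e p"
  using assms(1,4)
proof (induction arbitrary: e)
  case (ExiI \<Gamma> p n t)
  then show ?case by (auto simp: sat_subst1 simp del: fun_upd_apply)
next
  case (ExiE \<Gamma> n p m r)
  from ExiE.IH(1)[OF ExiE.prems] obtain x where x: "sat E T (e(n := x)) p" by auto
  let ?e = "e(m := x)"
  have "sat E T (?e(n := x)) p"
  proof -
    have "sat E T (?e(n := x)) p = sat E T (e(n := x)) p"
      by (rule sat_cong) (use ExiE.hyps in auto)
    then show ?thesis using x by simp
  qed
  then have 1: "sat E T ?e (subst1 p n (Var m))"
    by (simp add: sat_subst1)
  have 2: "sat E T ?e q" if "q \<in> \<Gamma>" for q
  proof -
    have "sat E T ?e q = sat E T e q"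
      by (rule sat_cong) (use ExiE.hyps that in auto)
    then show ?thesis using ExiE.prems that by simp
  qed
  have "sat E T ?e r" by (rule ExiE.IH(2)) (use 1 2 in blast)
  moreover have "sat E T ?e r = sat E T e r"
    by (rule sat_cong) (use ExiE.hyps in auto)
  ultimately show ?case by simp
next
  case (Refl \<Gamma> t)
  then show ?case by (simp add: refl)
next
  case (Replace \<Gamma> s t p n)
  then have "E (tval e s) (tval e t)" "sat E T (e(n := tval e s)) p"
    by (auto simp: sat_subst1 simp del: fun_upd_apply)
  then show ?case using cong by (simp add: sat_subst1 del: fun_upd_apply)
next
  case (NegI p \<Gamma> q) then show ?case by (metis insert_iff sat.simps(3))
next
  case (Classical p \<Gamma> q) then show ?case by (metis insert_iff sat.simps(3))
next
  case (DisE \<Gamma> p q r) then show ?case by (metis insert_iff sat.simps(4))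
qed auto

section \<open>Evaluating formulae written with bound variables\<close>

lemma tval_upd_fresh [simp]: "n \<notin> fvt t \<Longrightarrow> tval (e(n := x)) t = tval e t"
  by (rule tval_cong) auto

lemma fvt_le_maxvart: "i \<in> fvt t \<Longrightarrow> i \<le> maxvart t"
  by (induction t) auto

text \<open>
  The variable chosen by \<^const>\<open>ex\<close> depends on the whole body of the quantified formula. It is
  never computed: all that matters is that it lies above every variable of the body, and the
  elimination rules below extract from this that it differs from the variables of each term
  which occurs there.
\<close>

definition fresh :: "nat \<Rightarrow> fm \<Rightarrow> bool" where "fresh n p \<longleftrightarrow> maxvar p < n"

lemma fresh_fmE:
  "fresh n (\<^bold>\<not> p) \<Longrightarrow> (fresh n p \<Longrightarrow> R) \<Longrightarrow> R"
  "fresh n (p \<^bold>\<or> q) \<Longrightarrow> (fresh n p \<Longrightarrow> fresh n q \<Longrightarrow> R) \<Longrightarrow> R"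
  "fresh n (s \<^bold>= t) \<Longrightarrow> (n \<notin> fvt s \<Longrightarrow> n \<notin> fvt t \<Longrightarrow> R) \<Longrightarrow> R"
  "fresh n (Tr t) \<Longrightarrow> (n \<notin> fvt t \<Longrightarrow> R) \<Longrightarrow> R"
  "fresh n (ex f) \<Longrightarrow> (fresh n (f Zero) \<Longrightarrow> R) \<Longrightarrow> R"
  using fvt_le_maxvart[of n t] fvt_le_maxvart[of n s]
  by (auto simp: fresh_def ex_def Let_def)

lemma fresh_tmE:
  "n \<notin> fvt (Var k) \<Longrightarrow> (n \<noteq> k \<Longrightarrow> R) \<Longrightarrow> R"
  "n \<notin> fvt Zero \<Longrightarrow> R \<Longrightarrow> R"
  "n \<notin> fvt (Succ t) \<Longrightarrow> (n \<notin> fvt t \<Longrightarrow> R) \<Longrightarrow> R"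
  "n \<notin> fvt (s \<^bold>+ t) \<Longrightarrow> (n \<notin> fvt s \<Longrightarrow> n \<notin> fvt t \<Longrightarrow> R) \<Longrightarrow> R"
  "n \<notin> fvt (s \<^bold>* t) \<Longrightarrow> (n \<notin> fvt s \<Longrightarrow> n \<notin> fvt t \<Longrightarrow> R) \<Longrightarrow> R"
  by auto

text \<open>
  These rules, applied together with the elimination rules for \<^const>\<open>fresh\<close>, read a formula from
  the outside in, and so translate a defined arithmetical formula into its meaning.
\<close>

lemma sat_exI:
  assumes "\<And>n x. fresh n (f Zero) \<Longrightarrow> sat E T (e(n := x)) (f (Var n)) = Q x"
  shows "sat E T e (ex f) = (\<exists>x. Q x)"
  using assms[of "Suc (maxvar (f Zero))"] by (simp add: ex_def Let_def fresh_def)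

lemma sat_allI:
  assumes "\<And>n x. fresh n (f Zero) \<Longrightarrow> sat E T (e(n := x)) (f (Var n)) = Q x"
  shows "sat E T e (all f) = (\<forall>x. Q x)"
proof -
  have "sat E T e (\<^bold>\<exists>x. \<^bold>\<not> f x) = (\<exists>x. \<not> Q x)"
    by (rule sat_exI) (use assms in \<open>simp add: fresh_def\<close>)
  then show ?thesis by simp
qed

lemma sat_conI: "sat E T e p = P \<Longrightarrow> sat E T e q = Q \<Longrightarrow> sat E T e (p \<^bold>\<and> q) = (P \<and> Q)"
  by simp

lemma sat_disI: "sat E T e p = P \<Longrightarrow> sat E T e q = Q \<Longrightarrow> sat E T e (p \<^bold>\<or> q) = (P \<or> Q)"
  by simp

lemma sat_impI: "sat E T e p = P \<Longrightarrow> sat E T e q = Q \<Longrightarrow> sat E T e (p \<^bold>\<longrightarrow> q) = (P \<longrightarrow> Q)"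
  by simp

lemma sat_iffI: "sat E T e p = P \<Longrightarrow> sat E T e q = Q \<Longrightarrow> sat E T e (p \<^bold>\<longleftrightarrow> q) = (P \<longleftrightarrow> Q)"
  by auto

lemma sat_negI: "sat E T e p = P \<Longrightarrow> sat E T e (\<^bold>\<not> p) = (\<not> P)"
  by simp

text \<open>
  The second parts may be evaluated under the assumption that the first one holds; this is how
  the conditions on codes that guard the truth axioms become available.
\<close>

lemma sat_impI':
  "sat E S d p = P \<Longrightarrow> (P \<Longrightarrow> sat E S d q = Q) \<Longrightarrow> sat E S d (p \<^bold>\<longrightarrow> q) = (P \<longrightarrow> Q)"
  by auto

lemma sat_conI':
  "sat E S d p = P \<Longrightarrow> (P \<Longrightarrow> sat E S d q = Q) \<Longrightarrow> sat E S d (p \<^bold>\<and> q) = (P \<and> Q)"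
  by auto

lemmas sat_quantI = sat_allI sat_exI
lemmas sat_connI = sat_iffI sat_conI sat_impI sat_disI sat_negI

lemma fresh_Leq: "fresh n (Leq s t) \<Longrightarrow> (n \<notin> fvt s \<Longrightarrow> n \<notin> fvt t \<Longrightarrow> R) \<Longrightarrow> R"
  unfolding Leq_def by (elim fresh_fmE fresh_tmE) simp

lemma sat_Leq [simp]:
  fixes e :: "nat \<Rightarrow> nat"
  shows "sat (=) D e (Leq s t) = (tval e s \<le> tval e t)"
proof -
  have "sat (=) D e (Leq s t) = (\<exists>z. tval e s + z = tval e t)"
    unfolding Leq_def
    by ((rule sat_quantI, (elim fresh_fmE fresh_tmE)?) | rule sat_connI | (simp; fail))+
  then show ?thesis using le_iff_add[of "tval e s" "tval e t"] by metis
qed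

lemma fresh_Beta: "fresh n (Beta a b i r) \<Longrightarrow>
    (n \<notin> fvt a \<Longrightarrow> n \<notin> fvt b \<Longrightarrow> n \<notin> fvt i \<Longrightarrow> n \<notin> fvt r \<Longrightarrow> R) \<Longrightarrow> R"
  unfolding Beta_def by (elim fresh_fmE fresh_tmE fresh_Leq) simp

definition beta :: "nat \<Rightarrow> nat \<Rightarrow> nat \<Rightarrow> nat"
  where "beta a b i = a mod Suc (Suc i * b)"

text \<open>
  The bound on the remainder makes the quotient unique, so the formula defines a function.
\<close>

lemma sat_Beta [simp]:
  fixes e :: "nat \<Rightarrow> nat"
  shows "sat (=) D e (Beta a b i r) = (tval e r = beta (tval e a) (tval e b) (tval e i))"
proof -
  have "sat (=) D e (Beta a b i r) = (\<exists>q. tval e a = q * Suc (Suc (tval e i) * tval e b) + tval e r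
     \<and> tval e r \<le> Suc (tval e i) * tval e b)"
    unfolding Beta_def
    by ((rule sat_quantI, (elim fresh_fmE fresh_tmE fresh_Leq)?) | rule sat_connI | (simp; fail))+
  also have "\<dots> = (tval e r = tval e a mod Suc (Suc (tval e i) * tval e b))"
  proof (intro iffI, goal_cases)
    case 1
    then obtain q where "tval e a = q * Suc (Suc (tval e i) * tval e b) + tval e r"
      "tval e r < Suc (Suc (tval e i) * tval e b)" by auto
    then show ?case by (metis mod_less mod_mult_self3)
  next
    case 2
    show ?case
      by (rule exI[of _ "tval e a div Suc (Suc (tval e i) * tval e b)"])
        (metis 2 div_mult_mod_eq less_Suc_eq_le mod_less_divisor zero_less_Suc)
  qed
  finally show ?thesis by (simp add: beta_def)
qed

section \<open>Arithmetized syntax in the natural numbers\<close>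

subsection \<open>Goedel's beta function\<close>

text \<open>
  The moduli \<open>1 + (i + 1) b\<close> are pairwise coprime because a common prime divisor divides a difference
  of indices or \<open>b\<close>, hence \<open>b\<close> in any case, and hence \<open>1\<close>.
\<close>

lemma beta_exists: "\<exists>a b. \<forall>i \<le> x. beta a b i = f i"
proof -
  \<comment> \<open>the factorial of \<open>N\<close> is a multiple of all primes up to \<open>x\<close> and bounds the values to be coded\<close>
  define N where "N = Suc x + (\<Sum>i \<le> x. f i)"
  define b :: nat where "b = fact N"
  have cop: "coprime (Suc (Suc i * b)) (Suc (Suc j * b))" if "i \<le> x" "j < i" for i j
  proof (rule ccontr)
    assume "\<not> ?thesis"
    then obtain p where p: "prime p" "p dvd Suc (Suc i * b)" "p dvd Suc (Suc j * b)"
      by (metis coprime_iff_gcd_eq_1 gcd_nat.bounded_iff prime_factor_nat)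
    then have "p dvd Suc (Suc i * b) - Suc (Suc j * b)" by (rule_tac dvd_diff_nat)
    also have "Suc (Suc i * b) - Suc (Suc j * b) = (i - j) * b"
      by (simp add: diff_mult_distrib)
    finally have "p dvd (i - j) \<or> p dvd b" using p(1) by (simp add: prime_dvd_mult_iff)
    moreover have "p dvd b" if "p dvd (i - j)"
    proof -
      have "p \<le> i - j" using that \<open>j < i\<close> by (intro dvd_imp_le) auto
      then have "p \<le> N" using \<open>i \<le> x\<close> by (simp add: N_def)
      then show ?thesis unfolding b_def using p(1) by (simp add: prime_dvd_fact_iff)
    qed
    ultimately have "p dvd Suc i * b" by auto
    then have "p dvd 1" using p(2) by (metis Suc_eq_plus1_left dvd_add_left_iff add.commute)
    then show False using p(1) by simp
  qed
  have "\<exists>a. \<forall>i \<in> {..x}. [a = f i] (mod Suc (Suc i * b))"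
  proof (rule chinese_remainder_nat)
    show "\<forall>i \<in> {..x}. \<forall>j \<in> {..x}. i \<noteq> j \<longrightarrow> coprime (Suc (Suc i * b)) (Suc (Suc j * b))"
      using cop by (metis atMost_iff coprime_commute linorder_neqE_nat)
  qed simp
  then obtain a where a: "\<And>i. i \<le> x \<Longrightarrow> [a = f i] (mod Suc (Suc i * b))" by auto
  have "beta a b i = f i" if "i \<le> x" for i
  proof -
    have "f i \<le> N" using that member_le_sum[of i "{..x}" f] by (simp add: N_def)
    also have "N \<le> b" unfolding b_def by (rule fact_ge_self)
    finally have "f i < Suc (Suc i * b)" by simp
    then show ?thesis using a[OF that] by (simp add: beta_def cong_def)
  qed
  then show ?thesis by blast
qed

subsection \<open>Codes\<close>

definition npair :: "nat \<Rightarrow> nat \<Rightarrow> nat" where "npair x y = (x + y) * (x + y) + x"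

lemma npair_inject [simp]: "npair x y = npair x' y' \<longleftrightarrow> x = x' \<and> y = y'"
proof
  have less: "npair x y < npair x' y'" if "x + y < x' + y'" for x y x' y'
  proof -
    have "npair x y < Suc (x + y) * Suc (x + y)" by (simp add: npair_def)
    also have "\<dots> \<le> (x' + y') * (x' + y')" by (intro mult_le_mono) (use that in auto)
    finally show ?thesis by (simp add: npair_def)
  qed
  assume "npair x y = npair x' y'"
  moreover from this have "x + y = x' + y'"
    using less[of x y x' y'] less[of x' y' x y] by (cases "x + y" "x' + y'" rule: linorder_cases) auto
  ultimately have "x = x'" by (simp add: npair_def)
  then show "x = x' \<and> y = y'" using \<open>x + y = x' + y'\<close> by simp
qed simp

lemma npair_ge1: "x \<le> npair x y" by (simp add: npair_def)

lemma npair_ge2: "y \<le> npair x y"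
  unfolding npair_def using le_square[of "x + y"] by linarith

lemma npair_tag_less [simp]: "x > 0 \<Longrightarrow> y < npair x y"
  unfolding npair_def using le_square[of "x + y"] by linarith

lemma npair_tag_less2 [simp]:
  assumes "k > 0" shows "x < npair k (npair x y)" "y < npair k (npair x y)"
  using npair_tag_less[OF assms, of "npair x y"] npair_ge1[of x y] npair_ge2[of y x] by auto

abbreviation "nZero \<equiv> npair (Suc 0) 0"
abbreviation "nVar i \<equiv> npair 2 i"
abbreviation "nSucc s \<equiv> npair 3 s"
abbreviation "nAdd s t \<equiv> npair 4 (npair s t)"
abbreviation "nMul s t \<equiv> npair 5 (npair s t)"
abbreviation "nEql s t \<equiv> npair 6 (npair s t)"
abbreviation "nNeg p \<equiv> npair 7 p"
abbreviation "nDis p q \<equiv> npair 8 (npair p q)"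
abbreviation "nExi v p \<equiv> npair 9 (npair v p)"

primrec tcode :: "tm \<Rightarrow> nat" where
  "tcode (Var i) = nVar i"
| "tcode Zero = nZero"
| "tcode (Succ s) = nSucc (tcode s)"
| "tcode (s \<^bold>+ t) = nAdd (tcode s) (tcode t)"
| "tcode (s \<^bold>* t) = nMul (tcode s) (tcode t)"

primrec fcode :: "fm \<Rightarrow> nat" where
  "fcode (s \<^bold>= t) = nEql (tcode s) (tcode t)"
| "fcode (Tr t) = 0"
| "fcode (\<^bold>\<not> p) = nNeg (fcode p)"
| "fcode (p \<^bold>\<or> q) = nDis (fcode p) (fcode q)"
| "fcode (Exi n p) = nExi (nVar n) (fcode p)"

lemma tcode_inject [simp]: "tcode s = tcode t \<longleftrightarrow> s = t"
proof
  show "tcode s = tcode t \<Longrightarrow> s = t"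
    by (induction s arbitrary: t) (case_tac t; simp)+
qed simp

lemma npair_pos: "k > 0 \<Longrightarrow> npair k y \<noteq> 0"
  using npair_ge1[of k y] by simp

lemma npair_pos_simps [simp]: "npair (numeral k) y \<noteq> 0" "0 \<noteq> npair (numeral k) y"
  using npair_pos[of "numeral k" y] by auto

lemma fcode_inject: "arithmetical p \<Longrightarrow> arithmetical q \<Longrightarrow> fcode p = fcode q \<Longrightarrow> p = q"
  by (induction p arbitrary: q) (case_tac q; simp)+

lemma tval_numeral_tm [simp]: "tval e (numeral_tm n) = (n :: nat)"
  by (induction n) auto

lemma fvt_numeral_tm [simp]: "fvt (numeral_tm n) = {}"
  by (induction n) auto

lemma tval_pair: "tval e (pair s t) = npair (tval e s) (tval e t)"
  by (simp add: pair_def npair_def)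

lemma fvt_pair: "fvt (pair s t) = fvt s \<union> fvt t"
  by (auto simp: pair_def)

lemmas constructor_defs =
  cZero_def cVar_def cSucc_def cAdd_def cMul_def cEql_def cNeg_def cDis_def cExi_def

lemma tval_constructors [simp]:
  fixes e :: "nat \<Rightarrow> nat"
  shows "tval e cZero = nZero" "tval e (cVar i) = nVar (tval e i)"
    "tval e (cSucc s) = nSucc (tval e s)" "tval e (cAdd s t) = nAdd (tval e s) (tval e t)"
    "tval e (cMul s t) = nMul (tval e s) (tval e t)" "tval e (cEql s t) = nEql (tval e s) (tval e t)"
    "tval e (cNeg s) = nNeg (tval e s)" "tval e (cDis s t) = nDis (tval e s) (tval e t)"
    "tval e (cExi s t) = nExi (tval e s) (tval e t)"
  by (simp_all add: constructor_defs tval_pair del: numeral_tm.simps)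

lemma fvt_constructors [simp]:
  "fvt cZero = {}" "fvt (cVar i) = fvt i" "fvt (cSucc s) = fvt s"
  "fvt (cAdd s t) = fvt s \<union> fvt t" "fvt (cMul s t) = fvt s \<union> fvt t"
  "fvt (cEql s t) = fvt s \<union> fvt t" "fvt (cNeg s) = fvt s"
  "fvt (cDis s t) = fvt s \<union> fvt t" "fvt (cExi s t) = fvt s \<union> fvt t"
  by (auto simp: constructor_defs fvt_pair simp del: numeral_tm.simps)

lemma fresh_constructorE:
  "n \<notin> fvt cZero \<Longrightarrow> R \<Longrightarrow> R"
  "n \<notin> fvt (cVar t) \<Longrightarrow> (n \<notin> fvt t \<Longrightarrow> R) \<Longrightarrow> R"
  "n \<notin> fvt (cSucc t) \<Longrightarrow> (n \<notin> fvt t \<Longrightarrow> R) \<Longrightarrow> R"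
  "n \<notin> fvt (cAdd s t) \<Longrightarrow> (n \<notin> fvt s \<Longrightarrow> n \<notin> fvt t \<Longrightarrow> R) \<Longrightarrow> R"
  "n \<notin> fvt (cMul s t) \<Longrightarrow> (n \<notin> fvt s \<Longrightarrow> n \<notin> fvt t \<Longrightarrow> R) \<Longrightarrow> R"
  "n \<notin> fvt (cEql s t) \<Longrightarrow> (n \<notin> fvt s \<Longrightarrow> n \<notin> fvt t \<Longrightarrow> R) \<Longrightarrow> R"
  "n \<notin> fvt (cNeg t) \<Longrightarrow> (n \<notin> fvt t \<Longrightarrow> R) \<Longrightarrow> R"
  "n \<notin> fvt (cDis s t) \<Longrightarrow> (n \<notin> fvt s \<Longrightarrow> n \<notin> fvt t \<Longrightarrow> R) \<Longrightarrow> R"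
  "n \<notin> fvt (cExi s t) \<Longrightarrow> (n \<notin> fvt s \<Longrightarrow> n \<notin> fvt t \<Longrightarrow> R) \<Longrightarrow> R"
  by auto

lemmas freshE0 = fresh_fmE fresh_tmE fresh_constructorE fresh_Leq fresh_Beta

text \<open>
  Rules of the same kind for the defined formulae hide the bodies of these formulae from the
  evaluation of those which are built from them.
\<close>

lemma fresh_IsVar: "fresh n (IsVar v) \<Longrightarrow> (n \<notin> fvt v \<Longrightarrow> R) \<Longrightarrow> R"
  unfolding IsVar_def by (elim freshE0) simp

lemma fresh_IsTerm: "fresh n (IsTerm x) \<Longrightarrow> (n \<notin> fvt x \<Longrightarrow> R) \<Longrightarrow> R"
  unfolding IsTerm_def by (elim freshE0 fresh_IsVar) simp

lemma fresh_IsForm: "fresh n (IsForm x) \<Longrightarrow> (n \<notin> fvt x \<Longrightarrow> R) \<Longrightarrow> R"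
  unfolding IsForm_def by (elim freshE0 fresh_IsVar fresh_IsTerm) simp

lemma fresh_FreeIn: "fresh n (FreeIn v x) \<Longrightarrow> (n \<notin> fvt v \<Longrightarrow> n \<notin> fvt x \<Longrightarrow> R) \<Longrightarrow> R"
  unfolding FreeIn_def by (elim freshE0 fresh_IsVar) simp

lemma fresh_IsClosedTerm: "fresh n (IsClosedTerm x) \<Longrightarrow> (n \<notin> fvt x \<Longrightarrow> R) \<Longrightarrow> R"
  unfolding IsClosedTerm_def by (elim freshE0 fresh_IsTerm fresh_IsVar fresh_FreeIn) simp

lemma fresh_IsSent: "fresh n (IsSent x) \<Longrightarrow> (n \<notin> fvt x \<Longrightarrow> R) \<Longrightarrow> R"
  unfolding IsSent_def by (elim freshE0 fresh_IsForm fresh_IsVar fresh_FreeIn) simp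

lemma fresh_IsForm1: "fresh n (IsForm1 v x) \<Longrightarrow> (n \<notin> fvt v \<Longrightarrow> n \<notin> fvt x \<Longrightarrow> R) \<Longrightarrow> R"
  unfolding IsForm1_def by (elim freshE0 fresh_IsForm fresh_IsVar fresh_FreeIn) simp

lemma fresh_Num: "fresh n (Num x y) \<Longrightarrow> (n \<notin> fvt x \<Longrightarrow> n \<notin> fvt y \<Longrightarrow> R) \<Longrightarrow> R"
  unfolding Num_def by (elim freshE0) simp

lemma fresh_Val: "fresh n (Val x y) \<Longrightarrow> (n \<notin> fvt x \<Longrightarrow> n \<notin> fvt y \<Longrightarrow> R) \<Longrightarrow> R"
  unfolding Val_def by (elim freshE0) simp

lemma fresh_Sub: "fresh n (Sub x v s y) \<Longrightarrow> (n \<notin> fvt x \<Longrightarrow> n \<notin> fvt v \<Longrightarrow> n \<notin> fvt s \<Longrightarrow> n \<notin> fvt y \<Longrightarrow> R) \<Longrightarrow> R"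
  unfolding Sub_def by (elim freshE0 fresh_IsVar) simp

lemmas freshE = freshE0 fresh_IsVar fresh_IsTerm fresh_IsForm fresh_FreeIn fresh_IsClosedTerm fresh_IsSent fresh_IsForm1 fresh_Num fresh_Val fresh_Sub

subsection \<open>Terms and formulae\<close>

lemma sat_IsVar [simp]:
  fixes e :: "nat \<Rightarrow> nat"
  shows "sat (=) D e (IsVar v) = (\<exists>i. tval e v = nVar i)"
  unfolding IsVar_def by ((rule sat_quantI, (elim freshE)?) | rule sat_connI | (simp; fail))+

lemma sat_IsTerm_beta:
  fixes e :: "nat \<Rightarrow> nat"
  shows "sat (=) D e (IsTerm x) = (\<exists>a b. 1 = beta a b (tval e x) \<and>
    (\<forall>u. u \<le> tval e x \<and> 1 = beta a b u \<longrightarrow> u = nZero \<or> (\<exists>i. u = nVar i) \<or>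
      (\<exists>s. u = nSucc s \<and> 1 = beta a b s) \<or>
      (\<exists>s t. (u = nAdd s t \<or> u = nMul s t) \<and> 1 = beta a b s \<and> 1 = beta a b t)))"
  unfolding IsTerm_def
  by ((rule sat_quantI, (elim freshE)?) | rule sat_connI | (simp; fail))+

lemma npair_le_dest: "npair k y \<le> x \<Longrightarrow> y \<le> x" "npair y k \<le> x \<Longrightarrow> y \<le> x"
  using npair_ge1 npair_ge2 order_trans by blast+

text \<open>
  The set of all codes of terms up to \<open>x\<close> is a witness. Conversely, any witness contains codes of
  terms only, by induction on its elements.
\<close>

lemma sat_IsTerm [simp]:
  fixes e :: "nat \<Rightarrow> nat"
  shows "sat (=) D e (IsTerm x) = (\<exists>t. tval e x = tcode t)"
  unfolding sat_IsTerm_beta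
proof (intro iffI; (elim exE conjE)?)
  fix a b
  assume "1 = beta a b (tval e x)" and *: "\<forall>u. u \<le> tval e x \<and> 1 = beta a b u \<longrightarrow> u = nZero \<or> (\<exists>i. u = nVar i) \<or>
      (\<exists>s. u = nSucc s \<and> 1 = beta a b s) \<or>
      (\<exists>s t. (u = nAdd s t \<or> u = nMul s t) \<and> 1 = beta a b s \<and> 1 = beta a b t)"
  have "\<exists>t. u = tcode t" if "u \<le> tval e x" "1 = beta a b u" for u
    using that
  proof (induction u rule: less_induct)
    case (less u)
    from *[rule_format, OF conjI, OF less.prems]
    consider "u = nZero" | i where "u = nVar i" | s where "u = nSucc s" "1 = beta a b s"
      | s t where "u = nAdd s t \<or> u = nMul s t" "1 = beta a b s" "1 = beta a b t" by blast
    then show ?case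
    proof cases
      case 1
      then have "u = tcode Zero" by simp
      then show ?thesis ..
    next
      case 2
      then have "u = tcode (Var i)" by simp
      then show ?thesis ..
    next
      case 3
      then have "s < u" by simp
      then obtain s' where "s = tcode s'" using less.IH[of s] less.prems(1) 3(2) by auto
      then have "u = tcode (Succ s')" using 3 by simp
      then show ?thesis ..
    next
      case 4
      then have lt: "s < u" "t < u" by auto
      obtain s' where "s = tcode s'" using less.IH[OF lt(1)] less.prems(1) lt 4(2) by auto
      moreover obtain t' where "t = tcode t'" using less.IH[OF lt(2)] less.prems(1) lt 4(3) by auto
      ultimately have "u = tcode (s' \<^bold>+ t') \<or> u = tcode (s' \<^bold>* t')" using 4(1) by simp
      then show ?thesis by blast
    qed
  qed
  then show "\<exists>t. tval e x = tcode t" using \<open>1 = beta a b (tval e x)\<close> by blast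
next
  fix t assume t: "tval e x = tcode t"
  obtain a b where ab: "\<And>i. i \<le> tval e x \<Longrightarrow> beta a b i = (if \<exists>t. i = tcode t then 1 else 0)"
    using beta_exists[of "tval e x" "\<lambda>i. if \<exists>t. i = tcode t then 1 else 0"] by blast
  have sub: "1 = beta a b (tcode s)" if "tcode s \<le> tval e x" for s
    using ab[OF that] by auto
  show "\<exists>a b. 1 = beta a b (tval e x) \<and>
    (\<forall>u. u \<le> tval e x \<and> 1 = beta a b u \<longrightarrow> u = nZero \<or> (\<exists>i. u = nVar i) \<or>
      (\<exists>s. u = nSucc s \<and> 1 = beta a b s) \<or>
      (\<exists>s t. (u = nAdd s t \<or> u = nMul s t) \<and> 1 = beta a b s \<and> 1 = beta a b t))"
  proof (intro exI conjI allI impI; (elim conjE)?)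
    show "1 = beta a b (tval e x)" using sub[of t] t by simp
    fix u assume u: "u \<le> tval e x" "1 = beta a b u"
    then obtain r where r: "u = tcode r" using ab[OF u(1)] u(2) by (auto split: if_splits)
    have sub': "1 = beta a b (tcode s)" if "tcode s < u" for s
      using sub[of s] that u(1) by simp
    show "u = nZero \<or> (\<exists>i. u = nVar i) \<or>
      (\<exists>s. u = nSucc s \<and> 1 = beta a b s) \<or>
      (\<exists>s t. (u = nAdd s t \<or> u = nMul s t) \<and> 1 = beta a b s \<and> 1 = beta a b t)"
      using r by (cases r) (simp_all add: sub'[unfolded One_nat_def])
  qed
qed

lemma sat_IsForm_beta:
  fixes e :: "nat \<Rightarrow> nat"
  shows "sat (=) D e (IsForm x) = (\<exists>a b. 1 = beta a b (tval e x) \<and>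
    (\<forall>u. u \<le> tval e x \<and> 1 = beta a b u \<longrightarrow>
      (\<exists>s t. u = nEql s t \<and> (\<exists>r. s = tcode r) \<and> (\<exists>r. t = tcode r)) \<or>
      (\<exists>p. u = nNeg p \<and> 1 = beta a b p) \<or>
      (\<exists>p q. u = nDis p q \<and> 1 = beta a b p \<and> 1 = beta a b q) \<or>
      (\<exists>v p. u = nExi v p \<and> (\<exists>i. v = nVar i) \<and> 1 = beta a b p)))"
  unfolding IsForm_def
  by ((rule sat_quantI, (elim freshE)?) | rule sat_connI | (simp; fail))+

lemma sat_IsForm [simp]:
  fixes e :: "nat \<Rightarrow> nat"
  shows "sat (=) D e (IsForm x) = (\<exists>p. arithmetical p \<and> tval e x = fcode p)"
  unfolding sat_IsForm_beta
proof (intro iffI; (elim exE conjE)?)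
  fix a b
  assume "1 = beta a b (tval e x)" and *: "\<forall>u. u \<le> tval e x \<and> 1 = beta a b u \<longrightarrow>
      (\<exists>s t. u = nEql s t \<and> (\<exists>r. s = tcode r) \<and> (\<exists>r. t = tcode r)) \<or>
      (\<exists>p. u = nNeg p \<and> 1 = beta a b p) \<or>
      (\<exists>p q. u = nDis p q \<and> 1 = beta a b p \<and> 1 = beta a b q) \<or>
      (\<exists>v p. u = nExi v p \<and> (\<exists>i. v = nVar i) \<and> 1 = beta a b p)"
  have "\<exists>p. arithmetical p \<and> u = fcode p" if "u \<le> tval e x" "1 = beta a b u" for u
    using that
  proof (induction u rule: less_induct)
    case (less u)
    from *[rule_format, OF conjI, OF less.prems]
    consider s t where "u = nEql (tcode s) (tcode t)" | p where "u = nNeg p" "1 = beta a b p"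
      | p q where "u = nDis p q" "1 = beta a b p" "1 = beta a b q"
      | i p where "u = nExi (nVar i) p" "1 = beta a b p" by blast
    then show ?case
    proof cases
      case 1
      then have "arithmetical (s \<^bold>= t) \<and> u = fcode (s \<^bold>= t)" by simp
      then show ?thesis ..
    next
      case 2
      then have "p < u" by simp
      then obtain p' where "arithmetical p'" "p = fcode p'"
        using less.IH[of p] less.prems(1) 2(2) by auto
      then have "arithmetical (\<^bold>\<not> p') \<and> u = fcode (\<^bold>\<not> p')" using 2 by simp
      then show ?thesis ..
    next
      case 3
      then have lt: "p < u" "q < u" by auto
      obtain p' where "arithmetical p'" "p = fcode p'"
        using less.IH[OF lt(1)] less.prems(1) lt 3(2) by auto
      moreover obtain q' where "arithmetical q'" "q = fcode q'"
        using less.IH[OF lt(2)] less.prems(1) lt 3(3) by auto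
      ultimately have "arithmetical (p' \<^bold>\<or> q') \<and> u = fcode (p' \<^bold>\<or> q')" using 3 by simp
      then show ?thesis ..
    next
      case 4
      then have "p < u" by simp
      then obtain p' where "arithmetical p'" "p = fcode p'"
        using less.IH[of p] less.prems(1) 4(2) by auto
      then have "arithmetical (Exi i p') \<and> u = fcode (Exi i p')" using 4 by simp
      then show ?thesis ..
    qed
  qed
  then show "\<exists>p. arithmetical p \<and> tval e x = fcode p" using \<open>1 = beta a b (tval e x)\<close> by blast
next
  fix p assume p: "arithmetical p" "tval e x = fcode p"
  obtain a b where ab: "\<And>i. i \<le> tval e x \<Longrightarrow>
      beta a b i = (if \<exists>p. arithmetical p \<and> i = fcode p then 1 else 0)"
    using beta_exists[of "tval e x" "\<lambda>i. if \<exists>p. arithmetical p \<and> i = fcode p then 1 else 0"] by blast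
  have sub: "1 = beta a b (fcode s)" if "arithmetical s" "fcode s \<le> tval e x" for s
    using ab[OF that(2)] that(1) by auto
  show "\<exists>a b. 1 = beta a b (tval e x) \<and>
    (\<forall>u. u \<le> tval e x \<and> 1 = beta a b u \<longrightarrow>
      (\<exists>s t. u = nEql s t \<and> (\<exists>r. s = tcode r) \<and> (\<exists>r. t = tcode r)) \<or>
      (\<exists>p. u = nNeg p \<and> 1 = beta a b p) \<or>
      (\<exists>p q. u = nDis p q \<and> 1 = beta a b p \<and> 1 = beta a b q) \<or>
      (\<exists>v p. u = nExi v p \<and> (\<exists>i. v = nVar i) \<and> 1 = beta a b p))"
  proof (intro exI conjI allI impI; (elim conjE)?)
    show "1 = beta a b (tval e x)" using sub[of p] p by simp
    fix u assume u: "u \<le> tval e x" "1 = beta a b u"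
    then obtain r where r: "arithmetical r" "u = fcode r" using ab[OF u(1)] u(2) by (auto split: if_splits)
    have sub': "1 = beta a b (fcode s)" if "fcode s < u" "arithmetical s" for s
      using sub[of s] that u(1) by simp
    show "(\<exists>s t. u = nEql s t \<and> (\<exists>r. s = tcode r) \<and> (\<exists>r. t = tcode r)) \<or>
      (\<exists>p. u = nNeg p \<and> 1 = beta a b p) \<or>
      (\<exists>p q. u = nDis p q \<and> 1 = beta a b p \<and> 1 = beta a b q) \<or>
      (\<exists>v p. u = nExi v p \<and> (\<exists>i. v = nVar i) \<and> 1 = beta a b p)"
      using r by (cases r) (auto simp: sub'[unfolded One_nat_def])
  qed
qed

subsection \<open>Free variables\<close>

text \<open>
  The closure condition on a witness for \<^const>\<open>FreeIn\<close>: it traces a path from \<open>u\<close> towards an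
  occurrence of \<open>v\<close> which no quantifier on the way binds.
\<close>

definition free_step :: "nat \<Rightarrow> (nat \<Rightarrow> nat) \<Rightarrow> nat \<Rightarrow> bool" where
  "free_step v f u \<longleftrightarrow> u = v \<or>
     (\<exists>p. (u = nSucc p \<or> u = nNeg p) \<and> 1 = f p) \<or>
     (\<exists>p q. (u = nAdd p q \<or> u = nMul p q \<or> u = nEql p q \<or> u = nDis p q) \<and> (1 = f p \<or> 1 = f q)) \<or>
     (\<exists>w p. u = nExi w p \<and> \<not> w = v \<and> 1 = f p)"

lemma sat_FreeIn_beta:
  fixes e :: "nat \<Rightarrow> nat"
  shows "sat (=) D e (FreeIn v x) = (\<exists>a b. 1 = beta a b (tval e x) \<and>
    (\<forall>u. u \<le> tval e x \<and> 1 = beta a b u \<longrightarrow> free_step (tval e v) (beta a b) u))"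
  unfolding FreeIn_def free_step_def
  by ((rule sat_quantI, (elim freshE)?) | rule sat_connI | (simp; fail))+

lemma free_step_tcode:
  assumes "\<And>u. u \<le> x \<Longrightarrow> 1 = f u \<Longrightarrow> free_step (nVar i) f u"
  shows "tcode t \<le> x \<Longrightarrow> 1 = f (tcode t) \<Longrightarrow> i \<in> fvt t"
proof (induction t)
  case (Add s t)
  have "tcode s \<le> x" "tcode t \<le> x" using Add.prems(1) by (auto dest: npair_le_dest)
  with assms[OF Add.prems] Add.IH show ?case by (auto simp: free_step_def)
next
  case (Mul s t)
  have "tcode s \<le> x" "tcode t \<le> x" using Mul.prems(1) by (auto dest: npair_le_dest)
  with assms[OF Mul.prems] Mul.IH show ?case by (auto simp: free_step_def)
next
  case (Succ t)
  have "tcode t \<le> x" using Succ.prems(1) by (auto dest: npair_le_dest)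
  with assms[OF Succ.prems] Succ.IH show ?case by (auto simp: free_step_def)
next
  case (Var j)
  from assms[OF Var.prems] show ?case by (auto simp: free_step_def)
next
  case Zero
  from assms[OF Zero.prems] show ?case by (auto simp: free_step_def)
qed

lemma free_step_fcode:
  assumes "\<And>u. u \<le> x \<Longrightarrow> 1 = f u \<Longrightarrow> free_step (nVar i) f u"
  shows "arithmetical p \<Longrightarrow> fcode p \<le> x \<Longrightarrow> 1 = f (fcode p) \<Longrightarrow> i \<in> fv p"
proof (induction p)
  case (Eql s t)
  have "tcode s \<le> x" "tcode t \<le> x" using Eql.prems(2) by (auto dest: npair_le_dest)
  with assms[OF Eql.prems(2,3)] free_step_tcode[of x f, OF assms] show ?case
    by (auto simp: free_step_def)
next
  case (Dis p q)
  have "fcode p \<le> x" "fcode q \<le> x" using Dis.prems(2) by (auto dest: npair_le_dest)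
  with assms[OF Dis.prems(2,3)] Dis.IH Dis.prems(1) show ?case by (auto simp: free_step_def)
next
  case (Neg p)
  have "fcode p \<le> x" using Neg.prems(2) by (auto dest: npair_le_dest)
  with assms[OF Neg.prems(2,3)] Neg.IH Neg.prems(1) show ?case by (auto simp: free_step_def)
next
  case (Exi n p)
  have "fcode p \<le> x" using Exi.prems(2) by (auto dest: npair_le_dest)
  with assms[OF Exi.prems(2,3)] Exi.IH Exi.prems(1) show ?case by (auto simp: free_step_def)
qed auto

lemma free_step_witness:
  fixes G :: "nat \<Rightarrow> bool"
  assumes "G x" and "\<And>f u. \<forall>w < u. G w \<longrightarrow> 1 = f w \<Longrightarrow> G u \<Longrightarrow> free_step v f u"
  shows "\<exists>a b. 1 = beta a b x \<and> (\<forall>u. u \<le> x \<and> 1 = beta a b u \<longrightarrow> free_step v (beta a b) u)"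
proof -
  obtain a b where ab: "\<And>i. i \<le> x \<Longrightarrow> beta a b i = (if G i then 1 else 0)"
    using beta_exists[of x "\<lambda>i. if G i then 1 else 0"] by blast
  have "free_step v (beta a b) u" if u: "u \<le> x" "1 = beta a b u" for u
  proof (rule assms(2))
    show "G u" using ab[OF u(1)] u(2) by (auto split: if_splits)
    show "\<forall>w < u. G w \<longrightarrow> 1 = beta a b w" using ab u(1) by auto
  qed
  moreover have "1 = beta a b x" using ab[of x] assms(1) by simp
  ultimately show ?thesis by blast
qed

lemma free_code_step:
  assumes "\<forall>w < u. (\<exists>t. w = tcode t \<and> i \<in> fvt t) \<or> (\<exists>p. arithmetical p \<and> w = fcode p \<and> i \<in> fv p) \<longrightarrow> 1 = f w"
    and "(\<exists>t. u = tcode t \<and> i \<in> fvt t) \<or> (\<exists>p. arithmetical p \<and> u = fcode p \<and> i \<in> fv p)"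
  shows "free_step (nVar i) f u"
  using assms(2)
proof (elim disjE exE conjE)
  have t: "1 = f (tcode t)" if "tcode t < u" "i \<in> fvt t" for t using assms(1) that by blast
  have p: "1 = f (fcode p)" if "fcode p < u" "arithmetical p" "i \<in> fv p" for p using assms(1) that by blast
  show ?thesis if "u = tcode s" "i \<in> fvt s" for s
    using that by (cases s) (auto simp: free_step_def t[unfolded One_nat_def])
  show ?thesis if "arithmetical q" "u = fcode q" "i \<in> fv q" for q
    using that by (cases q) (auto simp: free_step_def t[unfolded One_nat_def] p[unfolded One_nat_def])
qed

lemma sat_FreeIn_tcode:
  fixes e :: "nat \<Rightarrow> nat"
  assumes "tval e v = nVar i" "tval e x = tcode t"
  shows "sat (=) D e (FreeIn v x) \<longleftrightarrow> i \<in> fvt t"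
  unfolding sat_FreeIn_beta assms
proof
  assume "i \<in> fvt t"
  then show "\<exists>a b. 1 = beta a b (tcode t) \<and>
    (\<forall>u. u \<le> tcode t \<and> 1 = beta a b u \<longrightarrow> free_step (nVar i) (beta a b) u)"
    by (intro free_step_witness[where G = "\<lambda>u. (\<exists>t. u = tcode t \<and> i \<in> fvt t)
          \<or> (\<exists>p. arithmetical p \<and> u = fcode p \<and> i \<in> fv p)"] free_code_step) auto
qed (use free_step_tcode in blast)

lemma sat_FreeIn_fcode:
  fixes e :: "nat \<Rightarrow> nat"
  assumes "tval e v = nVar i" "tval e x = fcode p" "arithmetical p"
  shows "sat (=) D e (FreeIn v x) \<longleftrightarrow> i \<in> fv p"
  unfolding sat_FreeIn_beta assms
proof
  assume "i \<in> fv p"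
  then show "\<exists>a b. 1 = beta a b (fcode p) \<and>
    (\<forall>u. u \<le> fcode p \<and> 1 = beta a b u \<longrightarrow> free_step (nVar i) (beta a b) u)"
    using assms(3) by (intro free_step_witness[where G = "\<lambda>u. (\<exists>t. u = tcode t \<and> i \<in> fvt t)
          \<or> (\<exists>p. arithmetical p \<and> u = fcode p \<and> i \<in> fv p)"] free_code_step) auto
qed (use free_step_fcode assms(3) in blast)

lemma sat_IsClosedTerm [simp]:
  fixes e :: "nat \<Rightarrow> nat"
  shows "sat (=) D e (IsClosedTerm x) = (\<exists>t. fvt t = {} \<and> tval e x = tcode t)"
proof -
  have "sat (=) D e (\<^bold>\<forall>v. IsVar v \<^bold>\<longrightarrow> \<^bold>\<not> FreeIn v x) = (\<forall>v. (\<exists>i. v = nVar i) \<longrightarrow> v \<notin> nVar ` fvt t)"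
    if "tval e x = tcode t" for t
  proof (rule sat_allI)
    fix n y assume "fresh n (IsVar Zero \<^bold>\<longrightarrow> \<^bold>\<not> FreeIn Zero x)"
    then have "n \<notin> fvt x" by (elim freshE)
    then show "sat (=) D (e(n := y)) (IsVar (Var n) \<^bold>\<longrightarrow> \<^bold>\<not> FreeIn (Var n) x) =
      ((\<exists>i. y = nVar i) \<longrightarrow> y \<notin> nVar ` fvt t)"
      using sat_FreeIn_tcode[of "e(n := y)" "Var n" _ x t] that by auto
  qed
  then show ?thesis
    unfolding IsClosedTerm_def by (auto simp del: sat.simps(3) simp: sat_conI)
qed

lemma sat_IsSent [simp]:
  fixes e :: "nat \<Rightarrow> nat"
  shows "sat (=) D e (IsSent x) = (\<exists>p. arithmetical p \<and> fv p = {} \<and> tval e x = fcode p)"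
proof -
  have "sat (=) D e (\<^bold>\<forall>v. IsVar v \<^bold>\<longrightarrow> \<^bold>\<not> FreeIn v x) = (\<forall>v. (\<exists>i. v = nVar i) \<longrightarrow> v \<notin> nVar ` fv p)"
    if "tval e x = fcode p" "arithmetical p" for p
  proof (rule sat_allI)
    fix n y assume "fresh n (IsVar Zero \<^bold>\<longrightarrow> \<^bold>\<not> FreeIn Zero x)"
    then have "n \<notin> fvt x" by (elim freshE)
    then show "sat (=) D (e(n := y)) (IsVar (Var n) \<^bold>\<longrightarrow> \<^bold>\<not> FreeIn (Var n) x) =
      ((\<exists>i. y = nVar i) \<longrightarrow> y \<notin> nVar ` fv p)"
      using sat_FreeIn_fcode[of "e(n := y)" "Var n" _ x p] that by auto
  qed
  then show ?thesis
    unfolding IsSent_def by (auto simp del: sat.simps(3) simp: sat_conI)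
qed

lemma sat_IsForm1 [simp]:
  fixes e :: "nat \<Rightarrow> nat"
  shows "sat (=) D e (IsForm1 v x) =
    (\<exists>i p. arithmetical p \<and> fv p \<subseteq> {i} \<and> tval e v = nVar i \<and> tval e x = fcode p)"
proof -
  have "sat (=) D e (\<^bold>\<forall>w. IsVar w \<^bold>\<and> FreeIn w x \<^bold>\<longrightarrow> w \<^bold>= v)
      = (\<forall>w. (\<exists>i. w = nVar i) \<and> w \<in> nVar ` fv p \<longrightarrow> w = tval e v)"
    if "tval e x = fcode p" "arithmetical p" for p
  proof (rule sat_allI)
    fix n y assume "fresh n (IsVar Zero \<^bold>\<and> FreeIn Zero x \<^bold>\<longrightarrow> Zero \<^bold>= v)"
    then have "n \<notin> fvt x \<and> n \<notin> fvt v" by (elim freshE) simp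
    then show "sat (=) D (e(n := y)) (IsVar (Var n) \<^bold>\<and> FreeIn (Var n) x \<^bold>\<longrightarrow> Var n \<^bold>= v) =
      ((\<exists>i. y = nVar i) \<and> y \<in> nVar ` fv p \<longrightarrow> y = tval e v)"
      using sat_FreeIn_fcode[of "e(n := y)" "Var n" _ x p] that by auto
  qed
  note all = this
  have *: "sat (=) D e (IsForm1 v x) \<longleftrightarrow> (\<exists>i. tval e v = nVar i \<and> fv p \<subseteq> {i})"
    if p: "tval e x = fcode p" "arithmetical p" for p
  proof -
    have "sat (=) D e (IsForm x)" using p by auto
    then have "sat (=) D e (IsForm1 v x) \<longleftrightarrow>
        (\<exists>i. tval e v = nVar i) \<and> (\<forall>w. (\<exists>i. w = nVar i) \<and> w \<in> nVar ` fv p \<longrightarrow> w = tval e v)"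
      unfolding IsForm1_def sat.simps(3,4) all[OF p, unfolded sat.simps(3,4)] by auto
    also have "\<dots> \<longleftrightarrow> (\<exists>i. tval e v = nVar i \<and> fv p \<subseteq> {i})"
    proof (cases "\<exists>i. tval e v = nVar i")
      case True
      then obtain i where i: "tval e v = nVar i" ..
      have "x = i" if "\<forall>w. (\<exists>i. w = nVar i) \<and> w \<in> nVar ` fv p \<longrightarrow> w = nVar i" "x \<in> fv p" for x
      proof -
        have "nVar x = nVar i" using that by blast
        then show ?thesis by simp
      qed
      then show ?thesis unfolding i by auto
    qed simp
    finally show ?thesis .
  qed
  show ?thesis
  proof (cases "\<exists>p. arithmetical p \<and> tval e x = fcode p")
    case True
    then obtain p where p: "arithmetical p" "tval e x = fcode p" by blast
    then have "q = p" if "arithmetical q" "tval e x = fcode q" for q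
      using that fcode_inject by metis
    then show ?thesis using p *[OF p(2,1)] by metis
  next
    case False
    then have "\<not> sat (=) D e (IsForm x)" by simp
    then show ?thesis using False unfolding IsForm1_def by auto
  qed
qed

subsection \<open>Substitution of closed terms\<close>

text \<open>
  For substitutions of this kind bound variables are never renamed.
\<close>

definition ground_subst :: "(nat \<Rightarrow> tm) \<Rightarrow> bool"
  where "ground_subst \<sigma> \<longleftrightarrow> (\<forall>i. \<sigma> i = Var i \<or> fvt (\<sigma> i) = {})"

lemma ground_subst_upd [simp]:
  "ground_subst \<sigma> \<Longrightarrow> ground_subst (\<sigma>(n := Var n))"
  "ground_subst \<sigma> \<Longrightarrow> fvt t = {} \<Longrightarrow> ground_subst (\<sigma>(n := t))"
  "ground_subst Var"
  by (auto simp: ground_subst_def)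

lemma ground_subst_fvt: "ground_subst \<sigma> \<Longrightarrow> i \<noteq> n \<Longrightarrow> n \<notin> fvt (\<sigma> i)"
  unfolding ground_subst_def by (drule spec[of _ i]) auto

lemma substt_Var [simp]: "substt Var t = t"
  by (induction t) auto

lemma substt_cong: "(\<And>i. i \<in> fvt t \<Longrightarrow> \<sigma> i = \<tau> i) \<Longrightarrow> substt \<sigma> t = substt \<tau> t"
  by (induction t) auto

lemma subst_cong: "(\<And>i. i \<in> fv p \<Longrightarrow> \<sigma> i = \<tau> i) \<Longrightarrow> subst \<sigma> p = subst \<tau> p"
proof (induction p arbitrary: \<sigma> \<tau>)
  case (Eql s t)
  have "substt \<sigma> s = substt \<tau> s" "substt \<sigma> t = substt \<tau> t"
    by (rule substt_cong, simp add: Eql)+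
  then show ?case by simp
next
  case (Tr t)
  have "substt \<sigma> t = substt \<tau> t"
    by (rule substt_cong) (simp add: Tr)
  then show ?case by simp
next
  case (Neg p)
  have "subst \<sigma> p = subst \<tau> p"
    by (rule Neg.IH) (simp add: Neg.prems)
  then show ?case by simp
next
  case (Dis p q)
  have "subst \<sigma> p = subst \<tau> p" "subst \<sigma> q = subst \<tau> q"
    by (rule Dis.IH, simp add: Dis.prems)+
  then show ?case by simp
next
  case (Exi n p)
  have F: "(\<Union>m \<in> fv p - {n}. fvt (\<sigma> m)) = (\<Union>m \<in> fv p - {n}. fvt (\<tau> m))"
    by (rule SUP_cong) (simp_all add: Exi.prems)
  have "subst (\<sigma>(n := Var k)) p = subst (\<tau>(n := Var k)) p" for k
    by (rule Exi.IH) (simp add: Exi.prems)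
  then show ?case unfolding subst.simps F Let_def by simp
qed

lemma subst_Exi_ground [simp]:
  assumes "ground_subst \<sigma>"
  shows "subst \<sigma> (Exi n p) = Exi n (subst (\<sigma>(n := Var n)) p)"
proof -
  have "n \<notin> (\<Union>m \<in> fv p - {n}. fvt (\<sigma> m))"
    using ground_subst_fvt[OF assms] by blast
  then show ?thesis by (auto simp: Let_def)
qed

declare subst.simps(5) [simp del]

lemma subst_Var [simp]: "subst Var p = p"
  by (induction p) auto

lemma substt_substt: "substt \<tau> (substt \<sigma> t) = substt (\<lambda>i. substt \<tau> (\<sigma> i)) t"
  by (induction t) auto

lemma substt_closed: "fvt t = {} \<Longrightarrow> substt \<tau> t = t"
  using substt_cong[of t \<tau> Var] by simp

lemma ground_subst_comp:
  "ground_subst \<sigma> \<Longrightarrow> ground_subst \<tau> \<Longrightarrow> ground_subst (\<lambda>i. substt \<tau> (\<sigma> i))"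
  unfolding ground_subst_def
  by (intro allI; drule_tac x = i in spec; drule_tac x = i in spec; elim disjE) (auto simp: substt_closed)

lemma subst_subst:
  "ground_subst \<sigma> \<Longrightarrow> ground_subst \<tau> \<Longrightarrow> subst \<tau> (subst \<sigma> p) = subst (\<lambda>i. substt \<tau> (\<sigma> i)) p"
proof (induction p arbitrary: \<sigma> \<tau>)
  case (Exi n p)
  have "(\<lambda>i. substt (\<tau>(n := Var n)) ((\<sigma>(n := Var n)) i)) = (\<lambda>i. substt \<tau> (\<sigma> i))(n := Var n)"
  proof
    fix i
    show "substt (\<tau>(n := Var n)) ((\<sigma>(n := Var n)) i) = ((\<lambda>i. substt \<tau> (\<sigma> i))(n := Var n)) i"
    proof (cases "i = n")
      case False
      then have "n \<notin> fvt (\<sigma> i)" using ground_subst_fvt[OF Exi.prems(1)] by blast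
      then have "substt (\<tau>(n := Var n)) (\<sigma> i) = substt \<tau> (\<sigma> i)"
        by (intro substt_cong) auto
      then show ?thesis using False by simp
    qed simp
  qed
  then show ?case using Exi by (simp add: ground_subst_comp del: fun_upd_apply)
qed (simp_all add: substt_substt)

lemma fvt_substt: "fvt (substt \<sigma> t) = (\<Union>i \<in> fvt t. fvt (\<sigma> i))"
  by (induction t) auto

lemma fv_subst_ground: "ground_subst \<sigma> \<Longrightarrow> fv (subst \<sigma> p) = (\<Union>i \<in> fv p. fvt (\<sigma> i))"
proof (induction p arbitrary: \<sigma>)
  case (Exi n p)
  have "(\<Union>i \<in> fv p. fvt ((\<sigma>(n := Var n)) i)) - {n} = (\<Union>i \<in> fv p - {n}. fvt (\<sigma> i))"
  proof -
    have "n \<notin> fvt (\<sigma> i)" if "i \<noteq> n" for i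
      using that ground_subst_fvt[OF Exi.prems] by blast
    then show ?thesis by (auto split: if_splits)
  qed
  then show ?case using Exi by (simp del: fun_upd_apply)
qed (auto simp: fvt_substt)

subsection \<open>Numerals, values and substitution on codes\<close>

text \<open>
  The recursion equations determine the coded sequence up to the argument, and the beta function
  provides one.
\<close>

lemma sat_Num [simp]:
  fixes e :: "nat \<Rightarrow> nat"
  shows "sat (=) D e (Num x y) = (tval e y = tcode (numeral_tm (tval e x)))"
proof -
  have "sat (=) D e (Num x y) = (\<exists>a b. nZero = beta a b 0 \<and>
    (\<forall>i. Suc i \<le> tval e x \<longrightarrow> (\<exists>r. r = beta a b i \<and> nSucc r = beta a b (Suc i))) \<and>
    tval e y = beta a b (tval e x))"
    unfolding Num_def
    by ((rule sat_quantI, (elim freshE)?) | rule sat_connI | (simp; fail))+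
  also have "\<dots> = (tval e y = tcode (numeral_tm (tval e x)))"
  proof (intro iffI; (elim exE conjE)?)
    fix a b assume *: "nZero = beta a b 0"
      "\<forall>i. Suc i \<le> tval e x \<longrightarrow> (\<exists>r. r = beta a b i \<and> nSucc r = beta a b (Suc i))"
      "tval e y = beta a b (tval e x)"
    have "i \<le> tval e x \<Longrightarrow> beta a b i = tcode (numeral_tm i)" for i
      by (induction i) (use * in auto)
    then show "tval e y = tcode (numeral_tm (tval e x))" using * by simp
  next
    obtain a b where "\<And>i. i \<le> tval e x \<Longrightarrow> beta a b i = tcode (numeral_tm i)"
      using beta_exists[of "tval e x" "\<lambda>i. tcode (numeral_tm i)"] by blast
    moreover assume "tval e y = tcode (numeral_tm (tval e x))"
    ultimately show "\<exists>a b. nZero = beta a b 0 \<and>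
      (\<forall>i. Suc i \<le> tval e x \<longrightarrow> (\<exists>r. r = beta a b i \<and> nSucc r = beta a b (Suc i))) \<and>
      tval e y = beta a b (tval e x)"
      by (intro exI[of _ a] exI[of _ b]) auto
  qed
  finally show ?thesis .
qed

definition npart1 :: "nat \<Rightarrow> nat" where "npart1 z = (THE x. \<exists>y. z = npair x y)"
definition npart2 :: "nat \<Rightarrow> nat" where "npart2 z = (THE y. \<exists>x. z = npair x y)"

lemma npart_npair [simp]: "npart1 (npair x y) = x" "npart2 (npair x y) = y"
  by (auto simp: npart1_def npart2_def)

definition val_step :: "(nat \<Rightarrow> nat) \<Rightarrow> nat \<Rightarrow> bool" where
  "val_step f u \<longleftrightarrow> (u = nZero \<longrightarrow> 0 = f u) \<and>
    (\<forall>s. u = nSucc s \<longrightarrow> (\<exists>m. m = f s \<and> Suc m = f u)) \<and>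
    (\<forall>s t. u = nAdd s t \<longrightarrow> (\<exists>m n. m = f s \<and> n = f t \<and> m + n = f u)) \<and>
    (\<forall>s t. u = nMul s t \<longrightarrow> (\<exists>m n. m = f s \<and> n = f t \<and> m * n = f u))"

lemma sat_Val_beta:
  fixes e :: "nat \<Rightarrow> nat"
  shows "sat (=) D e (Val x y) = (\<exists>a b. tval e y = beta a b (tval e x) \<and>
    (\<forall>u. u \<le> tval e x \<longrightarrow> val_step (beta a b) u))"
  unfolding Val_def val_step_def
  by ((rule sat_quantI, (elim freshE)?) | rule sat_connI | (simp; fail))+

lemma val_step_unique:
  assumes "\<And>u. u \<le> x \<Longrightarrow> val_step f u"
  shows "tcode t \<le> x \<Longrightarrow> fvt t = {} \<Longrightarrow> f (tcode t) = tval e t"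
proof (induction t)
  case Zero
  then show ?case using assms[OF Zero(1)] by (simp add: val_step_def)
next
  case (Succ t)
  have "tcode t \<le> x" using Succ.prems by (auto dest: npair_le_dest)
  then show ?case using Succ assms[OF Succ.prems(1)] by (simp add: val_step_def)
next
  case (Add s t)
  have "tcode s \<le> x" "tcode t \<le> x" using Add.prems by (auto dest: npair_le_dest)
  then show ?case using Add assms[OF Add.prems(1)] by (simp add: val_step_def)
next
  case (Mul s t)
  have "tcode s \<le> x" "tcode t \<le> x" using Mul.prems by (auto dest: npair_le_dest)
  then show ?case using Mul assms[OF Mul.prems(1)] by (simp add: val_step_def)
qed simp

lemma npair_le [simp]:
  assumes "k > 0" shows "y \<le> npair k y" "x \<le> npair k (npair x y)" "y \<le> npair k (npair x y)"
  using npair_tag_less[OF assms] npair_tag_less2[OF assms] by (auto intro: less_imp_le)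

lemma val_step_cong:
  "(\<And>w. w \<le> u \<Longrightarrow> f w = g w) \<Longrightarrow> val_step g u \<Longrightarrow> val_step f u"
  by (auto simp: val_step_def)

text \<open>
  The clauses of \<^const>\<open>Val\<close> and \<^const>\<open>Sub\<close> are imposed on all numbers up to the argument, whether or
  not they code anything. A witness must therefore satisfy the recursion equations on arbitrary
  numbers, which are decomposed by the inverses of the pairing function.
\<close>

function valn :: "nat \<Rightarrow> nat" where
  "valn u = (let s = npart2 u; s1 = npart1 s; s2 = npart2 s in
     if u = nSucc s then Suc (valn s)
     else if u = nAdd s1 s2 then valn s1 + valn s2
     else if u = nMul s1 s2 then valn s1 * valn s2
     else 0)"
  by auto
termination
  by (relation "measure id"; (simp only: wf_measure in_measure id_apply)?)
    (rule npair_tag_less[OF zero_less_numeral] npair_tag_less2[OF zero_less_numeral])+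

declare valn.simps [simp del]

lemma valn_code [simp]:
  "valn nZero = 0" "valn (nSucc s) = Suc (valn s)"
  "valn (nAdd s t) = valn s + valn t" "valn (nMul s t) = valn s * valn t"
  by (subst valn.simps; simp add: Let_def)+

lemma sat_Val:
  fixes e e' :: "nat \<Rightarrow> nat"
  assumes "tval e x = tcode t" "fvt t = {}"
  shows "sat (=) D e (Val x y) = (tval e y = tval e' t)"
proof
  assume "sat (=) D e (Val x y)"
  then show "tval e y = tval e' t"
    using val_step_unique[of "tcode t"] assms unfolding sat_Val_beta by auto
next
  obtain a b where ab: "\<And>i. i \<le> tcode t \<Longrightarrow> beta a b i = valn i"
    using beta_exists[of "tcode t" valn] by blast
  have step: "val_step valn u" for u by (simp add: val_step_def)
  from this have "valn (tcode t) = tval e' t"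
    using val_step_unique[of "tcode t"] assms(2) by blast
  moreover have "val_step (beta a b) u" if "u \<le> tcode t" for u
    by (rule val_step_cong[of u _ valn]) (use that ab step in auto)
  moreover assume "tval e y = tval e' t"
  ultimately show "sat (=) D e (Val x y)"
    unfolding sat_Val_beta assms(1) using ab[of "tcode t"] by (intro exI[of _ a] exI[of _ b]) auto
qed

definition sub_step :: "nat \<Rightarrow> nat \<Rightarrow> (nat \<Rightarrow> nat) \<Rightarrow> nat \<Rightarrow> bool" where
  "sub_step v s f u \<longleftrightarrow> (u = nZero \<longrightarrow> nZero = f u) \<and>
    (u = v \<longrightarrow> s = f u) \<and>
    ((\<exists>i. u = nVar i) \<and> \<not> u = v \<longrightarrow> u = f u) \<and>
    (\<forall>p. u = nSucc p \<longrightarrow> (\<exists>m. m = f p \<and> nSucc m = f u)) \<and>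
    (\<forall>p q. u = nAdd p q \<longrightarrow> (\<exists>m n. m = f p \<and> n = f q \<and> nAdd m n = f u)) \<and>
    (\<forall>p q. u = nMul p q \<longrightarrow> (\<exists>m n. m = f p \<and> n = f q \<and> nMul m n = f u)) \<and>
    (\<forall>p q. u = nEql p q \<longrightarrow> (\<exists>m n. m = f p \<and> n = f q \<and> nEql m n = f u)) \<and>
    (\<forall>p. u = nNeg p \<longrightarrow> (\<exists>m. m = f p \<and> nNeg m = f u)) \<and>
    (\<forall>p q. u = nDis p q \<longrightarrow> (\<exists>m n. m = f p \<and> n = f q \<and> nDis m n = f u)) \<and>
    (\<forall>p. u = nExi v p \<longrightarrow> u = f u) \<and>
    (\<forall>w p. u = nExi w p \<and> \<not> w = v \<longrightarrow> (\<exists>m. m = f p \<and> nExi w m = f u))"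

lemma sat_Sub_beta:
  fixes e :: "nat \<Rightarrow> nat"
  shows "sat (=) D e (Sub x v s y) = (\<exists>a b. tval e y = beta a b (tval e x) \<and>
    (\<forall>u. u \<le> tval e x \<longrightarrow> sub_step (tval e v) (tval e s) (beta a b) u))"
  unfolding Sub_def sub_step_def
  by ((rule sat_quantI, (elim freshE)?) | rule sat_connI | (simp; fail))+

lemma sub_step_unique_tm:
  assumes "\<And>u. u \<le> x \<Longrightarrow> sub_step (nVar i) (tcode s) f u"
  shows "tcode t \<le> x \<Longrightarrow> f (tcode t) = tcode (substt (Var(i := s)) t)"
proof (induction t)
  case (Var j)
  then show ?case using assms[OF Var(1)] by (auto simp: sub_step_def)
next
  case Zero
  then show ?case using assms[OF Zero(1)] by (simp add: sub_step_def)
next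
  case (Succ t)
  have "tcode t \<le> x" using Succ.prems by (auto dest: npair_le_dest)
  then show ?case using Succ assms[OF Succ.prems(1)] by (simp add: sub_step_def)
next
  case (Add s t)
  have "tcode s \<le> x" "tcode t \<le> x" using Add.prems by (auto dest: npair_le_dest)
  then show ?case using Add assms[OF Add.prems(1)] by (simp add: sub_step_def)
next
  case (Mul s t)
  have "tcode s \<le> x" "tcode t \<le> x" using Mul.prems by (auto dest: npair_le_dest)
  then show ?case using Mul assms[OF Mul.prems(1)] by (simp add: sub_step_def)
qed

lemma sub_step_unique_fm:
  assumes "\<And>u. u \<le> x \<Longrightarrow> sub_step (nVar i) (tcode s) f u" "fvt s = {}"
  shows "arithmetical p \<Longrightarrow> fcode p \<le> x \<Longrightarrow> f (fcode p) = fcode (subst1 p i s)"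
proof (induction p)
  case (Eql t t')
  have "tcode t \<le> x" "tcode t' \<le> x" using Eql.prems by (auto dest: npair_le_dest)
  then show ?case using assms(1)[OF Eql.prems(2)] sub_step_unique_tm[of x i s f, OF assms(1)]
    by (simp add: sub_step_def del: fun_upd_apply)
next
  case (Neg p)
  have "fcode p \<le> x" using Neg.prems by (auto dest: npair_le_dest)
  then show ?case using Neg assms(1)[OF Neg.prems(2)] by (simp add: sub_step_def)
next
  case (Dis p q)
  have "fcode p \<le> x" "fcode q \<le> x" using Dis.prems by (auto dest: npair_le_dest)
  then show ?case using Dis assms(1)[OF Dis.prems(2)] by (simp add: sub_step_def)
next
  case (Exi n p)
  have "fcode p \<le> x" using Exi.prems by (auto dest: npair_le_dest)
  moreover have "(Var(i := s))(n := Var n) = (if n = i then Var else Var(i := s))"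
    by auto
  ultimately show ?case
    using Exi assms(1)[OF Exi.prems(2)] assms(2) by (auto simp: sub_step_def simp del: fun_upd_apply)
qed simp

lemma sub_step_cong:
  "(\<And>w. w \<le> u \<Longrightarrow> f w = g w) \<Longrightarrow> sub_step v s g u \<Longrightarrow> sub_step v s f u"
  by (auto simp: sub_step_def)

function subn :: "nat \<Rightarrow> nat \<Rightarrow> nat \<Rightarrow> nat" where
  "subn v s u = (let p = npart2 u; p1 = npart1 p; p2 = npart2 p in
     if u = v then s
     else if u = nSucc p then nSucc (subn v s p)
     else if u = nAdd p1 p2 then nAdd (subn v s p1) (subn v s p2)
     else if u = nMul p1 p2 then nMul (subn v s p1) (subn v s p2)
     else if u = nEql p1 p2 then nEql (subn v s p1) (subn v s p2)
     else if u = nNeg p then nNeg (subn v s p)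
     else if u = nDis p1 p2 then nDis (subn v s p1) (subn v s p2)
     else if u = nExi p1 p2 \<and> p1 \<noteq> v then nExi p1 (subn v s p2)
     else u)"
  by auto
termination
  by (relation "measure (\<lambda>(v, s, u). u)"; (simp only: wf_measure in_measure prod.case)?; (elim conjE)?)
    (rule npair_tag_less[OF zero_less_numeral] npair_tag_less2[OF zero_less_numeral])+

declare subn.simps [simp del]

lemma subn_code [simp]:
  fixes i :: nat
  defines "v \<equiv> nVar i"
  shows "subn v s nZero = nZero" "subn v s v = s" "j \<noteq> i \<Longrightarrow> subn v s (nVar j) = nVar j"
    "subn v s (nSucc p) = nSucc (subn v s p)"
    "subn v s (nAdd p q) = nAdd (subn v s p) (subn v s q)"
    "subn v s (nMul p q) = nMul (subn v s p) (subn v s q)"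
    "subn v s (nEql p q) = nEql (subn v s p) (subn v s q)"
    "subn v s (nNeg p) = nNeg (subn v s p)"
    "subn v s (nDis p q) = nDis (subn v s p) (subn v s q)"
    "subn v s (nExi v p) = nExi v p"
    "w \<noteq> v \<Longrightarrow> subn v s (nExi w p) = nExi w (subn v s p)"
  unfolding v_def by (subst subn.simps; simp add: Let_def)+

lemma sat_Sub:
  fixes e :: "nat \<Rightarrow> nat"
  assumes "tval e x = fcode p" "arithmetical p" "tval e v = nVar i" "tval e s = tcode t" "fvt t = {}"
  shows "sat (=) D e (Sub x v s y) = (tval e y = fcode (subst1 p i t))"
proof
  assume "sat (=) D e (Sub x v s y)"
  then show "tval e y = fcode (subst1 p i t)"
    using sub_step_unique_fm[of "fcode p" i t] assms unfolding sat_Sub_beta by auto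
next
  let ?f = "subn (nVar i) (tcode t)"
  obtain a b where ab: "\<And>j. j \<le> fcode p \<Longrightarrow> beta a b j = ?f j"
    using beta_exists[of "fcode p" ?f] by blast
  have step: "sub_step (nVar i) (tcode t) ?f u" for u
    by (auto simp: sub_step_def)
  from this have "?f (fcode p) = fcode (subst1 p i t)"
    using sub_step_unique_fm[of "fcode p" i t] assms(2,5) by blast
  moreover have "sub_step (nVar i) (tcode t) (beta a b) u" if "u \<le> fcode p" for u
    by (rule sub_step_cong[of u _ ?f]) (use that ab step in auto)
  moreover assume "tval e y = fcode (subst1 p i t)"
  ultimately show "sat (=) D e (Sub x v s y)"
    unfolding sat_Sub_beta assms(1,3,4) using ab[of "fcode p"] by (intro exI[of _ a] exI[of _ b]) auto
qed

section \<open>An ultrapower of the natural numbers\<close>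

text \<open>
  A maximal family of sets all of whose finite intersections are infinite is a free ultrafilter.
\<close>

lemma free_ultrafilter_exists:
  "\<exists>F :: nat filter. F \<noteq> bot \<and> (\<forall>P. eventually P F \<or> eventually (\<lambda>n. \<not> P n) F) \<and>
     (\<forall>N. eventually (\<lambda>n. N \<le> n) F)"
proof -
  define A where "A = {S :: nat set set. \<forall>B \<subseteq> S. finite B \<longrightarrow> infinite (\<Inter>B)}"
  have "\<exists>M \<in> A. \<forall>X \<in> A. M \<subseteq> X \<longrightarrow> X = M"
  proof (rule subset_Zorn_nonempty)
    have "{} \<in> A" by (auto simp: A_def)
    then show "A \<noteq> {}" by blast
    fix C assume C: "C \<noteq> {}" "subset.chain A C"
    have "infinite (\<Inter>B)" if B: "B \<subseteq> \<Union>C" "finite B" for B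
    proof -
      obtain S where "S \<in> C" "B \<subseteq> S"
        using finite_subset_Union_chain[OF B(2,1) C] by blast
      then show ?thesis using C(2) B(2) by (auto simp: A_def subset.chain_def)
    qed
    then show "\<Union>C \<in> A" by (auto simp: A_def)
  qed
  then obtain M where M: "M \<in> A" and max: "\<And>X. X \<in> A \<Longrightarrow> M \<subseteq> X \<Longrightarrow> X = M" by blast
  have inf: "infinite (\<Inter>B)" if "B \<subseteq> M" "finite B" for B
    using M that by (auto simp: A_def)
  have extend: "\<exists>B \<subseteq> M. finite B \<and> finite (\<Inter>B \<inter> X)" if "X \<notin> M" for X
  proof -
    have "insert X M \<notin> A" using max[of "insert X M"] that by blast
    then obtain B where B: "B \<subseteq> insert X M" "finite B" "finite (\<Inter>B)" by (auto simp: A_def)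
    have "\<Inter>(B - {X}) \<inter> X \<subseteq> \<Inter>B" by auto
    then have "finite (\<Inter>(B - {X}) \<inter> X)" using B(3) finite_subset by blast
    then show ?thesis using B by (intro exI[of _ "B - {X}"]) auto
  qed
  have ultra: "X \<in> M \<or> - X \<in> M" for X
  proof (rule ccontr)
    assume "\<not> ?thesis"
    then obtain B B' where B: "B \<subseteq> M" "finite B" "finite (\<Inter>B \<inter> X)"
      and B': "B' \<subseteq> M" "finite B'" "finite (\<Inter>B' \<inter> - X)"
      using extend[of X] extend[of "- X"] by auto
    have "\<Inter>(B \<union> B') \<subseteq> (\<Inter>B \<inter> X) \<union> (\<Inter>B' \<inter> - X)" by auto
    then have "finite (\<Inter>(B \<union> B'))" using B(3) B'(3) finite_subset by blast
    then show False using inf[of "B \<union> B'"] B B' by auto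
  qed
  have up: "Y \<in> M" if "B \<subseteq> M" "finite B" "\<Inter>B \<subseteq> Y" for B Y
  proof (rule ccontr)
    assume "Y \<notin> M"
    then have "insert (- Y) B \<subseteq> M" using ultra that by auto
    moreover have "\<Inter>(insert (- Y) B) = {}" using that by auto
    ultimately show False using inf[of "insert (- Y) B"] that by (metis finite.emptyI finite_insert)
  qed
  define F where "F = Abs_filter (\<lambda>P. {n. P n} \<in> M)"
  have "is_filter (\<lambda>P. {n. P n} \<in> M)"
  proof
    show "{n. True} \<in> M" by (rule up[of "{}"]) auto
    show "{n. P n \<and> Q n} \<in> M" if "{n. P n} \<in> M" "{n. Q n} \<in> M" for P Q
      by (rule up[of "{{n. P n}, {n. Q n}}"]) (use that in auto)
    show "{n. Q n} \<in> M" if "\<forall>n. P n \<longrightarrow> Q n" "{n. P n} \<in> M" for P Q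
      by (rule up[of "{{n. P n}}"]) (use that in auto)
  qed
  then have ev: "eventually P F \<longleftrightarrow> {n. P n} \<in> M" for P
    unfolding F_def by (rule eventually_Abs_filter)
  have "{} \<notin> M" using inf[of "{{}}"] by auto
  then have "F \<noteq> bot" using ev[of "\<lambda>_. False"] by auto
  moreover have "eventually P F \<or> eventually (\<lambda>n. \<not> P n) F" for P
    using ultra[of "{n. P n}"] by (simp add: ev Collect_neg_eq)
  moreover have "eventually (\<lambda>n. N \<le> n) F" for N
  proof -
    have "- {n. N \<le> n} \<notin> M" using inf[of "{- {n. N \<le> n}}"] finite_lessThan[of N]
      by (auto simp: lessThan_def Compl_eq not_le)
    then show ?thesis using ultra[of "{n. N \<le> n}"] by (auto simp: ev)
  qed
  ultimately show ?thesis by blast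
qed

definition \<U> :: "nat filter" where
  "\<U> = (SOME F. F \<noteq> bot \<and> (\<forall>P. eventually P F \<or> eventually (\<lambda>n. \<not> P n) F) \<and>
     (\<forall>N. eventually (\<lambda>n. N \<le> n) F))"

lemma U_nontrivial [simp]: "\<U> \<noteq> bot"
  and U_ultra: "eventually P \<U> \<or> eventually (\<lambda>n. \<not> P n) \<U>"
  and U_ge: "\<forall>\<^sub>F n in \<U>. N \<le> n"
  using someI_ex[OF free_ultrafilter_exists] unfolding \<U>_def[symmetric] by blast+

lemma U_not [simp]: "(\<forall>\<^sub>F n in \<U>. \<not> P n) \<longleftrightarrow> \<not> eventually P \<U>"
  using U_ultra[of P] eventually_conj[of P \<U> "\<lambda>n. \<not> P n"] by (auto simp: eventually_False)

lemma U_disj: "(\<forall>\<^sub>F n in \<U>. P n \<or> Q n) \<longleftrightarrow> eventually P \<U> \<or> eventually Q \<U>"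
proof -
  have "(\<forall>\<^sub>F n in \<U>. \<not> (\<not> P n \<and> \<not> Q n)) \<longleftrightarrow> eventually P \<U> \<or> eventually Q \<U>"
    by (simp only: U_not eventually_conj_iff) auto
  then show ?thesis by simp
qed

lemma U_ex: "(\<forall>\<^sub>F n in \<U>. \<exists>y. P n y) \<longleftrightarrow> (\<exists>y. \<forall>\<^sub>F n in \<U>. P n (y n))"
proof
  assume "\<forall>\<^sub>F n in \<U>. \<exists>y. P n y"
  then have "\<forall>\<^sub>F n in \<U>. P n (SOME y. P n y)"
    by (rule eventually_mono) (rule someI_ex)
  then show "\<exists>y. \<forall>\<^sub>F n in \<U>. P n (y n)" by (rule exI[of _ "\<lambda>n. SOME y. P n y"])
qed (auto elim: eventually_mono)

definition eqU :: "(nat \<Rightarrow> 'a) \<Rightarrow> (nat \<Rightarrow> 'a) \<Rightarrow> bool" (infix "\<approx>" 50)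
  where "x \<approx> y \<longleftrightarrow> (\<forall>\<^sub>F n in \<U>. x n = y n)"

lemma eqU_refl [simp]: "x \<approx> x"
  by (simp add: eqU_def)

lemma eqU_sym: "x \<approx> y \<Longrightarrow> y \<approx> x"
  unfolding eqU_def by (erule eventually_mono) simp

lemma eqU_trans: "x \<approx> y \<Longrightarrow> y \<approx> z \<Longrightarrow> x \<approx> z"
  unfolding eqU_def by (erule (1) eventually_elim2) simp

abbreviation "nsat \<equiv> sat (=) (\<lambda>_ :: nat. False)"
abbreviation "msat T \<equiv> sat (\<approx>) (T :: (nat \<Rightarrow> nat) \<Rightarrow> bool)"

lemma tval_seq: "tval e t n = tval (\<lambda>i. e i n) t" for e :: "nat \<Rightarrow> nat \<Rightarrow> nat"
  by (induction t) auto

text \<open>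
  A witness of an existential formula is chosen at each index. On the two sides \<open>Tr\<close> may be
  interpreted differently, as it does not occur.
\<close>

theorem Los:
  fixes e :: "nat \<Rightarrow> nat \<Rightarrow> nat"
  assumes "arithmetical p"
  shows "msat T e p \<longleftrightarrow> (\<forall>\<^sub>F n in \<U>. sat (=) D (\<lambda>i. e i n) p)"
  using assms
proof (induction p arbitrary: e)
  case (Exi m p)
  have "(\<lambda>i. (e(m := x)) i n) = (\<lambda>i. e i n)(m := x n)" for x n by auto
  then have "msat T e (Exi m p) \<longleftrightarrow> (\<exists>x. \<forall>\<^sub>F n in \<U>. sat (=) D ((\<lambda>i. e i n)(m := x n)) p)"
    using Exi by simp
  also have "\<dots> \<longleftrightarrow> (\<forall>\<^sub>F n in \<U>. \<exists>y. sat (=) D ((\<lambda>i. e i n)(m := y)) p)"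
    by (rule U_ex[symmetric])
  finally show ?case by simp
qed (auto simp: eqU_def tval_seq U_disj)

text \<open>
  At index \<open>n\<close> the sequence \<open>x\<close> meets the strongest of the conditions \<open>A 0, \<dots>, A n\<close> that can be met
  there, if any. As each condition can be met almost everywhere, this is at least \<open>A N\<close> for almost all \<open>n\<close>.
\<close>

lemma saturation:
  fixes A :: "nat \<Rightarrow> nat \<Rightarrow> 'a \<Rightarrow> bool"
  assumes ex: "\<And>N. \<forall>\<^sub>F n in \<U>. \<exists>y. A N n y"
    and decr: "\<And>N M n y. N \<le> M \<Longrightarrow> A M n y \<Longrightarrow> A N n y"
  shows "\<exists>x. \<forall>N. \<forall>\<^sub>F n in \<U>. A N n (x n)"
proof -
  define K where "K n = {N. N \<le> n \<and> (\<exists>y. A N n y)}" for n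
  define x where "x n = (SOME y. A (Max (K n)) n y)" for n
  have "\<forall>\<^sub>F n in \<U>. A N n (x n)" for N
    using ex[of N] U_ge[of N]
  proof eventually_elim
    case (elim n)
    then have "N \<in> K n" by (simp add: K_def)
    moreover have "finite (K n)" by (simp add: K_def)
    ultimately have "Max (K n) \<in> K n" "N \<le> Max (K n)" by (auto intro: Max_in)
    then have "A (Max (K n)) n (x n)"
      unfolding x_def K_def by (auto intro: someI_ex)
    then show ?case using decr \<open>N \<le> Max (K n)\<close> by blast
  qed
  then show ?thesis by blast
qed

lemma tval_eqU:
  "(\<And>i. i \<in> fvt t \<Longrightarrow> e i \<approx> e' i) \<Longrightarrow> tval e t \<approx> (tval e' t :: nat \<Rightarrow> nat)"
proof (induction t)
  case (Succ t)
  then have "tval e t \<approx> tval e' t" by simp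
  then show ?case unfolding eqU_def by (rule eventually_mono) simp
next
  case (Add s t)
  then have "tval e s \<approx> tval e' s" "tval e t \<approx> tval e' t" by simp_all
  then show ?case unfolding eqU_def by (rule eventually_elim2) simp
next
  case (Mul s t)
  then have "tval e s \<approx> tval e' s" "tval e t \<approx> tval e' t" by simp_all
  then show ?case unfolding eqU_def by (rule eventually_elim2) simp
qed simp_all

definition respects_eqU :: "((nat \<Rightarrow> nat) \<Rightarrow> bool) \<Rightarrow> bool"
  where "respects_eqU T \<longleftrightarrow> (\<forall>x y. x \<approx> y \<longrightarrow> T x \<longrightarrow> T y)"

lemma respects_eqU_iff: "respects_eqU T \<Longrightarrow> x \<approx> y \<Longrightarrow> T x \<longleftrightarrow> T y"
  unfolding respects_eqU_def using eqU_sym by blast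

lemma msat_eqU:
  assumes "respects_eqU T"
  shows "(\<And>i. i \<in> fv p \<Longrightarrow> e i \<approx> e' i) \<Longrightarrow> msat T e p = msat T e' p"
proof (induction p arbitrary: e e')
  case (Eql s t)
  have "tval e s \<approx> tval e' s" "tval e t \<approx> tval e' t"
    by (rule tval_eqU, simp add: Eql)+
  then show ?case using eqU_sym eqU_trans by (metis sat.simps(1))
next
  case (Tr t)
  have "tval e t \<approx> tval e' t" by (rule tval_eqU) (simp add: Tr)
  then show ?case using respects_eqU_iff[OF assms] by simp
next
  case (Neg p)
  have "msat T e p = msat T e' p" by (rule Neg.IH) (simp add: Neg.prems)
  then show ?case by simp
next
  case (Dis p q)
  have "msat T e p = msat T e' p" "msat T e q = msat T e' q"
    by (rule Dis.IH, simp add: Dis.prems)+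
  then show ?case by simp
next
  case (Exi n p)
  have "msat T (e(n := x)) p = msat T (e'(n := x)) p" for x
    by (rule Exi.IH) (simp add: Exi.prems)
  then show ?case by simp
qed

lemma msat_soundness:
  assumes "\<Gamma> \<turnstile> p" "respects_eqU T" "\<And>q. q \<in> \<Gamma> \<Longrightarrow> msat T e q"
  shows "msat T e p"
proof (rule soundness[OF assms(1)])
  fix x y :: "nat \<Rightarrow> nat" and e n p
  assume "x \<approx> y"
  then have "msat T (e(n := x)) p = msat T (e(n := y)) p"
    by (intro msat_eqU[OF assms(2)]) simp
  then show "msat T (e(n := x)) p \<Longrightarrow> msat T (e(n := y)) p" by simp
qed (use assms(3) in auto)

section \<open>Peano arithmetic in the ultrapower\<close>

lemma nsat_Uni: "nsat e (Uni n p) = (\<forall>x. nsat (e(n := x)) p)"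
  by simp

lemma nsat_univ_closure: "(\<And>e. nsat e p) \<Longrightarrow> nsat e (univ_closure p)"
proof -
  assume "\<And>e. nsat e p"
  then have "nsat e (foldr Uni xs p)" for xs e
    by (induction xs arbitrary: e) auto
  then show ?thesis by (simp add: univ_closure_def)
qed

lemma arithmetical_univ_closure [simp]: "arithmetical (univ_closure p) = arithmetical p"
proof -
  have "arithmetical (foldr Uni xs p) = arithmetical p" for xs
    by (induction xs) auto
  then show ?thesis by (simp add: univ_closure_def)
qed

lemma nsat_induction_axiom: "nsat e (induction_axiom n p)"
  unfolding induction_axiom_def
proof (rule nsat_univ_closure)
  fix e
  have "nsat e (Uni n p)" if "nsat e (subst1 p n Zero)"
    "nsat e (Uni n (p \<^bold>\<longrightarrow> subst1 p n (Succ (Var n))))"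
  proof -
    have "nsat (e(n := x)) p" for x
    proof (induction x)
      case 0
      then show ?case using that(1) by (simp add: sat_subst1 del: fun_upd_apply)
    next
      case (Suc x)
      from that(2) have "nsat (e(n := x)) (p \<^bold>\<longrightarrow> subst1 p n (Succ (Var n)))"
        unfolding nsat_Uni ..
      then show ?case using Suc by (simp add: sat_subst1 fun_upd_same del: fun_upd_apply)
    qed
    then show ?thesis by simp
  qed
  then show "nsat e (subst1 p n Zero \<^bold>\<and> Uni n (p \<^bold>\<longrightarrow> subst1 p n (Succ (Var n))) \<^bold>\<longrightarrow> Uni n p)"
    by auto
qed

lemma arithmetical_ex [simp]: "(\<And>t. arithmetical (f t)) \<Longrightarrow> arithmetical (ex f)"
  by (simp add: ex_def Let_def)

lemma nsat_PA:
  assumes "p \<in> PA" shows "nsat e p" "arithmetical p"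
proof -
  have "nsat e (\<^bold>\<forall>x. \<^bold>\<not> Succ x \<^bold>= Zero) = (\<forall>x. \<not> Suc x = 0)"
    "nsat e (\<^bold>\<forall>x. \<^bold>\<forall>y. Succ x \<^bold>= Succ y \<^bold>\<longrightarrow> x \<^bold>= y) = (\<forall>x y :: nat. Suc x = Suc y \<longrightarrow> x = y)"
    "nsat e (\<^bold>\<forall>x. x \<^bold>+ Zero \<^bold>= x) = (\<forall>x :: nat. x + 0 = x)"
    "nsat e (\<^bold>\<forall>x. \<^bold>\<forall>y. x \<^bold>+ Succ y \<^bold>= Succ (x \<^bold>+ y)) = (\<forall>x y :: nat. x + Suc y = Suc (x + y))"
    "nsat e (\<^bold>\<forall>x. x \<^bold>* Zero \<^bold>= Zero) = (\<forall>x :: nat. x * 0 = 0)"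
    "nsat e (\<^bold>\<forall>x. \<^bold>\<forall>y. x \<^bold>* Succ y \<^bold>= x \<^bold>* y \<^bold>+ x) = (\<forall>x y :: nat. x * Suc y = x * y + x)"
    by (((rule sat_quantI, (elim freshE)?) | rule sat_connI | (simp; fail))+)
  then show "nsat e p"
    using assms nsat_induction_axiom unfolding PA_def by auto
  show "arithmetical p"
    using assms unfolding PA_def by (auto simp: induction_axiom_def)
qed

lemma msat_PA: "p \<in> PA \<Longrightarrow> msat T e p"
  using nsat_PA by (subst Los[where D = "\<lambda>_. False"]) auto

section \<open>The truth axioms in the ultrapower\<close>

text \<open>
  Decoding functions allow the truth axioms to be read as statements about arbitrary sequences of
  numbers, of which almost all entries are codes. Elsewhere the values are arbitrary.
\<close>

definition untm :: "nat \<Rightarrow> tm" where "untm x = (SOME t. x = tcode t)"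
definition unfm :: "nat \<Rightarrow> fm" where "unfm x = (SOME p. arithmetical p \<and> x = fcode p)"

lemma untm_tcode [simp]: "untm (tcode t) = t"
  by (simp add: untm_def)

lemma unfm_fcode [simp]: "arithmetical p \<Longrightarrow> unfm (fcode p) = p"
  unfolding unfm_def by (rule some_equality) (auto dest: fcode_inject)

abbreviation cval :: "tm \<Rightarrow> nat" where "cval \<equiv> tval (\<lambda>_. 0)"

definition is_closed_term :: "nat \<Rightarrow> bool"
  where "is_closed_term x \<longleftrightarrow> (\<exists>t. fvt t = {} \<and> x = tcode t)"

definition is_sentence :: "nat \<Rightarrow> bool"
  where "is_sentence x \<longleftrightarrow> (\<exists>p. arithmetical p \<and> fv p = {} \<and> x = fcode p)"

definition is_form1 :: "nat \<Rightarrow> nat \<Rightarrow> bool"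
  where "is_form1 v x \<longleftrightarrow> (\<exists>i p. arithmetical p \<and> fv p \<subseteq> {i} \<and> v = nVar i \<and> x = fcode p)"

definition sub_code :: "nat \<Rightarrow> nat \<Rightarrow> nat \<Rightarrow> nat"
  where "sub_code x v s = fcode (subst1 (unfm x) (npart2 v) (untm s))"

definition num_code :: "nat \<Rightarrow> nat"
  where "num_code x = tcode (numeral_tm x)"

lemma is_form1_neg [simp]: "is_form1 v x \<Longrightarrow> is_form1 v (nNeg x)"
  unfolding is_form1_def by (metis arithmetical.simps(3) fcode.simps(3) fv.simps(3))

lemma is_closed_term_num [simp]: "is_closed_term (num_code x)"
  unfolding is_closed_term_def num_code_def using fvt_numeral_tm by blast

lemma fresh_SameVal: "fresh n (SameVal s t) \<Longrightarrow> (n \<notin> fvt s \<Longrightarrow> n \<notin> fvt t \<Longrightarrow> R) \<Longrightarrow> R"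
  unfolding SameVal_def by (elim freshE) simp

lemma fresh_TrSub: "fresh n (TrSub p v s) \<Longrightarrow>
    (n \<notin> fvt p \<Longrightarrow> n \<notin> fvt v \<Longrightarrow> n \<notin> fvt s \<Longrightarrow> R) \<Longrightarrow> R"
  unfolding TrSub_def by (elim freshE) simp

lemma fresh_TrNum: "fresh n (TrNum p v x) \<Longrightarrow>
    (n \<notin> fvt p \<Longrightarrow> n \<notin> fvt v \<Longrightarrow> n \<notin> fvt x \<Longrightarrow> R) \<Longrightarrow> R"
  unfolding TrNum_def by (elim freshE fresh_TrSub) simp

lemma fresh_Int_at: "fresh n (Int_at v p) \<Longrightarrow> (n \<notin> fvt p \<Longrightarrow> n \<notin> fvt v \<Longrightarrow> R) \<Longrightarrow> R"
  unfolding Int_at_def by (elim freshE fresh_TrNum) simp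

lemma fresh_Tot: "fresh n (Tot v p) \<Longrightarrow> (n \<notin> fvt p \<Longrightarrow> n \<notin> fvt v \<Longrightarrow> R) \<Longrightarrow> R"
  unfolding Tot_def by (elim freshE fresh_TrNum) simp

lemmas fresh_truthE = freshE fresh_SameVal fresh_TrSub fresh_TrNum fresh_Int_at fresh_Tot

lemma arithmetical_defs [simp]:
  "arithmetical (Leq s t)" "arithmetical (Beta s t u v)" "arithmetical (IsVar s)"
  "arithmetical (IsTerm s)" "arithmetical (IsForm s)" "arithmetical (FreeIn s t)"
  "arithmetical (IsClosedTerm s)" "arithmetical (IsSent s)" "arithmetical (IsForm1 s t)"
  "arithmetical (Num s t)" "arithmetical (Val s t)" "arithmetical (Sub s t u v)"
  "arithmetical (SameVal s t)"
  by (simp_all add: Leq_def Beta_def IsVar_def IsTerm_def IsForm_def FreeIn_def IsClosedTerm_def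
      IsSent_def IsForm1_def Num_def Val_def Sub_def SameVal_def)

lemma tval_constructors_seq [simp]:
  fixes e :: "nat \<Rightarrow> nat \<Rightarrow> nat"
  shows "tval e (cEql s t) = (\<lambda>n. nEql (tval e s n) (tval e t n))"
    "tval e (cNeg s) = (\<lambda>n. nNeg (tval e s n))"
    "tval e (cDis s t) = (\<lambda>n. nDis (tval e s n) (tval e t n))"
    "tval e (cExi s t) = (\<lambda>n. nExi (tval e s n) (tval e t n))"
  by (rule ext; simp add: tval_seq)+

context
  fixes T :: "(nat \<Rightarrow> nat) \<Rightarrow> bool" and e :: "nat \<Rightarrow> nat \<Rightarrow> nat"
begin

lemma msat_IsClosedTerm [simp]:
  "msat T e (IsClosedTerm x) \<longleftrightarrow> (\<forall>\<^sub>F n in \<U>. is_closed_term (tval e x n))"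
  by (simp add: Los[where D = "\<lambda>_. False"] is_closed_term_def tval_seq)

lemma msat_IsSent [simp]:
  "msat T e (IsSent x) \<longleftrightarrow> (\<forall>\<^sub>F n in \<U>. is_sentence (tval e x n))"
  by (simp add: Los[where D = "\<lambda>_. False"] is_sentence_def tval_seq)

lemma msat_IsForm1 [simp]:
  "msat T e (IsForm1 v x) \<longleftrightarrow> (\<forall>\<^sub>F n in \<U>. is_form1 (tval e v n) (tval e x n))"
  by (simp add: Los[where D = "\<lambda>_. False"] is_form1_def tval_seq)

lemma msat_Num: "msat T e (Num x y) \<longleftrightarrow> tval e y \<approx> (\<lambda>n. num_code (tval e x n))"
  by (simp add: Los[where D = "\<lambda>_. False"] eqU_def num_code_def tval_seq)

lemma msat_Sub:
  assumes "\<forall>\<^sub>F n in \<U>. is_form1 (tval e v n) (tval e x n)"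
    and "\<forall>\<^sub>F n in \<U>. is_closed_term (tval e s n)"
  shows "msat T e (Sub x v s y) \<longleftrightarrow>
    tval e y \<approx> (\<lambda>n. sub_code (tval e x n) (tval e v n) (tval e s n))"
proof -
  have "\<forall>\<^sub>F n in \<U>. nsat (\<lambda>i. e i n) (Sub x v s y) \<longleftrightarrow>
      tval e y n = sub_code (tval e x n) (tval e v n) (tval e s n)"
    using assms
  proof eventually_elim
    case (elim n)
    then obtain i p t where *: "arithmetical p" "tval e v n = nVar i" "tval e x n = fcode p"
      "fvt t = {}" "tval e s n = tcode t"
      unfolding is_form1_def is_closed_term_def by blast
    then show ?case
      using sat_Sub[of "\<lambda>i. e i n" x p v i s t] by (simp add: tval_seq[symmetric] sub_code_def)
  qed
  from eventually_subst[OF this] show ?thesis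
    by (simp add: Los[where D = "\<lambda>_. False"] eqU_def)
qed

end

lemma nsat_SameVal:
  fixes e :: "nat \<Rightarrow> nat"
  assumes "is_closed_term (tval e s)" "is_closed_term (tval e t)"
  shows "sat (=) D e (SameVal s t) \<longleftrightarrow> cval (untm (tval e s)) = cval (untm (tval e t))"
proof -
  obtain s' t' where *: "fvt s' = {}" "tval e s = tcode s'" "fvt t' = {}" "tval e t = tcode t'"
    using assms unfolding is_closed_term_def by blast
  have "sat (=) D e (SameVal s t) \<longleftrightarrow> (\<exists>x. x = cval s' \<and> x = cval t')"
    unfolding SameVal_def
  proof (rule sat_exI, elim fresh_truthE)
    fix n x assume "n \<notin> fvt s" "n \<notin> fvt t"
    then show "sat (=) D (e(n := x)) (Val s (Var n) \<^bold>\<and> Val t (Var n)) \<longleftrightarrow> x = cval s' \<and> x = cval t'"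
      using * sat_Val[of "e(n := x)" s s' D "Var n" "\<lambda>_. 0"] sat_Val[of "e(n := x)" t t' D "Var n" "\<lambda>_. 0"]
      by auto
  qed
  then show ?thesis using * by auto
qed

lemma msat_SameVal:
  assumes "\<forall>\<^sub>F n in \<U>. is_closed_term (tval e s n)" "\<forall>\<^sub>F n in \<U>. is_closed_term (tval e t n)"
  shows "msat T e (SameVal s t) \<longleftrightarrow> (\<forall>\<^sub>F n in \<U>. cval (untm (tval e s n)) = cval (untm (tval e t n)))"
proof -
  have "\<forall>\<^sub>F n in \<U>. nsat (\<lambda>i. e i n) (SameVal s t) \<longleftrightarrow>
      cval (untm (tval e s n)) = cval (untm (tval e t n))"
    using assms by eventually_elim (simp add: nsat_SameVal tval_seq)
  from eventually_subst[OF this] show ?thesis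
    by (simp add: Los[where D = "\<lambda>_. False"])
qed

context
  fixes T :: "(nat \<Rightarrow> nat) \<Rightarrow> bool" and e :: "nat \<Rightarrow> nat \<Rightarrow> nat"
  assumes resp: "respects_eqU T"
begin

lemma ex_eqU_T: "(\<exists>y. y \<approx> x \<and> T y) \<longleftrightarrow> T x"
  using respects_eqU_iff[OF resp] eqU_refl by blast

lemma msat_TrSub:
  assumes "\<forall>\<^sub>F n in \<U>. is_form1 (tval e v n) (tval e p n)"
    and "\<forall>\<^sub>F n in \<U>. is_closed_term (tval e s n)"
  shows "msat T e (TrSub p v s) \<longleftrightarrow> T (\<lambda>n. sub_code (tval e p n) (tval e v n) (tval e s n))"
proof -
  have "msat T e (TrSub p v s) \<longleftrightarrow>
      (\<exists>y. y \<approx> (\<lambda>n. sub_code (tval e p n) (tval e v n) (tval e s n)) \<and> T y)"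
    unfolding TrSub_def
  proof (rule sat_exI, elim fresh_truthE)
    fix m y assume "m \<notin> fvt p" "m \<notin> fvt v" "m \<notin> fvt s"
    then show "msat T (e(m := y)) (Sub p v s (Var m) \<^bold>\<and> Tr (Var m)) \<longleftrightarrow>
        y \<approx> (\<lambda>n. sub_code (tval e p n) (tval e v n) (tval e s n)) \<and> T y"
      using assms msat_Sub[of "e(m := y)" v p s T "Var m"] by simp
  qed
  then show ?thesis by (simp only: ex_eqU_T)
qed

end

context
  fixes T :: "(nat \<Rightarrow> nat) \<Rightarrow> bool" and e :: "nat \<Rightarrow> nat \<Rightarrow> nat"
  assumes resp: "respects_eqU T"
begin

lemma msat_TrNum:
  assumes "\<forall>\<^sub>F n in \<U>. is_form1 (tval e v n) (tval e p n)"
  shows "msat T e (TrNum p v x) \<longleftrightarrow>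
    T (\<lambda>n. sub_code (tval e p n) (tval e v n) (num_code (tval e x n)))"
proof -
  let ?x = "\<lambda>n. num_code (tval e x n)"
  let ?Q = "\<lambda>y. T (\<lambda>n. sub_code (tval e p n) (tval e v n) (y n))"
  have "msat T e (TrNum p v x) \<longleftrightarrow> (\<exists>y. y \<approx> ?x \<and> ?Q y)"
    unfolding TrNum_def
  proof (rule sat_exI, elim fresh_truthE)
    fix m y assume m: "m \<notin> fvt p" "m \<notin> fvt v" "m \<notin> fvt x"
    have num: "msat T (e(m := y)) (Num x (Var m)) \<longleftrightarrow> y \<approx> ?x"
      using m by (simp add: msat_Num)
    have "msat T (e(m := y)) (TrSub p v (Var m)) \<longleftrightarrow> ?Q y" if "y \<approx> ?x"
    proof -
      have "\<forall>\<^sub>F n in \<U>. is_closed_term (y n)"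
        using that unfolding eqU_def by (rule eventually_mono) simp
      then show ?thesis
        using m assms msat_TrSub[OF resp, of "e(m := y)" v p "Var m"] by simp
    qed
    then show "msat T (e(m := y)) (Num x (Var m) \<^bold>\<and> TrSub p v (Var m)) \<longleftrightarrow> y \<approx> ?x \<and> ?Q y"
      using num by auto
  qed
  moreover have "?Q y = ?Q ?x" if "y \<approx> ?x" for y
    by (rule respects_eqU_iff[OF resp])
      (use that in \<open>auto simp: eqU_def elim: eventually_mono\<close>)
  ultimately show ?thesis using eqU_refl by blast
qed

end

text \<open>
  Read in the ultrapower, the axioms speak of sequences of codes. They are evaluated for every
  interpretation of \<open>Tr\<close> that respects equality, since they are needed for two of them: the least
  positive truth predicate and the one which is defined from it.
\<close>

abbreviation "closedU x \<equiv> \<forall>\<^sub>F n in \<U>. is_closed_term (x n)"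
abbreviation "sentU x \<equiv> \<forall>\<^sub>F n in \<U>. is_sentence (x n)"
abbreviation "form1U v x \<equiv> \<forall>\<^sub>F n in \<U>. is_form1 (v n) (x n)"

context
  fixes T :: "(nat \<Rightarrow> nat) \<Rightarrow> bool" and e :: "nat \<Rightarrow> nat \<Rightarrow> nat"
  assumes resp: "respects_eqU T"
begin

lemma msat_axiom_Eql:
  "msat T e (\<^bold>\<forall>s. \<^bold>\<forall>t. IsClosedTerm s \<^bold>\<and> IsClosedTerm t \<^bold>\<longrightarrow> (Tr (cEql s t) \<^bold>\<longleftrightarrow> SameVal s t)) \<longleftrightarrow>
    (\<forall>s t. closedU s \<and> closedU t \<longrightarrow>
      (T (\<lambda>n. nEql (s n) (t n)) \<longleftrightarrow> (\<forall>\<^sub>F n in \<U>. cval (untm (s n)) = cval (untm (t n)))))"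
  by ((rule sat_quantI, (elim fresh_truthE)?) | rule sat_impI' sat_iffI sat_conI
      | (simp add: msat_SameVal; fail))+

lemma msat_axiom_Neg_Eql:
  "msat T e (\<^bold>\<forall>s. \<^bold>\<forall>t. IsClosedTerm s \<^bold>\<and> IsClosedTerm t \<^bold>\<longrightarrow> (Tr (cNeg (cEql s t)) \<^bold>\<longleftrightarrow> \<^bold>\<not> SameVal s t)) \<longleftrightarrow>
    (\<forall>s t. closedU s \<and> closedU t \<longrightarrow>
      (T (\<lambda>n. nNeg (nEql (s n) (t n))) \<longleftrightarrow> \<not> (\<forall>\<^sub>F n in \<U>. cval (untm (s n)) = cval (untm (t n)))))"
  by ((rule sat_quantI, (elim fresh_truthE)?) | rule sat_impI' sat_iffI sat_conI sat_negI
      | (simp add: msat_SameVal del: U_not; fail))+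

lemma msat_axiom_Dis:
  "msat T e (\<^bold>\<forall>p. \<^bold>\<forall>q. IsSent p \<^bold>\<and> IsSent q \<^bold>\<longrightarrow> (Tr (cDis p q) \<^bold>\<longleftrightarrow> Tr p \<^bold>\<or> Tr q)) \<longleftrightarrow>
    (\<forall>p q. sentU p \<and> sentU q \<longrightarrow> (T (\<lambda>n. nDis (p n) (q n)) \<longleftrightarrow> T p \<or> T q))"
  by ((rule sat_quantI, (elim fresh_truthE)?) | rule sat_impI' sat_iffI sat_conI sat_disI
      | (simp; fail))+

lemma msat_axiom_Neg_Dis:
  "msat T e (\<^bold>\<forall>p. \<^bold>\<forall>q. IsSent p \<^bold>\<and> IsSent q \<^bold>\<longrightarrow>
      (Tr (cNeg (cDis p q)) \<^bold>\<longleftrightarrow> Tr (cNeg p) \<^bold>\<and> Tr (cNeg q))) \<longleftrightarrow>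
    (\<forall>p q. sentU p \<and> sentU q \<longrightarrow>
      (T (\<lambda>n. nNeg (nDis (p n) (q n))) \<longleftrightarrow> T (\<lambda>n. nNeg (p n)) \<and> T (\<lambda>n. nNeg (q n))))"
  by ((rule sat_quantI, (elim fresh_truthE)?) | rule sat_impI' sat_iffI sat_conI
      | (simp; fail))+

lemma msat_axiom_Exi:
  "msat T e (\<^bold>\<forall>v. \<^bold>\<forall>p. IsForm1 v p \<^bold>\<longrightarrow> (Tr (cExi v p) \<^bold>\<longleftrightarrow> (\<^bold>\<exists>x. TrNum p v x))) \<longleftrightarrow>
    (\<forall>v p. form1U v p \<longrightarrow> (T (\<lambda>n. nExi (v n) (p n)) \<longleftrightarrow>
      (\<exists>x. T (\<lambda>n. sub_code (p n) (v n) (num_code (x n))))))"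
  by ((rule sat_quantI, (elim fresh_truthE)?) | rule sat_impI' sat_iffI
      | (simp add: msat_TrNum[OF resp]; fail))+

lemma msat_axiom_Neg_Exi:
  "msat T e (\<^bold>\<forall>v. \<^bold>\<forall>p. IsForm1 v p \<^bold>\<longrightarrow>
      (Tr (cNeg (cExi v p)) \<^bold>\<longleftrightarrow> (\<^bold>\<forall>x. TrNum (cNeg p) v x))) \<longleftrightarrow>
    (\<forall>v p. form1U v p \<longrightarrow> (T (\<lambda>n. nNeg (nExi (v n) (p n))) \<longleftrightarrow>
      (\<forall>x. T (\<lambda>n. sub_code (nNeg (p n)) (v n) (num_code (x n))))))"
  by ((rule sat_quantI, (elim fresh_truthE)?) | rule sat_impI' sat_iffI
      | (subst msat_TrNum[OF resp]; simp add: eventually_mono[OF _ is_form1_neg]; fail) | (simp; fail))+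

lemma msat_axiom_Neg_Neg:
  "msat T e (\<^bold>\<forall>p. IsSent p \<^bold>\<longrightarrow> (Tr (cNeg (cNeg p)) \<^bold>\<longleftrightarrow> Tr p)) \<longleftrightarrow>
    (\<forall>p. sentU p \<longrightarrow> (T (\<lambda>n. nNeg (nNeg (p n))) \<longleftrightarrow> T p))"
  by ((rule sat_quantI, (elim fresh_truthE)?) | rule sat_impI' sat_iffI | (simp; fail))+

lemma msat_axiom_regularity:
  "msat T e (\<^bold>\<forall>v. \<^bold>\<forall>p. \<^bold>\<forall>s. \<^bold>\<forall>t. IsForm1 v p \<^bold>\<and> IsClosedTerm s \<^bold>\<and> IsClosedTerm t \<^bold>\<longrightarrow>
       (SameVal s t \<^bold>\<longrightarrow> (TrSub p v s \<^bold>\<longleftrightarrow> TrSub p v t))) \<longleftrightarrow>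
    (\<forall>v p s t. form1U v p \<and> closedU s \<and> closedU t \<longrightarrow>
      ((\<forall>\<^sub>F n in \<U>. cval (untm (s n)) = cval (untm (t n))) \<longrightarrow>
        (T (\<lambda>n. sub_code (p n) (v n) (s n)) \<longleftrightarrow> T (\<lambda>n. sub_code (p n) (v n) (t n)))))"
  by ((rule sat_quantI, (elim fresh_truthE)?) | rule sat_impI' sat_iffI sat_conI
      | (simp add: msat_SameVal msat_TrSub[OF resp]; fail))+

end

definition int_at :: "((nat \<Rightarrow> nat) \<Rightarrow> bool) \<Rightarrow> (nat \<Rightarrow> nat) \<Rightarrow> (nat \<Rightarrow> nat) \<Rightarrow> bool" where
  "int_at T v p \<longleftrightarrow>
    ((\<forall>x. T (\<lambda>n. sub_code (p n) (v n) (num_code (x n))) \<longrightarrow>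
          T (\<lambda>n. sub_code (p n) (v n) (num_code (Suc (x n))))) \<longrightarrow>
     (T (\<lambda>n. sub_code (p n) (v n) (num_code 0)) \<longrightarrow>
        (\<forall>x. T (\<lambda>n. sub_code (p n) (v n) (num_code (x n))))))"

lemma msat_Int_at:
  assumes resp: "respects_eqU T" and "form1U (tval e v) (tval e p)"
  shows "msat T e (Int_at v p) \<longleftrightarrow> int_at T (tval e v) (tval e p)"
  unfolding Int_at_def int_at_def using assms(2)
  by - ((rule sat_quantI, (elim fresh_truthE)?) | rule sat_impI
      | (simp add: msat_TrNum[OF resp]; fail))+

lemma msat_INT_all:
  assumes resp: "respects_eqU T"
  shows "msat T e INT_all \<longleftrightarrow> (\<forall>v p. form1U v p \<longrightarrow> int_at T v p)"
  unfolding INT_all_def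
  by ((rule sat_quantI, (elim fresh_truthE)?) | rule sat_impI'
      | (simp add: msat_Int_at[OF resp]; fail))+

lemma msat_Tot:
  assumes resp: "respects_eqU T"
  shows "msat T e (Tot v p) \<longleftrightarrow> form1U (tval e v) (tval e p) \<and>
    (\<forall>x. T (\<lambda>n. sub_code (tval e p n) (tval e v n) (num_code (x n)))
       \<or> T (\<lambda>n. sub_code (nNeg (tval e p n)) (tval e v n) (num_code (x n))))"
proof -
  have "msat T e (\<^bold>\<forall>x. TrNum p v x \<^bold>\<or> TrNum (cNeg p) v x) \<longleftrightarrow>
      (\<forall>x. T (\<lambda>n. sub_code (tval e p n) (tval e v n) (num_code (x n)))
       \<or> T (\<lambda>n. sub_code (nNeg (tval e p n)) (tval e v n) (num_code (x n))))"
    if "form1U (tval e v) (tval e p)"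
    using that eventually_mono[OF that is_form1_neg]
    by - ((rule sat_quantI, (elim fresh_truthE)?) | rule sat_disI
      | (simp add: msat_TrNum[OF resp]; fail))+
  then show ?thesis
    unfolding Tot_def by (auto simp del: sat.simps(3) simp: sat_conI)
qed

lemma msat_INT_tot:
  assumes resp: "respects_eqU T"
  shows "msat T e INT_tot \<longleftrightarrow> (\<forall>v p. form1U v p \<and>
    (\<forall>x. T (\<lambda>n. sub_code (p n) (v n) (num_code (x n)))
       \<or> T (\<lambda>n. sub_code (nNeg (p n)) (v n) (num_code (x n)))) \<longrightarrow> int_at T v p)"
  unfolding INT_tot_def
  by ((rule sat_quantI, (elim fresh_truthE)?) | rule sat_impI'
      | (simp add: msat_Int_at[OF resp] msat_Tot[OF resp]; fail))+

section \<open>The least positive truth predicate of the ultrapower\<close>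

text \<open>
  One application of the truth axioms, read from right to left. The operator is positive, so it
  has a least fixed point, whose finite stages are the following predicates.
\<close>

fun truth_step :: "(fm \<Rightarrow> bool) \<Rightarrow> fm \<Rightarrow> bool" where
  "truth_step X (s \<^bold>= t) = (cval s = cval t)"
| "truth_step X (\<^bold>\<not> (s \<^bold>= t)) = (cval s \<noteq> cval t)"
| "truth_step X (p \<^bold>\<or> q) = (X p \<or> X q)"
| "truth_step X (\<^bold>\<not> (p \<^bold>\<or> q)) = (X (\<^bold>\<not> p) \<and> X (\<^bold>\<not> q))"
| "truth_step X (Exi v p) = (\<exists>x. X (subst1 p v (numeral_tm x)))"
| "truth_step X (\<^bold>\<not> (Exi v p)) = (\<forall>x. X (\<^bold>\<not> subst1 p v (numeral_tm x)))"
| "truth_step X (\<^bold>\<not> (\<^bold>\<not> p)) = X p"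
| "truth_step X (Tr t) = False"
| "truth_step X (\<^bold>\<not> (Tr t)) = False"

primrec truth_rank :: "nat \<Rightarrow> fm \<Rightarrow> bool" where
  "truth_rank 0 = (\<lambda>p. False)"
| "truth_rank (Suc N) = truth_step (truth_rank N)"

lemma truth_step_mono: "(\<And>p. X p \<Longrightarrow> Y p) \<Longrightarrow> truth_step X p \<Longrightarrow> truth_step Y p"
  by (cases "(X, p)" rule: truth_step.cases) auto

lemma truth_rank_Suc: "truth_rank N p \<Longrightarrow> truth_rank (Suc N) p"
proof (induction N arbitrary: p)
  case (Suc N)
  then show ?case using truth_step_mono[of "truth_rank N" "truth_rank (Suc N)" p] by simp
qed simp

lemma truth_rank_mono: "N \<le> M \<Longrightarrow> truth_rank N p \<Longrightarrow> truth_rank M p"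
proof (induction M rule: dec_induct)
  case (step M)
  then show ?case using truth_rank_Suc by blast
qed simp

lemma fv_subst1_closed: "fvt t = {} \<Longrightarrow> fv (subst1 p v t) = fv p - {v}"
  by (subst fv_subst_ground) (auto split: if_splits)

lemma cval_closed: "fvt t = {} \<Longrightarrow> tval e t = cval t"
  by (rule tval_cong) simp

lemma truth_rank_sound: "truth_rank N p \<Longrightarrow> fv p = {} \<Longrightarrow> nsat e p"
proof (induction N arbitrary: p)
  case (Suc N)
  have IH: "nsat e q" if "truth_rank N q" "fv q = {}" for q using Suc.IH that .
  from Suc.prems show ?case
  proof (cases "(truth_rank N, p)" rule: truth_step.cases)
    case (4 X q r)
    then show ?thesis using Suc.prems IH[of "\<^bold>\<not> q"] IH[of "\<^bold>\<not> r"] by simp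
  next
    case (5 X v q)
    then obtain x where "truth_rank N (subst1 q v (numeral_tm x))" using Suc.prems by auto
    then have "nsat e (subst1 q v (numeral_tm x))"
      using IH 5 Suc.prems(2) by (simp add: fv_subst1_closed)
    then show ?thesis using 5 by (auto simp: sat_subst1 simp del: fun_upd_apply)
  next
    case (6 X v q)
    have "nsat e (\<^bold>\<not> subst1 q v (numeral_tm x))" for x
      by (rule IH) (use 6 Suc.prems in \<open>simp_all add: fv_subst1_closed\<close>)
    then show ?thesis using 6 by (simp add: sat_subst1 del: fun_upd_apply)
  qed (use IH cval_closed[of _ e] in auto)
qed simp

lemma subst1_subst:
  assumes "\<And>i. fvt (\<sigma> i) = {}" "fvt t = {}"
  shows "subst1 (subst (\<sigma>(n := Var n)) p) n t = subst (\<sigma>(n := t)) p"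
proof -
  have "ground_subst \<sigma>" using assms(1) by (simp add: ground_subst_def)
  then have "subst1 (subst (\<sigma>(n := Var n)) p) n t
      = subst (\<lambda>i. substt (Var(n := t)) ((\<sigma>(n := Var n)) i)) p"
    using assms(2) by (intro subst_subst) simp_all
  also have "(\<lambda>i. substt (Var(n := t)) ((\<sigma>(n := Var n)) i)) = \<sigma>(n := t)"
    using assms(1) by (auto simp: substt_closed)
  finally show ?thesis .
qed

text \<open>
  All substituted terms are closed, so the induction can pass quantifiers: an instance of the
  matrix is again a substitution instance of the original formula.
\<close>

lemma truth_rank_regular:
  "(\<And>i. fvt (\<sigma> i) = {} \<and> fvt (\<tau> i) = {} \<and> cval (\<sigma> i) = cval (\<tau> i)) \<Longrightarrow>
    truth_rank N (subst \<sigma> p) = truth_rank N (subst \<tau> p)"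
proof (induction N arbitrary: p \<sigma> \<tau>)
  case (Suc N)
  have IH: "truth_rank N (subst \<sigma> q) = truth_rank N (subst \<tau> q)" for q
    by (rule Suc.IH) (rule Suc.prems)
  have IHx: "truth_rank N (subst (\<sigma>(n := numeral_tm x)) q) = truth_rank N (subst (\<tau>(n := numeral_tm x)) q)"
    for n x q
    by (rule Suc.IH) (simp add: Suc.prems)
  have ground: "ground_subst \<sigma>" "ground_subst \<tau>" using Suc.prems by (auto simp: ground_subst_def)
  have val: "cval (substt \<sigma> t) = cval (substt \<tau> t)" for t
    using Suc.prems by (simp add: tval_substt)
  have closed: "\<And>i. fvt (\<sigma> i) = {}" "\<And>i. fvt (\<tau> i) = {}" using Suc.prems by auto
  show ?case
  proof (cases "(truth_rank N, p)" rule: truth_step.cases)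
    case (4 X q r)
    then show ?thesis using IH[of "\<^bold>\<not> q"] IH[of "\<^bold>\<not> r"] by simp
  next
    case (5 X v q)
    then show ?thesis using IHx[of v _ q] by (simp add: ground subst1_subst closed del: fun_upd_apply)
  next
    case (6 X v q)
    then show ?thesis using IHx[of v _ "\<^bold>\<not> q"] by (simp add: ground subst1_subst closed del: fun_upd_apply)
  qed (use IH val in simp_all)
qed simp

definition true_code :: "nat \<Rightarrow> nat \<Rightarrow> bool"
  where "true_code N x \<longleftrightarrow> (\<exists>p. arithmetical p \<and> fv p = {} \<and> x = fcode p \<and> truth_rank N p)"

lemma true_code_fcode:
  "arithmetical p \<Longrightarrow> true_code N (fcode p) \<longleftrightarrow> fv p = {} \<and> truth_rank N p"
  unfolding true_code_def using fcode_inject by blast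

lemma true_code_mono: "N \<le> M \<Longrightarrow> true_code N x \<Longrightarrow> true_code M x"
  unfolding true_code_def using truth_rank_mono by blast

lemma not_true_code_0 [simp]: "\<not> true_code 0 x"
  by (simp add: true_code_def)

lemma is_closed_termE:
  assumes "is_closed_term x" obtains t where "fvt t = {}" "x = tcode t"
  using assms unfolding is_closed_term_def by blast

lemma is_sentenceE:
  assumes "is_sentence x" obtains p where "arithmetical p" "fv p = {}" "x = fcode p"
  using assms unfolding is_sentence_def by blast

lemma is_form1E:
  assumes "is_form1 v x"
  obtains i p where "arithmetical p" "fv p \<subseteq> {i}" "v = nVar i" "x = fcode p"
  using assms unfolding is_form1_def by blast

lemma true_code_Eql:
  "is_closed_term x \<Longrightarrow> is_closed_term y \<Longrightarrow>
    true_code (Suc N) (nEql x y) \<longleftrightarrow> cval (untm x) = cval (untm y)"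
  by (elim is_closed_termE) (use true_code_fcode[of "_ \<^bold>= _" "Suc N"] in simp)

lemma true_code_Neg_Eql:
  "is_closed_term x \<Longrightarrow> is_closed_term y \<Longrightarrow>
    true_code (Suc N) (nNeg (nEql x y)) \<longleftrightarrow> cval (untm x) \<noteq> cval (untm y)"
  by (elim is_closed_termE) (use true_code_fcode[of "\<^bold>\<not> _ \<^bold>= _" "Suc N"] in simp)

lemma true_code_Dis:
  "is_sentence x \<Longrightarrow> is_sentence y \<Longrightarrow>
    true_code (Suc N) (nDis x y) \<longleftrightarrow> true_code N x \<or> true_code N y"
  by (elim is_sentenceE)
    (use true_code_fcode[of "_ \<^bold>\<or> _" "Suc N"] in \<open>simp add: true_code_fcode\<close>)

lemma true_code_Neg_Dis:
  assumes "is_sentence x" "is_sentence y"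
  shows "true_code (Suc N) (nNeg (nDis x y)) \<longleftrightarrow> true_code N (nNeg x) \<and> true_code N (nNeg y)"
proof -
  obtain p q where *: "arithmetical p" "fv p = {}" "x = fcode p" "arithmetical q" "fv q = {}" "y = fcode q"
    using assms by (elim is_sentenceE)
  then show ?thesis
    using true_code_fcode[of "\<^bold>\<not> (p \<^bold>\<or> q)" "Suc N"] true_code_fcode[of "\<^bold>\<not> p" N]
      true_code_fcode[of "\<^bold>\<not> q" N] by simp
qed

lemma true_code_Neg_Neg:
  assumes "is_sentence x"
  shows "true_code (Suc N) (nNeg (nNeg x)) \<longleftrightarrow> true_code N x"
proof -
  obtain p where *: "arithmetical p" "fv p = {}" "x = fcode p"
    using assms by (elim is_sentenceE)
  then show ?thesis
    using true_code_fcode[of "\<^bold>\<not> (\<^bold>\<not> p)" "Suc N"] true_code_fcode[of p N] by simp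
qed

lemma true_code_sub:
  assumes "arithmetical p" "fv p \<subseteq> {i}" "fvt t = {}"
  shows "true_code N (sub_code (fcode p) (nVar i) (tcode t)) \<longleftrightarrow> truth_rank N (subst1 p i t)"
proof -
  have "fv (subst1 p i t) = {}" using assms by (auto simp: fv_subst1_closed)
  then show ?thesis using assms by (simp add: sub_code_def true_code_fcode)
qed

lemma true_code_Exi:
  assumes "is_form1 v x"
  shows "true_code (Suc N) (nExi v x) \<longleftrightarrow> (\<exists>y. true_code N (sub_code x v (num_code y)))"
proof -
  obtain i p where *: "arithmetical p" "fv p \<subseteq> {i}" "v = nVar i" "x = fcode p"
    using assms by (elim is_form1E)
  then show ?thesis
    using true_code_fcode[of "Exi i p" "Suc N"] true_code_sub[OF *(1,2)]
    by (auto simp: num_code_def)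
qed

lemma true_code_Neg_Exi:
  assumes "is_form1 v x"
  shows "true_code (Suc N) (nNeg (nExi v x)) \<longleftrightarrow> (\<forall>y. true_code N (sub_code (nNeg x) v (num_code y)))"
proof -
  obtain i p where *: "arithmetical p" "fv p \<subseteq> {i}" "v = nVar i" "x = fcode p"
    using assms by (elim is_form1E)
  then show ?thesis
    using true_code_fcode[of "\<^bold>\<not> Exi i p" "Suc N"] true_code_sub[of "\<^bold>\<not> p" i]
    by (auto simp: num_code_def)
qed

lemma true_code_regular:
  assumes "is_form1 v x" "is_closed_term s" "is_closed_term t" "cval (untm s) = cval (untm t)"
  shows "true_code N (sub_code x v s) \<longleftrightarrow> true_code N (sub_code x v t)"
proof -
  obtain i p s' t' where *: "arithmetical p" "fv p \<subseteq> {i}" "v = nVar i" "x = fcode p"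
    "fvt s' = {}" "s = tcode s'" "fvt t' = {}" "t = tcode t'"
    using assms by (elim is_form1E is_closed_termE)
  have "subst1 p i r = subst (\<lambda>_. r) p" for r
    by (rule subst_cong) (use *(2) in auto)
  then have "truth_rank N (subst1 p i s') = truth_rank N (subst1 p i t')"
    using truth_rank_regular[of "\<lambda>_. s'" "\<lambda>_. t'"] * assms(4) by simp
  then show ?thesis using * by (simp add: true_code_sub)
qed

lemma true_code_consistent:
  assumes "is_form1 v x" "is_closed_term s" "true_code N (sub_code x v s)"
  shows "\<not> true_code M (sub_code (nNeg x) v s)"
proof -
  obtain i p t where *: "arithmetical p" "fv p \<subseteq> {i}" "v = nVar i" "x = fcode p"
    "fvt t = {}" "s = tcode t"
    using assms by (elim is_form1E is_closed_termE)
  have "fv (subst1 p i t) = {}" using * by (auto simp: fv_subst1_closed)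
  then show ?thesis
    using * assms(3) true_code_sub[of "\<^bold>\<not> p" i t M] true_code_sub[of p i t N]
      truth_rank_sound[of N "subst1 p i t" "\<lambda>_. 0"] truth_rank_sound[of M "\<^bold>\<not> subst1 p i t" "\<lambda>_. 0"]
    by auto
qed

text \<open>
  In the ultrapower only the standard finite stages are used. By saturation their union is already
  a fixed point.
\<close>

definition Tmin :: "(nat \<Rightarrow> nat) \<Rightarrow> bool"
  where "Tmin x \<longleftrightarrow> (\<exists>N. \<forall>\<^sub>F n in \<U>. true_code N (x n))"

lemma Tmin_Suc: "Tmin x \<longleftrightarrow> (\<exists>N. \<forall>\<^sub>F n in \<U>. true_code (Suc N) (x n))"
proof
  assume "Tmin x"
  then obtain N where "\<forall>\<^sub>F n in \<U>. true_code N (x n)" unfolding Tmin_def ..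
  then have "\<forall>\<^sub>F n in \<U>. true_code (Suc N) (x n)"
    by (rule eventually_mono) (rule true_code_mono[of N], simp)
  then show "\<exists>N. \<forall>\<^sub>F n in \<U>. true_code (Suc N) (x n)" ..
qed (auto simp: Tmin_def)

lemma respects_Tmin: "respects_eqU Tmin"
proof -
  have "Tmin y" if "x \<approx> y" "Tmin x" for x y
  proof -
    from that(2) obtain N where "\<forall>\<^sub>F n in \<U>. true_code N (x n)" unfolding Tmin_def ..
    with that(1) have "\<forall>\<^sub>F n in \<U>. true_code N (y n)"
      unfolding eqU_def by eventually_elim simp
    then show ?thesis unfolding Tmin_def ..
  qed
  then show ?thesis unfolding respects_eqU_def by blast
qed

text \<open>
  The form in which saturation is used: a standard bound that exists for each element separately
  can be chosen uniformly.
\<close>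

lemma uniform_rank:
  fixes P :: "nat \<Rightarrow> nat \<Rightarrow> nat \<Rightarrow> bool"
  assumes "\<And>x. \<exists>N. \<forall>\<^sub>F n in \<U>. P N n (x n)"
    and mono: "\<And>N M n y. N \<le> M \<Longrightarrow> P N n y \<Longrightarrow> P M n y"
  shows "\<exists>N. \<forall>\<^sub>F n in \<U>. \<forall>y. P N n y"
proof (rule ccontr)
  assume "\<not> ?thesis"
  then have "\<forall>\<^sub>F n in \<U>. \<exists>y. \<not> P N n y" for N
    using U_not[of "\<lambda>n. \<forall>y. P N n y"] by simp
  then obtain x where "\<And>N. \<forall>\<^sub>F n in \<U>. \<not> P N n (x n)"
    using saturation[of "\<lambda>N n y. \<not> P N n y"] mono by blast
  then show False using assms(1)[of x] by simp
qed

text \<open>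
  Index by index, each axiom relates a finite stage to the preceding one. Passing to the union of
  the stages requires that a single stage suffices for both parts of a conjunction, where the stages being increasing is
  enough, and for all instances of a quantifier, where the bound comes from saturation.
\<close>

theorem Tmin_PT_minus:
  assumes "p \<in> PT_minus" shows "msat Tmin e p"
proof -
  have Eql: "Tmin (\<lambda>n. nEql (s n) (t n)) \<longleftrightarrow> (\<forall>\<^sub>F n in \<U>. cval (untm (s n)) = cval (untm (t n)))"
    if "closedU s" "closedU t" for s t
  proof -
    have "\<forall>\<^sub>F n in \<U>. true_code (Suc N) (nEql (s n) (t n)) \<longleftrightarrow> cval (untm (s n)) = cval (untm (t n))" for N
      using that by eventually_elim (rule true_code_Eql)
    from eventually_subst[OF this] show ?thesis unfolding Tmin_Suc by simp
  qed
  have Neg_Eql: "Tmin (\<lambda>n. nNeg (nEql (s n) (t n))) \<longleftrightarrow>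
      \<not> (\<forall>\<^sub>F n in \<U>. cval (untm (s n)) = cval (untm (t n)))"
    if "closedU s" "closedU t" for s t
  proof -
    have "\<forall>\<^sub>F n in \<U>. true_code (Suc N) (nNeg (nEql (s n) (t n))) \<longleftrightarrow>
        cval (untm (s n)) \<noteq> cval (untm (t n))" for N
      using that by eventually_elim (rule true_code_Neg_Eql)
    from eventually_subst[OF this] show ?thesis unfolding Tmin_Suc by simp
  qed
  have Dis: "Tmin (\<lambda>n. nDis (p n) (q n)) \<longleftrightarrow> Tmin p \<or> Tmin q"
    if "sentU p" "sentU q" for p q
  proof -
    have "\<forall>\<^sub>F n in \<U>. true_code (Suc N) (nDis (p n) (q n)) \<longleftrightarrow> true_code N (p n) \<or> true_code N (q n)" for N
      using that by eventually_elim (rule true_code_Dis)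
    from eventually_subst[OF this] show ?thesis
      unfolding Tmin_Suc[of "\<lambda>n. nDis (p n) (q n)"] unfolding Tmin_def by (auto simp: U_disj)
  qed
  have Neg_Dis: "Tmin (\<lambda>n. nNeg (nDis (p n) (q n))) \<longleftrightarrow>
      Tmin (\<lambda>n. nNeg (p n)) \<and> Tmin (\<lambda>n. nNeg (q n))"
    if "sentU p" "sentU q" for p q
  proof -
    have "\<forall>\<^sub>F n in \<U>. true_code (Suc N) (nNeg (nDis (p n) (q n))) \<longleftrightarrow>
        true_code N (nNeg (p n)) \<and> true_code N (nNeg (q n))" for N
      using that by eventually_elim (rule true_code_Neg_Dis)
    from eventually_subst[OF this]
    have "Tmin (\<lambda>n. nNeg (nDis (p n) (q n))) \<longleftrightarrow> (\<exists>N. (\<forall>\<^sub>F n in \<U>. true_code N (nNeg (p n))) \<and>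
        (\<forall>\<^sub>F n in \<U>. true_code N (nNeg (q n))))"
      unfolding Tmin_Suc[of "\<lambda>n. nNeg (nDis (p n) (q n))"] by (simp add: eventually_conj_iff)
    also have "\<dots> \<longleftrightarrow> Tmin (\<lambda>n. nNeg (p n)) \<and> Tmin (\<lambda>n. nNeg (q n))"
    proof
      assume "Tmin (\<lambda>n. nNeg (p n)) \<and> Tmin (\<lambda>n. nNeg (q n))"
      then obtain N M where "\<forall>\<^sub>F n in \<U>. true_code N (nNeg (p n))" "\<forall>\<^sub>F n in \<U>. true_code M (nNeg (q n))"
        unfolding Tmin_def by blast
      then have "\<forall>\<^sub>F n in \<U>. true_code (max N M) (nNeg (p n)) \<and> true_code (max N M) (nNeg (q n))"
        by eventually_elim (auto intro: true_code_mono[of N] true_code_mono[of M])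
      then show "\<exists>N. (\<forall>\<^sub>F n in \<U>. true_code N (nNeg (p n))) \<and> (\<forall>\<^sub>F n in \<U>. true_code N (nNeg (q n)))"
        unfolding eventually_conj_iff by blast
    qed (auto simp: Tmin_def)
    finally show ?thesis .
  qed
  have Neg_Neg: "Tmin (\<lambda>n. nNeg (nNeg (p n))) \<longleftrightarrow> Tmin p" if "sentU p" for p
  proof -
    have "\<forall>\<^sub>F n in \<U>. true_code (Suc N) (nNeg (nNeg (p n))) \<longleftrightarrow> true_code N (p n)" for N
      using that by eventually_elim (rule true_code_Neg_Neg)
    from eventually_subst[OF this] show ?thesis
      unfolding Tmin_Suc[of "\<lambda>n. nNeg (nNeg (p n))"] unfolding Tmin_def by simp
  qed
  have Exi: "Tmin (\<lambda>n. nExi (v n) (p n)) \<longleftrightarrow> (\<exists>x. Tmin (\<lambda>n. sub_code (p n) (v n) (num_code (x n))))"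
    if "form1U v p" for v p
  proof -
    have "\<forall>\<^sub>F n in \<U>. true_code (Suc N) (nExi (v n) (p n)) \<longleftrightarrow>
        (\<exists>y. true_code N (sub_code (p n) (v n) (num_code y)))" for N
      using that by eventually_elim (rule true_code_Exi)
    from eventually_subst[OF this] show ?thesis
      unfolding Tmin_Suc[of "\<lambda>n. nExi (v n) (p n)"] unfolding Tmin_def by (auto simp: U_ex)
  qed
  have Neg_Exi: "Tmin (\<lambda>n. nNeg (nExi (v n) (p n))) \<longleftrightarrow>
      (\<forall>x. Tmin (\<lambda>n. sub_code (nNeg (p n)) (v n) (num_code (x n))))"
    if "form1U v p" for v p
  proof -
    have "\<forall>\<^sub>F n in \<U>. true_code (Suc N) (nNeg (nExi (v n) (p n))) \<longleftrightarrow>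
        (\<forall>y. true_code N (sub_code (nNeg (p n)) (v n) (num_code y)))" for N
      using that by eventually_elim (rule true_code_Neg_Exi)
    from eventually_subst[OF this]
    have "Tmin (\<lambda>n. nNeg (nExi (v n) (p n))) \<longleftrightarrow>
        (\<exists>N. \<forall>\<^sub>F n in \<U>. \<forall>y. true_code N (sub_code (nNeg (p n)) (v n) (num_code y)))"
      unfolding Tmin_Suc[of "\<lambda>n. nNeg (nExi (v n) (p n))"] by simp
    also have "\<dots> \<longleftrightarrow> (\<forall>x. Tmin (\<lambda>n. sub_code (nNeg (p n)) (v n) (num_code (x n))))"
    proof
      assume "\<exists>N. \<forall>\<^sub>F n in \<U>. \<forall>y. true_code N (sub_code (nNeg (p n)) (v n) (num_code y))"
      then show "\<forall>x. Tmin (\<lambda>n. sub_code (nNeg (p n)) (v n) (num_code (x n)))"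
        unfolding Tmin_def by (blast intro: eventually_mono)
    next
      assume "\<forall>x. Tmin (\<lambda>n. sub_code (nNeg (p n)) (v n) (num_code (x n)))"
      then show "\<exists>N. \<forall>\<^sub>F n in \<U>. \<forall>y. true_code N (sub_code (nNeg (p n)) (v n) (num_code y))"
        unfolding Tmin_def
        by (intro uniform_rank[where P = "\<lambda>N n y. true_code N (sub_code (nNeg (p n)) (v n) (num_code y))"])
          (auto intro: true_code_mono)
    qed
    finally show ?thesis .
  qed
  have regular: "Tmin (\<lambda>n. sub_code (p n) (v n) (s n)) \<longleftrightarrow> Tmin (\<lambda>n. sub_code (p n) (v n) (t n))"
    if "form1U v p" "closedU s" "closedU t" "\<forall>\<^sub>F n in \<U>. cval (untm (s n)) = cval (untm (t n))" for v p s t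
  proof -
    have "\<forall>\<^sub>F n in \<U>. true_code N (sub_code (p n) (v n) (s n)) \<longleftrightarrow>
        true_code N (sub_code (p n) (v n) (t n))" for N
      using that by eventually_elim (rule true_code_regular)
    from eventually_subst[OF this] show ?thesis unfolding Tmin_def by simp
  qed
  note axioms = msat_axiom_Eql[OF respects_Tmin, of e] msat_axiom_Neg_Eql[OF respects_Tmin, of e]
    msat_axiom_Dis[OF respects_Tmin, of e] msat_axiom_Neg_Dis[OF respects_Tmin, of e]
    msat_axiom_Exi[OF respects_Tmin, of e] msat_axiom_Neg_Exi[OF respects_Tmin, of e]
    msat_axiom_Neg_Neg[OF respects_Tmin, of e] msat_axiom_regularity[OF respects_Tmin, of e]
  show ?thesis
    using assms unfolding PT_minus_def
  proof (elim UnE insertE emptyE; (hypsubst, subst axioms)?)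
    show "msat Tmin e p" if "p \<in> PA" using that by (rule msat_PA)
  qed (intro allI impI, (elim conjE)?,
      rule Eql Neg_Eql Dis Neg_Dis Neg_Neg Exi Neg_Exi regular; assumption)+
qed

text \<open>
  If a formula is total then a single stage \<open>N\<close> decides all its instances. Stages are consistent, so
  the true instances are exactly those true at stage \<open>N\<close>. They form an internal set, to which
  induction applies index by index.
\<close>

theorem Tmin_INT_tot: "msat Tmin e INT_tot"
  unfolding msat_INT_tot[OF respects_Tmin]
proof (intro allI impI, elim conjE)
  fix v p
  assume form: "form1U v p"
    and tot: "\<forall>x. Tmin (\<lambda>n. sub_code (p n) (v n) (num_code (x n)))
       \<or> Tmin (\<lambda>n. sub_code (nNeg (p n)) (v n) (num_code (x n)))"
  define pos where "pos N n y \<longleftrightarrow> true_code N (sub_code (p n) (v n) (num_code y))" for N n y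
  define neg where "neg N n y \<longleftrightarrow> true_code N (sub_code (nNeg (p n)) (v n) (num_code y))" for N n y
  have mono: "pos N n y \<Longrightarrow> pos M n y" "neg N n y \<Longrightarrow> neg M n y" if "N \<le> M" for N M n y
    using true_code_mono[OF that] by (auto simp: pos_def neg_def)
  have "\<exists>N. \<forall>\<^sub>F n in \<U>. \<forall>y. pos N n y \<or> neg N n y"
  proof (rule uniform_rank)
    fix x
    show "\<exists>N. \<forall>\<^sub>F n in \<U>. pos N n (x n) \<or> neg N n (x n)"
      using tot[rule_format, of x] unfolding Tmin_def U_disj pos_def neg_def by blast
  qed (use mono in blast)
  then obtain N where N: "\<forall>\<^sub>F n in \<U>. \<forall>y. pos N n y \<or> neg N n y" ..
  have T: "Tmin (\<lambda>n. sub_code (p n) (v n) (num_code (x n))) \<longleftrightarrow> (\<forall>\<^sub>F n in \<U>. pos N n (x n))" for x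
  proof
    assume "Tmin (\<lambda>n. sub_code (p n) (v n) (num_code (x n)))"
    then obtain M where "\<forall>\<^sub>F n in \<U>. true_code M (sub_code (p n) (v n) (num_code (x n)))"
      unfolding Tmin_def ..
    with form N show "\<forall>\<^sub>F n in \<U>. pos N n (x n)"
    proof eventually_elim
      case (elim n)
      then have "\<not> neg N n (x n)"
        using true_code_consistent[of "v n" "p n" "num_code (x n)" M N] by (simp add: neg_def)
      then show ?case using elim by blast
    qed
  qed (auto simp: Tmin_def pos_def)
  show "int_at Tmin v p"
    unfolding int_at_def
  proof (intro impI allI)
    fix x
    assume step: "\<forall>x. Tmin (\<lambda>n. sub_code (p n) (v n) (num_code (x n))) \<longrightarrow>
        Tmin (\<lambda>n. sub_code (p n) (v n) (num_code (Suc (x n))))"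
      and zero: "Tmin (\<lambda>n. sub_code (p n) (v n) (num_code 0))"
    have "\<forall>\<^sub>F n in \<U>. \<forall>y. pos N n y \<longrightarrow> pos N n (Suc y)"
    proof (rule ccontr)
      assume "\<not> ?thesis"
      then have "\<forall>\<^sub>F n in \<U>. \<exists>y. pos N n y \<and> \<not> pos N n (Suc y)"
        using U_not[of "\<lambda>n. \<forall>y. pos N n y \<longrightarrow> pos N n (Suc y)"] by simp
      then obtain y where "\<forall>\<^sub>F n in \<U>. pos N n (y n)" "\<not> (\<forall>\<^sub>F n in \<U>. pos N n (Suc (y n)))"
        unfolding U_ex eventually_conj_iff U_not by blast
      then show False using step T[of y] T[of "\<lambda>n. Suc (y n)"] by simp
    qed
    moreover have "\<forall>\<^sub>F n in \<U>. pos N n 0" using zero T[of "\<lambda>_. 0"] by simp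
    ultimately have "\<forall>\<^sub>F n in \<U>. pos N n (x n)"
    proof eventually_elim
      case (elim n)
      have "pos N n y" for y by (induction y) (use elim in auto)
      then show ?case .
    qed
    then show "Tmin (\<lambda>n. sub_code (p n) (v n) (num_code (x n)))" by (simp add: T)
  qed
qed

section \<open>Arithmetical types determine truth\<close>

lemma nsat_TrNum:
  fixes e :: "nat \<Rightarrow> nat"
  assumes "is_form1 (tval e v) (tval e p)"
  shows "sat (=) D e (TrNum p v x) \<longleftrightarrow> D (sub_code (tval e p) (tval e v) (num_code (tval e x)))"
proof -
  obtain i q where q: "arithmetical q" "tval e v = nVar i" "tval e p = fcode q"
    using assms by (elim is_form1E)
  have Sub: "sat (=) D e' (TrSub p v s) \<longleftrightarrow> D (sub_code (tval e p) (tval e v) (tcode t))"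
    if "tval e' p = tval e p" "tval e' v = tval e v" "tval e' s = tcode t" "fvt t = {}" for e' s t
  proof -
    have "sat (=) D e' (TrSub p v s) \<longleftrightarrow> (\<exists>y. y = sub_code (tval e p) (tval e v) (tcode t) \<and> D y)"
      unfolding TrSub_def
    proof (rule sat_exI, elim fresh_truthE)
      fix m y assume "m \<notin> fvt p" "m \<notin> fvt v" "m \<notin> fvt s"
      then show "sat (=) D (e'(m := y)) (Sub p v s (Var m) \<^bold>\<and> Tr (Var m)) \<longleftrightarrow>
          y = sub_code (tval e p) (tval e v) (tcode t) \<and> D y"
        using that q sat_Sub[of "e'(m := y)" p q v i s t D "Var m"] by (auto simp: sub_code_def)
    qed
    then show ?thesis by simp
  qed
  have "sat (=) D e (TrNum p v x) \<longleftrightarrow> (\<exists>y. y = num_code (tval e x) \<and>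
      D (sub_code (tval e p) (tval e v) (num_code (tval e x))))"
    unfolding TrNum_def
  proof (rule sat_exI, elim fresh_truthE)
    fix m y assume m: "m \<notin> fvt p" "m \<notin> fvt v" "m \<notin> fvt x"
    show "sat (=) D (e(m := y)) (Num x (Var m) \<^bold>\<and> TrSub p v (Var m)) \<longleftrightarrow>
        y = num_code (tval e x) \<and> D (sub_code (tval e p) (tval e v) (num_code (tval e x)))"
      using m Sub[of "e(m := y)" "Var m" "numeral_tm (tval e x)"] by (auto simp: num_code_def)
  qed
  then show ?thesis by simp
qed

text \<open>
  The operator \<^const>\<open>truth_step\<close> as a formula, with \<open>Tr\<close> for its argument. Replacing \<open>Tr\<close> by a
  definition of one stage gives a definition of the next one.
\<close>

definition step_fm :: "tm \<Rightarrow> fm" where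
  "step_fm x =
    ((\<^bold>\<exists>s. \<^bold>\<exists>t. IsClosedTerm s \<^bold>\<and> IsClosedTerm t \<^bold>\<and> x \<^bold>= cEql s t \<^bold>\<and> SameVal s t) \<^bold>\<or>
     (\<^bold>\<exists>s. \<^bold>\<exists>t. IsClosedTerm s \<^bold>\<and> IsClosedTerm t \<^bold>\<and> x \<^bold>= cNeg (cEql s t) \<^bold>\<and> \<^bold>\<not> SameVal s t) \<^bold>\<or>
     (\<^bold>\<exists>p. \<^bold>\<exists>q. IsSent p \<^bold>\<and> IsSent q \<^bold>\<and> x \<^bold>= cDis p q \<^bold>\<and> (Tr p \<^bold>\<or> Tr q)) \<^bold>\<or>
     (\<^bold>\<exists>p. \<^bold>\<exists>q. IsSent p \<^bold>\<and> IsSent q \<^bold>\<and> x \<^bold>= cNeg (cDis p q) \<^bold>\<and> Tr (cNeg p) \<^bold>\<and> Tr (cNeg q)) \<^bold>\<or>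
     (\<^bold>\<exists>v. \<^bold>\<exists>p. IsForm1 v p \<^bold>\<and> x \<^bold>= cExi v p \<^bold>\<and> (\<^bold>\<exists>y. TrNum p v y)) \<^bold>\<or>
     (\<^bold>\<exists>v. \<^bold>\<exists>p. IsForm1 v p \<^bold>\<and> x \<^bold>= cNeg (cExi v p) \<^bold>\<and> (\<^bold>\<forall>y. TrNum (cNeg p) v y)) \<^bold>\<or>
     (\<^bold>\<exists>p. IsSent p \<^bold>\<and> x \<^bold>= cNeg (cNeg p) \<^bold>\<and> Tr p))"

lemma nsat_is:
  fixes e :: "nat \<Rightarrow> nat"
  shows "sat (=) D e (IsClosedTerm x) = is_closed_term (tval e x)"
    "sat (=) D e (IsSent x) = is_sentence (tval e x)"
    "sat (=) D e (IsForm1 v x) = is_form1 (tval e v) (tval e x)"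
  by (simp_all add: is_closed_term_def is_sentence_def is_form1_def)

lemma nsat_step_fm:
  fixes e :: "nat \<Rightarrow> nat"
  shows "sat (=) D e (step_fm x) \<longleftrightarrow>
    ((\<exists>s t. is_closed_term s \<and> is_closed_term t \<and> tval e x = nEql s t \<and> cval (untm s) = cval (untm t)) \<or>
     (\<exists>s t. is_closed_term s \<and> is_closed_term t \<and> tval e x = nNeg (nEql s t) \<and> \<not> cval (untm s) = cval (untm t)) \<or>
     (\<exists>p q. is_sentence p \<and> is_sentence q \<and> tval e x = nDis p q \<and> (D p \<or> D q)) \<or>
     (\<exists>p q. is_sentence p \<and> is_sentence q \<and> tval e x = nNeg (nDis p q) \<and> D (nNeg p) \<and> D (nNeg q)) \<or>
     (\<exists>v p. is_form1 v p \<and> tval e x = nExi v p \<and> (\<exists>y. D (sub_code p v (num_code y)))) \<or>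
     (\<exists>v p. is_form1 v p \<and> tval e x = nNeg (nExi v p) \<and> (\<forall>y. D (sub_code (nNeg p) v (num_code y)))) \<or>
     (\<exists>p. is_sentence p \<and> tval e x = nNeg (nNeg p) \<and> D p))"
  unfolding step_fm_def
  by ((rule sat_quantI, (elim fresh_truthE)?) | rule sat_conI' sat_disI sat_negI
      | (simp add: nsat_is nsat_SameVal nsat_TrNum del: sat_IsClosedTerm sat_IsSent sat_IsForm1; fail))+

text \<open>
  The disjunction obtained by evaluating \<^const>\<open>step_fm\<close>. The components of a code determine
  which disjunct applies, and then both directions are the equations for the stages.
\<close>

lemma true_code_Suc_iff:
  "true_code (Suc N) x \<longleftrightarrow>
    ((\<exists>s t. is_closed_term s \<and> is_closed_term t \<and> x = nEql s t \<and> cval (untm s) = cval (untm t)) \<or>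
     (\<exists>s t. is_closed_term s \<and> is_closed_term t \<and> x = nNeg (nEql s t) \<and> \<not> cval (untm s) = cval (untm t)) \<or>
     (\<exists>p q. is_sentence p \<and> is_sentence q \<and> x = nDis p q \<and> (true_code N p \<or> true_code N q)) \<or>
     (\<exists>p q. is_sentence p \<and> is_sentence q \<and> x = nNeg (nDis p q) \<and> true_code N (nNeg p) \<and> true_code N (nNeg q)) \<or>
     (\<exists>v p. is_form1 v p \<and> x = nExi v p \<and> (\<exists>y. true_code N (sub_code p v (num_code y)))) \<or>
     (\<exists>v p. is_form1 v p \<and> x = nNeg (nExi v p) \<and> (\<forall>y. true_code N (sub_code (nNeg p) v (num_code y)))) \<or>
     (\<exists>p. is_sentence p \<and> x = nNeg (nNeg p) \<and> true_code N p))"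
    (is "?L \<longleftrightarrow> ?R")
proof
  assume ?R
  then show ?L
    by (elim disjE exE conjE; hypsubst)
      (simp_all add: true_code_Eql true_code_Neg_Eql true_code_Dis true_code_Neg_Dis
        true_code_Neg_Neg, auto simp: true_code_Exi true_code_Neg_Exi)
next
  assume L: ?L
  then obtain p where p: "arithmetical p" "fv p = {}" "x = fcode p" "truth_step (truth_rank N) p"
    by (auto simp: true_code_def)
  have sent: "is_sentence (fcode q)" if "arithmetical q" "fv q = {}" for q
    using that unfolding is_sentence_def by blast
  have closed: "is_closed_term (tcode t)" if "fvt t = {}" for t
    using that unfolding is_closed_term_def by blast
  have form: "is_form1 (nVar i) (fcode q)" if "arithmetical q" "fv q - {i} = {}" for i q
    using that unfolding is_form1_def by blast
  from p(4) show ?R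
  proof (cases "(truth_rank N, p)" rule: truth_step.cases)
    case (1 X s t)
    then have *: "is_closed_term (tcode s)" "is_closed_term (tcode t)" "x = nEql (tcode s) (tcode t)"
      using p by (auto intro: sent closed form)
    then have **: "cval (untm (tcode s)) = cval (untm (tcode t))"
      using L true_code_Eql[OF *(1,2), of N] by simp
    show ?thesis
      by (rule disjI1, rule exI, rule exI, rule conjI[OF *(1) conjI[OF *(2) conjI[OF *(3) **]]])
  next
    case (2 X s t)
    then have *: "is_closed_term (tcode s)" "is_closed_term (tcode t)" "x = nNeg (nEql (tcode s) (tcode t))"
      using p by (auto intro: sent closed form)
    then have **: "\<not> cval (untm (tcode s)) = cval (untm (tcode t))"
      using L true_code_Neg_Eql[OF *(1,2), of N] by simp
    show ?thesis
      by (rule disjI2, rule disjI1, rule exI, rule exI, rule conjI[OF *(1) conjI[OF *(2) conjI[OF *(3) **]]])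
  next
    case (3 X q r)
    then have *: "is_sentence (fcode q)" "is_sentence (fcode r)" "x = nDis (fcode q) (fcode r)"
      using p by (auto intro: sent closed form)
    then have **: "true_code N (fcode q) \<or> true_code N (fcode r)"
      using L true_code_Dis[OF *(1,2), of N] by simp
    show ?thesis
      by (rule disjI2, rule disjI2, rule disjI1, rule exI, rule exI, rule conjI[OF *(1) conjI[OF *(2) conjI[OF *(3) **]]])
  next
    case (4 X q r)
    then have *: "is_sentence (fcode q)" "is_sentence (fcode r)" "x = nNeg (nDis (fcode q) (fcode r))"
      using p by (auto intro: sent closed form)
    then have **: "true_code N (nNeg (fcode q)) \<and> true_code N (nNeg (fcode r))"
      using L true_code_Neg_Dis[OF *(1,2), of N] by simp
    show ?thesis
      by (rule disjI2, rule disjI2, rule disjI2, rule disjI1, rule exI, rule exI, rule conjI[OF *(1) conjI[OF *(2) conjI[OF *(3) **]]])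
  next
    case (5 X v q)
    then have *: "is_form1 (nVar v) (fcode q)" "x = nExi (nVar v) (fcode q)"
      using p by (auto intro: sent closed form)
    then have **: "\<exists>y. true_code N (sub_code (fcode q) (nVar v) (num_code y))"
      using L true_code_Exi[OF *(1), of N] by simp
    show ?thesis
      by (rule disjI2, rule disjI2, rule disjI2, rule disjI2, rule disjI1, rule exI, rule exI, rule conjI[OF *(1) conjI[OF *(2) **]])
  next
    case (6 X v q)
    then have *: "is_form1 (nVar v) (fcode q)" "x = nNeg (nExi (nVar v) (fcode q))"
      using p by (auto intro: sent closed form)
    then have **: "\<forall>y. true_code N (sub_code (nNeg (fcode q)) (nVar v) (num_code y))"
      using L true_code_Neg_Exi[OF *(1), of N] by simp
    show ?thesis
      by (rule disjI2, rule disjI2, rule disjI2, rule disjI2, rule disjI2, rule disjI1, rule exI, rule exI, rule conjI[OF *(1) conjI[OF *(2) **]])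
  next
    case (7 X q)
    then have *: "is_sentence (fcode q)" "x = nNeg (nNeg (fcode q))"
      using p by (auto intro: sent closed form)
    then have **: "true_code N (fcode q)"
      using L true_code_Neg_Neg[OF *(1), of N] by simp
    show ?thesis
      by (rule disjI2, rule disjI2, rule disjI2, rule disjI2, rule disjI2, rule disjI2, rule exI, rule conjI[OF *(1) conjI[OF *(2) **]])
  qed (use p in simp_all)
qed

lemma arithmetical_true_code:
  "\<exists>q. arithmetical q \<and> (\<forall>e. nsat e q \<longleftrightarrow> true_code N (e 0))"
proof (induction N)
  case 0
  show ?case by (rule exI[of _ "\<^bold>\<not> Zero \<^bold>= Zero"]) simp
next
  case (Suc N)
  then obtain q where q: "arithmetical q" "\<And>e. nsat e q \<longleftrightarrow> true_code N (e 0)" by blast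
  have "nsat e (replace_truth 0 q (step_fm (Var 0))) \<longleftrightarrow> sat (=) (true_code N) e (step_fm (Var 0))" for e
    by (subst sat_replace_truth[where d = e]) (simp_all add: q)
  then show ?case
    using arithmetical_replace_truth[OF q(1)]
    by (intro exI[of _ "replace_truth 0 q (step_fm (Var 0))"])
      (simp add: nsat_step_fm true_code_Suc_iff)
qed

text \<open>
  One implication suffices, because formulae may be negated. Environments assign values to all
  variables at once, so this compares the types of countable tuples.
\<close>

definition same_type :: "(nat \<Rightarrow> nat \<Rightarrow> nat) \<Rightarrow> (nat \<Rightarrow> nat \<Rightarrow> nat) \<Rightarrow> bool" where
  "same_type e e' \<longleftrightarrow> (\<forall>p. arithmetical p \<longrightarrow>
     msat (\<lambda>_. False) e p \<longrightarrow> msat (\<lambda>_. False) e' p)"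

lemma same_type_sym: "same_type e e' \<Longrightarrow> same_type e' e"
  unfolding same_type_def
proof (intro allI impI)
  fix p assume *: "\<forall>p. arithmetical p \<longrightarrow> msat (\<lambda>_. False) e p \<longrightarrow> msat (\<lambda>_. False) e' p"
    "arithmetical p" "msat (\<lambda>_. False) e' p"
  then show "msat (\<lambda>_. False) e p" using *(1)[rule_format, of "\<^bold>\<not> p"] by auto
qed

lemma same_typeD:
  "same_type e e' \<Longrightarrow> arithmetical p \<Longrightarrow> msat T e p \<longleftrightarrow> msat T e' p"
  using same_type_sym[of e e'] sat_arithmetical[of p "(\<approx>)" T _ "\<lambda>_. False"]
  unfolding same_type_def by blast

text \<open>
  The type of \<open>x\<close> over the tuple \<open>e\<close> is realized over \<open>e'\<close>: each finite part of it is satisfiable there,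
  as an existential formula says so, and saturation does the rest.
\<close>

lemma same_type_extend:
  assumes "same_type e e'"
  shows "\<exists>y. same_type (e(v := x)) (e'(v := y))"
proof -
  let ?sat = "msat (\<lambda>_. False)"
  define \<theta> where "\<theta> j = (if arithmetical (unfm j) \<and> ?sat (e(v := x)) (unfm j) then unfm j else Zero \<^bold>= Zero)" for j
  \<comment> \<open>the first \<open>N\<close> formulae of the type, as a single formula\<close>
  define \<Phi> where "\<Phi> = rec_nat (Zero \<^bold>= Zero) (\<lambda>N q. q \<^bold>\<and> \<theta> N)"
  have \<theta>: "arithmetical (\<theta> j)" "?sat (e(v := x)) (\<theta> j)" for j by (auto simp: \<theta>_def)
  have \<Phi>: "arithmetical (\<Phi> N)" "?sat (e(v := x)) (\<Phi> N)" for N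
    by (induction N) (simp_all add: \<Phi>_def \<theta> del: fun_upd_apply)
  have \<Phi>_iff: "nsat d (\<Phi> N) \<longleftrightarrow> (\<forall>j < N. nsat d (\<theta> j))" for d N
    by (induction N) (auto simp: \<Phi>_def less_Suc_eq)
  have "\<exists>y. \<forall>N. \<forall>\<^sub>F n in \<U>. \<forall>j < N. nsat ((\<lambda>i. e' i n)(v := y n)) (\<theta> j)"
  proof (rule saturation)
    fix N
    have "?sat e (Exi v (\<Phi> N))" using \<Phi>(2) by auto
    then have "?sat e' (Exi v (\<Phi> N))"
      using same_typeD[OF assms, of "Exi v (\<Phi> N)" "\<lambda>_. False"] \<Phi>(1) by simp
    then have "\<forall>\<^sub>F n in \<U>. nsat (\<lambda>i. e' i n) (Exi v (\<Phi> N))"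
      using Los[of "Exi v (\<Phi> N)" _ e' "\<lambda>_. False"] \<Phi>(1) by simp
    then show "\<forall>\<^sub>F n in \<U>. \<exists>y. \<forall>j < N. nsat ((\<lambda>i. e' i n)(v := y)) (\<theta> j)"
      by (simp add: \<Phi>_iff)
  qed auto
  then obtain y where y: "\<And>N. \<forall>\<^sub>F n in \<U>. \<forall>j < N. nsat ((\<lambda>i. e' i n)(v := y n)) (\<theta> j)" by blast
  have "same_type (e(v := x)) (e'(v := y))"
    unfolding same_type_def
  proof (intro allI impI)
    fix p assume p: "arithmetical p" "?sat (e(v := x)) p"
    then have "\<theta> (fcode p) = p" by (simp add: \<theta>_def)
    with y[of "Suc (fcode p)"] have "\<forall>\<^sub>F n in \<U>. nsat ((\<lambda>i. e' i n)(v := y n)) p"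
      by (auto elim!: eventually_mono simp del: fun_upd_apply)
    moreover have "(\<lambda>i. (e'(v := y)) i n) = (\<lambda>i. e' i n)(v := y n)" for n by auto
    ultimately show "?sat (e'(v := y)) p"
      by (simp add: Los[OF p(1), where D = "\<lambda>_. False"] del: fun_upd_apply)
  qed
  then show ?thesis by (rule exI[of _ y])
qed

text \<open>
  The relation is a back-and-forth system. Atomic formulae \<open>Tr t\<close> are preserved because \<^const>\<open>Tmin\<close> is
  the union of arithmetically definable stages.
\<close>

theorem same_type_Tmin:
  "same_type e e' \<Longrightarrow> msat Tmin e p \<longleftrightarrow> msat Tmin e' p"
proof (induction p arbitrary: e e')
  case (Eql s t)
  then show ?case by (rule same_typeD) simp
next
  case (Tr t)
  obtain q where q: "\<And>N. arithmetical (q N)" "\<And>N d. nsat d (q N) \<longleftrightarrow> true_code N (d 0)"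
    using arithmetical_true_code by metis
  have "(\<forall>\<^sub>F n in \<U>. true_code N (tval d t n)) \<longleftrightarrow> msat Tmin d (subst1 (q N) 0 t)" for N d
    by (simp add: Los[where D = "\<lambda>_. False"] q sat_subst1 tval_seq)
  then have "Tmin (tval d t) \<longleftrightarrow> (\<exists>N. msat Tmin d (subst1 (q N) 0 t))" for d
    by (simp add: Tmin_def)
  moreover have "msat Tmin e (subst1 (q N) 0 t) \<longleftrightarrow> msat Tmin e' (subst1 (q N) 0 t)" for N
    by (rule same_typeD[OF Tr]) (simp add: q)
  ultimately show ?case by simp
next
  case (Exi v p)
  have "msat Tmin e' (Exi v p)" if sat: "msat Tmin e (Exi v p)" and same: "same_type e e'"
    for e e' :: "nat \<Rightarrow> nat \<Rightarrow> nat"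
  proof -
    from sat obtain x where x: "msat Tmin (e(v := x)) p" by auto
    obtain y where "same_type (e(v := x)) (e'(v := y))"
      using same_type_extend[OF same, of v x] by (elim exE)
    then have "msat Tmin (e'(v := y)) p" using Exi.IH x by blast
    then show ?thesis by auto
  qed
  then show ?case using Exi.prems same_type_sym by blast
next
  case (Neg p)
  show ?case using Neg.IH[OF Neg.prems] by simp
next
  case (Dis p q)
  show ?case using Dis.IH[OF Dis.prems] by simp
qed

section \<open>Nonstandard formulae under a truth predicate with full internal induction\<close>

text \<open>
  What the ultrapower takes for a sentence is represented by a sequence of
  formulae, whose free variables are replaced, index by index, by the numerals for the entries of \<open>e\<close>.
\<close>

definition inst :: "(nat \<Rightarrow> nat \<Rightarrow> nat) \<Rightarrow> nat \<Rightarrow> fm \<Rightarrow> fm"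
  where "inst e n p = subst (\<lambda>i. numeral_tm (e i n)) p"

definition inst_but :: "nat \<Rightarrow> (nat \<Rightarrow> nat \<Rightarrow> nat) \<Rightarrow> nat \<Rightarrow> fm \<Rightarrow> fm"
  where "inst_but v e n p = subst ((\<lambda>i. numeral_tm (e i n))(v := Var v)) p"

lemma ground_subst_inst [simp]: "ground_subst (\<lambda>i. numeral_tm (e i n))"
  by (simp add: ground_subst_def)

lemma inst_simps [simp]:
  "inst e n (\<^bold>\<not> p) = (\<^bold>\<not> inst e n p)"
  "inst e n (p \<^bold>\<or> q) = (inst e n p \<^bold>\<or> inst e n q)"
  "inst e n (Exi v p) = Exi v (inst_but v e n p)"
  "inst_but v e n (\<^bold>\<not> p) = (\<^bold>\<not> inst_but v e n p)"
  by (simp_all add: inst_def inst_but_def del: fun_upd_apply)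

lemma is_sentence_inst [simp]:
  assumes "arithmetical p" shows "is_sentence (fcode (inst e n p))"
proof -
  have "fv (inst e n p) = {}" "arithmetical (inst e n p)"
    using assms by (simp_all add: inst_def fv_subst_ground)
  then show ?thesis unfolding is_sentence_def by blast
qed

lemma is_form1_inst_but [simp]:
  assumes "arithmetical p" shows "is_form1 (nVar v) (fcode (inst_but v e n p))"
proof -
  have "fv (inst_but v e n p) \<subseteq> {v}" "arithmetical (inst_but v e n p)"
    using assms by (auto simp: inst_but_def fv_subst_ground split: if_splits)
  then show ?thesis unfolding is_form1_def by blast
qed

lemma sub_code_inst_but [simp]:
  assumes "arithmetical p"
  shows "sub_code (fcode (inst_but v e n p)) (nVar v) (num_code (x n)) = fcode (inst (e(v := x)) n p)"
proof -
  have "(\<lambda>i. numeral_tm ((e(v := x)) i n)) = (\<lambda>i. numeral_tm (e i n))(v := numeral_tm (x n))"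
    by auto
  then show ?thesis
    using assms by (simp add: sub_code_def num_code_def inst_but_def inst_def subst1_subst del: fun_upd_apply)
qed

locale truth_model =
  fixes T :: "(nat \<Rightarrow> nat) \<Rightarrow> bool"
  assumes resp: "respects_eqU T"
    and PT: "p \<in> PT_minus \<Longrightarrow> msat T e p"
    and INT: "msat T e INT_all"
begin

text \<open>
  Truth of a possibly nonstandard formula, given as a sequence \<open>\<phi>\<close>, at the elements \<open>e\<close>. For this
  notion the truth axioms become Tarski's clauses, although \<open>T\<close> may be neither consistent nor
  complete: negations are moved inwards instead of being interpreted.
\<close>

definition ev :: "(nat \<Rightarrow> fm) \<Rightarrow> (nat \<Rightarrow> nat \<Rightarrow> nat) \<Rightarrow> bool"
  where "ev \<phi> e \<longleftrightarrow> T (\<lambda>n. fcode (inst e n (\<phi> n)))"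

lemma ev_Eql: "ev (\<lambda>n. s n \<^bold>= t n) e \<longleftrightarrow> (\<forall>\<^sub>F n in \<U>. tval (\<lambda>i. e i n) (s n) = tval (\<lambda>i. e i n) (t n))"
  and ev_Neg_Eql: "ev (\<lambda>n. \<^bold>\<not> s n \<^bold>= t n) e \<longleftrightarrow>
    \<not> (\<forall>\<^sub>F n in \<U>. tval (\<lambda>i. e i n) (s n) = tval (\<lambda>i. e i n) (t n))"
proof -
  let ?inst = "\<lambda>n. substt (\<lambda>i. numeral_tm (e i n))"
  have closed: "is_closed_term (tcode (?inst n r))" for n r
    unfolding is_closed_term_def using fvt_substt[of "\<lambda>i. numeral_tm (e i n)" r] by auto
  have val: "cval (?inst n r) = tval (\<lambda>i. e i n) r" for n r
    by (simp add: tval_substt)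
  have "\<forall>s t. closedU s \<and> closedU t \<longrightarrow>
      (T (\<lambda>n. nEql (s n) (t n)) \<longleftrightarrow> (\<forall>\<^sub>F n in \<U>. cval (untm (s n)) = cval (untm (t n))))"
    unfolding msat_axiom_Eql[OF resp, of "\<lambda>_. 0", symmetric] by (rule PT) (simp add: PT_minus_def)
  from this[rule_format, of "\<lambda>n. tcode (?inst n (s n))" "\<lambda>n. tcode (?inst n (t n))"]
  show "ev (\<lambda>n. s n \<^bold>= t n) e \<longleftrightarrow> (\<forall>\<^sub>F n in \<U>. tval (\<lambda>i. e i n) (s n) = tval (\<lambda>i. e i n) (t n))"
    by (simp add: closed val ev_def inst_def)
  have "\<forall>s t. closedU s \<and> closedU t \<longrightarrow>
      (T (\<lambda>n. nNeg (nEql (s n) (t n))) \<longleftrightarrow> \<not> (\<forall>\<^sub>F n in \<U>. cval (untm (s n)) = cval (untm (t n))))"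
    unfolding msat_axiom_Neg_Eql[OF resp, of "\<lambda>_. 0", symmetric] by (rule PT) (simp add: PT_minus_def)
  from this[rule_format, of "\<lambda>n. tcode (?inst n (s n))" "\<lambda>n. tcode (?inst n (t n))"]
  show "ev (\<lambda>n. \<^bold>\<not> s n \<^bold>= t n) e \<longleftrightarrow>
      \<not> (\<forall>\<^sub>F n in \<U>. tval (\<lambda>i. e i n) (s n) = tval (\<lambda>i. e i n) (t n))"
    by (simp add: closed val ev_def inst_def)
qed

lemma ev_Dis:
  assumes "\<And>n. arithmetical (\<phi> n)" "\<And>n. arithmetical (\<psi> n)"
  shows "ev (\<lambda>n. \<phi> n \<^bold>\<or> \<psi> n) e \<longleftrightarrow> ev \<phi> e \<or> ev \<psi> e"
proof -
  have "\<forall>p q. sentU p \<and> sentU q \<longrightarrow> (T (\<lambda>n. nDis (p n) (q n)) \<longleftrightarrow> T p \<or> T q)"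
    unfolding msat_axiom_Dis[OF resp, of "\<lambda>_. 0", symmetric] by (rule PT) (simp add: PT_minus_def)
  then show ?thesis using assms by (simp add: ev_def)
qed

lemma ev_Neg_Dis:
  assumes "\<And>n. arithmetical (\<phi> n)" "\<And>n. arithmetical (\<psi> n)"
  shows "ev (\<lambda>n. \<^bold>\<not> (\<phi> n \<^bold>\<or> \<psi> n)) e \<longleftrightarrow> ev (\<lambda>n. \<^bold>\<not> \<phi> n) e \<and> ev (\<lambda>n. \<^bold>\<not> \<psi> n) e"
proof -
  have "\<forall>p q. sentU p \<and> sentU q \<longrightarrow>
      (T (\<lambda>n. nNeg (nDis (p n) (q n))) \<longleftrightarrow> T (\<lambda>n. nNeg (p n)) \<and> T (\<lambda>n. nNeg (q n)))"
    unfolding msat_axiom_Neg_Dis[OF resp, of "\<lambda>_. 0", symmetric] by (rule PT) (simp add: PT_minus_def)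
  then show ?thesis using assms by (simp add: ev_def)
qed

lemma ev_Neg_Neg:
  assumes "\<And>n. arithmetical (\<phi> n)"
  shows "ev (\<lambda>n. \<^bold>\<not> (\<^bold>\<not> \<phi> n)) e \<longleftrightarrow> ev \<phi> e"
proof -
  have "\<forall>p. sentU p \<longrightarrow> (T (\<lambda>n. nNeg (nNeg (p n))) \<longleftrightarrow> T p)"
    unfolding msat_axiom_Neg_Neg[OF resp, of "\<lambda>_. 0", symmetric] by (rule PT) (simp add: PT_minus_def)
  then show ?thesis using assms by (simp add: ev_def)
qed

lemma ev_Con:
  assumes "\<And>n. arithmetical (\<phi> n)" "\<And>n. arithmetical (\<psi> n)"
  shows "ev (\<lambda>n. \<phi> n \<^bold>\<and> \<psi> n) e \<longleftrightarrow> ev \<phi> e \<and> ev \<psi> e"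
  using assms by (simp add: ev_Neg_Dis ev_Neg_Neg)

lemma ev_Exi:
  assumes "\<And>n. arithmetical (\<phi> n)"
  shows "ev (\<lambda>n. Exi v (\<phi> n)) e \<longleftrightarrow> (\<exists>x. ev \<phi> (e(v := x)))"
proof -
  have "\<forall>v p. form1U v p \<longrightarrow> (T (\<lambda>n. nExi (v n) (p n)) \<longleftrightarrow>
      (\<exists>x. T (\<lambda>n. sub_code (p n) (v n) (num_code (x n)))))"
    unfolding msat_axiom_Exi[OF resp, of "\<lambda>_. 0", symmetric] by (rule PT) (simp add: PT_minus_def)
  from this[rule_format, of "\<lambda>_. nVar v" "\<lambda>n. fcode (inst_but v e n (\<phi> n))"]
  show ?thesis using assms by (simp add: ev_def)
qed

lemma ev_Neg_Exi:
  assumes "\<And>n. arithmetical (\<phi> n)"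
  shows "ev (\<lambda>n. \<^bold>\<not> Exi v (\<phi> n)) e \<longleftrightarrow> (\<forall>x. ev (\<lambda>n. \<^bold>\<not> \<phi> n) (e(v := x)))"
proof -
  have "\<forall>v p. form1U v p \<longrightarrow> (T (\<lambda>n. nNeg (nExi (v n) (p n))) \<longleftrightarrow>
      (\<forall>x. T (\<lambda>n. sub_code (nNeg (p n)) (v n) (num_code (x n)))))"
    unfolding msat_axiom_Neg_Exi[OF resp, of "\<lambda>_. 0", symmetric] by (rule PT) (simp add: PT_minus_def)
  from this[rule_format, of "\<lambda>_. nVar v" "\<lambda>n. fcode (inst_but v e n (\<phi> n))"]
  show ?thesis using assms sub_code_inst_but[of "\<^bold>\<not> \<phi> _" v e] by (simp add: ev_def)
qed

lemma ev_induct: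
  assumes "\<And>n. arithmetical (\<phi> n)"
    and "ev \<phi> (e(v := \<lambda>_. 0))"
    and "\<And>x. ev \<phi> (e(v := x)) \<Longrightarrow> ev \<phi> (e(v := \<lambda>n. Suc (x n)))"
  shows "ev \<phi> (e(v := x))"
proof -
  have "\<forall>v p. form1U v p \<longrightarrow> int_at T v p"
    using INT by (simp add: msat_INT_all[OF resp])
  from this[rule_format, of "\<lambda>_. nVar v" "\<lambda>n. fcode (inst_but v e n (\<phi> n))"]
  have *: "int_at T (\<lambda>_. nVar v) (\<lambda>n. fcode (inst_but v e n (\<phi> n)))" using assms(1) by simp
  have code: "sub_code (fcode (inst_but v e n (\<phi> n))) (nVar v) (num_code (x n)) =
      fcode (inst (e(v := x)) n (\<phi> n))" for x n
    using assms(1) by simp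
  show ?thesis
    using * assms(2,3) code[of _ "\<lambda>_. 0"] code[of _ "\<lambda>n. Suc (_ n)"]
    unfolding int_at_def code ev_def by simp
qed

lemma ev_eventually_cong:
  assumes "\<forall>\<^sub>F n in \<U>. \<phi> n = \<psi> n" shows "ev \<phi> e \<longleftrightarrow> ev \<psi> e"
  unfolding ev_def
  by (rule respects_eqU_iff[OF resp]) (use assms in \<open>auto simp: eqU_def elim: eventually_mono\<close>)

lemma ev_fv_cong:
  assumes "\<And>n i. i \<in> fv (\<phi> n) \<Longrightarrow> e i = e' i" shows "ev \<phi> e \<longleftrightarrow> ev \<phi> e'"
proof -
  have "inst e n (\<phi> n) = inst e' n (\<phi> n)" for n
    unfolding inst_def by (rule subst_cong) (simp add: assms)
  then show ?thesis by (simp add: ev_def)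
qed

text \<open>
  By induction on the formula, which is possible for standard formulae only.
\<close>

lemma ev_standard:
  "arithmetical p \<Longrightarrow> ev (\<lambda>_. p) e \<longleftrightarrow> msat (\<lambda>_. False) e p"
  "arithmetical p \<Longrightarrow> ev (\<lambda>_. \<^bold>\<not> p) e \<longleftrightarrow> \<not> msat (\<lambda>_. False) e p"
proof (induction p arbitrary: e)
  case (Eql s t)
  { case 1 show ?case by (simp add: ev_Eql eqU_def tval_seq) }
  { case 2 show ?case by (simp add: ev_Neg_Eql eqU_def tval_seq) }
next
  case (Neg p)
  { case 1 then show ?case using Neg.IH by simp }
  { case 2 then show ?case using Neg.IH by (simp add: ev_Neg_Neg) }
next
  case (Dis p q)
  { case 1 then show ?case using Dis.IH by (simp add: ev_Dis) }
  { case 2 then show ?case using Dis.IH by (simp add: ev_Neg_Dis) }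
next
  case (Exi v p)
  { case 1 then show ?case using Exi.IH by (simp add: ev_Exi) }
  { case 2 then show ?case using Exi.IH by (simp add: ev_Neg_Exi) }
qed simp_all

end

subsection \<open>A formula of nonstandard length\<close>

text \<open>
  All arithmetical formulae in the variables \<open>0\<close>, \<open>1\<close>, \<open>2\<close>, enumerated by their codes; other variables
  are set to zero.
\<close>

definition theta :: "nat \<Rightarrow> fm" where
  "theta j = subst (\<lambda>i. if i \<le> 2 then Var i else Zero)
     (if arithmetical (unfm j) then unfm j else Zero \<^bold>= Zero)"

text \<open>
  Replacing the variable \<open>0\<close> by \<open>3\<close> is expressed by a quantifier, so that no bound variable has to be
  renamed.
\<close>

definition chi :: "nat \<Rightarrow> fm" where
  "chi j = (theta j \<^bold>\<longleftrightarrow> Exi 0 (Var 0 \<^bold>= Var 3 \<^bold>\<and> theta j))"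

text \<open>
  Agreement of the variables \<open>0\<close> and \<open>3\<close> on the formulae with index from \<open>j\<close> up to the value of
  variable \<open>2\<close>. The disjunct \<open>Var 2 = j\<close> ends the conjunction at this value. So for a standard value
  the part of the formula that lies beyond it is irrelevant, whatever truth value it receives.
\<close>

primrec agree :: "nat \<Rightarrow> nat \<Rightarrow> fm" where
  "agree 0 j = (Zero \<^bold>= Zero)"
| "agree (Suc m) j = (Var 2 \<^bold>= numeral_tm j \<^bold>\<or> chi j \<^bold>\<and> agree m (Suc j))"

text \<open>
  There are \<open>x < y\<close> that agree, with \<open>x \<le> g - v\<close> for the values \<open>g\<close> and \<open>v\<close> of the variables \<open>1\<close> and \<open>4\<close>.
  Stated in terms of \<open>v\<close> this is downward closed, and induction on \<open>v\<close> finds the least \<open>x\<close>.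
\<close>

definition twins :: "nat \<Rightarrow> fm" where
  "twins n = Exi 0 (Exi 3 (Exi 5 (Var 0 \<^bold>+ Var 4 \<^bold>+ Var 5 \<^bold>= Var 1) \<^bold>\<and>
     Exi 5 (Succ (Var 0 \<^bold>+ Var 5) \<^bold>= Var 3) \<^bold>\<and> agree n 0))"

lemma arithmetical_theta [simp]: "arithmetical (theta j)"
  by (simp add: theta_def)

lemma arithmetical_chi [simp]: "arithmetical (chi j)"
  by (simp add: chi_def)

lemma arithmetical_agree [simp]: "arithmetical (agree m j)"
  by (induction m arbitrary: j) simp_all

lemma arithmetical_twins [simp]: "arithmetical (twins n)"
  by (simp add: twins_def)

lemma fv_theta: "fv (theta j) \<subseteq> {0, 1, 2}"
  unfolding theta_def by (subst fv_subst_ground) (auto simp: ground_subst_def split: if_splits)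

lemma fv_chi: "fv (chi j) \<subseteq> {0, 1, 2, 3}"
  using fv_theta[of j] by (auto simp: chi_def)

lemma fv_agree: "fv (agree m j) \<subseteq> {0, 1, 2, 3}"
  by (induction m arbitrary: j) (use fv_chi in auto)

lemma fv_twins: "fv (twins n) \<subseteq> {1, 2, 4}"
  using fv_agree[of n 0] by (auto simp: twins_def)

text \<open>
  Consequently the code of the sequence of formulae \<^const>\<open>twins\<close> is nonstandard and can serve as the
  bound \<open>g\<close>. This makes it the only parameter besides \<open>k\<close>.
\<close>

lemma le_fcode_agree: "m \<le> fcode (agree m j)"
proof (induction m arbitrary: j)
  case (Suc m)
  let ?p = "agree m (Suc j)"
  have "fcode ?p < fcode (\<^bold>\<not> ?p)" by simp
  also have "\<dots> < fcode (\<^bold>\<not> chi j \<^bold>\<or> \<^bold>\<not> ?p)" by simp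
  also have "\<dots> < fcode (chi j \<^bold>\<and> ?p)" by simp
  also have "\<dots> < fcode (agree (Suc m) j)" by simp
  finally show ?case using Suc[of "Suc j"] by linarith
qed simp

lemma le_fcode_twins: "n \<le> fcode (twins n)"
proof -
  define p where "p = Exi 5 (Succ (Var 0 \<^bold>+ Var 5) \<^bold>= Var 3)"
  define q where "q = Exi 5 (Var 0 \<^bold>+ Var 4 \<^bold>+ Var 5 \<^bold>= Var 1)"
  define r where "r = agree n 0"
  have neg: "fcode p < fcode (\<^bold>\<not> p)" for p by simp
  have dis: "fcode q < fcode (p \<^bold>\<or> q)" for p q by simp
  have exi: "fcode p < fcode (Exi v p)" for v p by simp
  have con: "fcode q < fcode (p \<^bold>\<and> q)" for p q
    using neg[of q] dis[of "\<^bold>\<not> q" "\<^bold>\<not> p"] neg[of "\<^bold>\<not> p \<^bold>\<or> \<^bold>\<not> q"] by linarith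
  have "n \<le> fcode r" using le_fcode_agree by (simp add: r_def)
  also have "\<dots> < fcode (p \<^bold>\<and> r)" by (rule con)
  also have "\<dots> < fcode (q \<^bold>\<and> p \<^bold>\<and> r)" by (rule con)
  also have "\<dots> < fcode (Exi 3 (q \<^bold>\<and> p \<^bold>\<and> r))" by (rule exi)
  also have "\<dots> < fcode (Exi 0 (Exi 3 (q \<^bold>\<and> p \<^bold>\<and> r)))" by (rule exi)
  finally show ?thesis by (simp add: twins_def p_def q_def r_def del: fcode.simps)
qed

abbreviation "msat0 \<equiv> msat (\<lambda>_. False)"

definition env :: "(nat \<Rightarrow> nat) \<Rightarrow> (nat \<Rightarrow> nat) \<Rightarrow> (nat \<Rightarrow> nat) \<Rightarrow> nat \<Rightarrow> nat \<Rightarrow> nat"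
  where "env x g k = (\<lambda>_. 0)(0 := x, 1 := g, 2 := k)"

lemma msat_theta: "msat0 e (theta j) \<longleftrightarrow> msat0 (env (e 0) (e 1) (e 2)) (theta j)"
  by (rule sat_cong) (use fv_theta[of j] in \<open>auto simp: env_def\<close>)

lemma same_type_env:
  assumes "\<And>j. msat0 (env x g k) (theta j) \<longleftrightarrow> msat0 (env y g k) (theta j)"
  shows "same_type (env x g k) (env y g k)"
  unfolding same_type_def
proof (intro allI impI)
  fix p assume p: "arithmetical p" "msat0 (env x g k) p"
  have "(\<lambda>i. tval (env z g k) (if i \<le> 2 then Var i else Zero)) = env z g k" for z
    by (auto simp: env_def fun_eq_iff)
  then have "msat0 (env z g k) (theta (fcode p)) \<longleftrightarrow> msat0 (env z g k) p" for z
    using p(1) by (simp add: theta_def sat_subst)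
  then show "msat0 (env y g k) p" using p(2) assms by blast
qed

lemma msat_chi:
  "msat0 e (chi j) \<longleftrightarrow> (msat0 (env (e 0) (e 1) (e 2)) (theta j) \<longleftrightarrow> msat0 (env (e 3) (e 1) (e 2)) (theta j))"
proof -
  have "(\<exists>x. x \<approx> e 3 \<and> msat0 (e(0 := x)) (theta j)) \<longleftrightarrow> msat0 (e(0 := e 3)) (theta j)"
  proof -
    have "msat0 (e(0 := x)) (theta j) = msat0 (e(0 := e 3)) (theta j)" if "x \<approx> e 3" for x
      by (rule msat_eqU) (use that in \<open>auto simp: respects_eqU_def\<close>)
    then show ?thesis using eqU_refl by blast
  qed
  then show ?thesis
    using msat_theta[of e j] msat_theta[of "e(0 := e 3)" j] by (auto simp: chi_def)
qed

context truth_model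
begin

text \<open>
  The index \<open>n\<close> bounds the length of the formula, so in the ultrapower its length is the nonstandard
  element given by the identity sequence, and any standard number of unfoldings is possible.
\<close>

lemma ev_agree_step:
  "ev (\<lambda>n. agree (n - j) j) e \<longleftrightarrow>
    e 2 \<approx> (\<lambda>_. j) \<or> (msat0 e (chi j) \<and> ev (\<lambda>n. agree (n - Suc j) (Suc j)) e)"
proof -
  have "\<forall>\<^sub>F n in \<U>. agree (n - j) j = (Var 2 \<^bold>= numeral_tm j \<^bold>\<or> chi j \<^bold>\<and> agree (n - Suc j) (Suc j))"
    using U_ge[of "Suc j"]
  proof eventually_elim
    case (elim n)
    then have "n - j = Suc (n - Suc j)" by simp
    then show ?case by simp
  qed
  then have "ev (\<lambda>n. agree (n - j) j) e \<longleftrightarrow>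
      ev (\<lambda>n. Var 2 \<^bold>= numeral_tm j \<^bold>\<or> chi j \<^bold>\<and> agree (n - Suc j) (Suc j)) e"
    by (rule ev_eventually_cong)
  then show ?thesis
    by (simp add: ev_Dis ev_Con ev_standard ev_Eql eqU_def)
qed

lemma ev_agree_nonstandard:
  assumes "\<And>j. \<not> e 2 \<approx> (\<lambda>_. j)" "ev (\<lambda>n. agree n 0) e"
  shows "msat0 e (chi j)"
proof -
  have "ev (\<lambda>n. agree (n - j) j) e" for j
  proof (induction j)
    case 0
    show ?case using assms(2) by simp
  next
    case (Suc j)
    then show ?case using ev_agree_step[of j e] assms(1)[of j] by simp
  qed
  then show ?thesis using ev_agree_step[of j e] assms(1)[of j] by simp
qed

lemma ev_agree_standard:
  assumes "e 2 \<approx> (\<lambda>_. K)" "\<And>j. j < K \<Longrightarrow> msat0 e (chi j)"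
  shows "ev (\<lambda>n. agree n 0) e"
proof -
  have "ev (\<lambda>n. agree (n - j) j) e" if "j \<le> K" for j
    using that
  proof (induction rule: inc_induct)
    case base
    then show ?case using assms(1) by (subst ev_agree_step) simp
  next
    case (step j)
    then show ?case using assms(2) by (subst ev_agree_step) simp
  qed
  from this[of 0] show ?thesis by simp
qed

definition twins_code :: "nat \<Rightarrow> nat" where "twins_code n = fcode (twins n)"

definition has_twins :: "(nat \<Rightarrow> nat) \<Rightarrow> (nat \<Rightarrow> nat) \<Rightarrow> bool"
  where "has_twins k v \<longleftrightarrow> ev twins ((env 0 twins_code k)(4 := v))"

definition agrees :: "(nat \<Rightarrow> nat) \<Rightarrow> (nat \<Rightarrow> nat) \<Rightarrow> (nat \<Rightarrow> nat) \<Rightarrow> bool"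
  where "agrees k x y \<longleftrightarrow> ev (\<lambda>n. agree n 0) ((env x twins_code k)(3 := y))"

lemma has_twins_iff:
  "has_twins k v \<longleftrightarrow> (\<exists>x y. (\<forall>\<^sub>F n in \<U>. x n + v n \<le> twins_code n) \<and> (\<forall>\<^sub>F n in \<U>. x n < y n) \<and> agrees k x y)"
proof -
  let ?e = "\<lambda>x y. (env 0 twins_code k)(4 := v, 0 := x, 3 := y)"
  have 1: "msat0 (?e x y) (Exi 5 (Var 0 \<^bold>+ Var 4 \<^bold>+ Var 5 \<^bold>= Var 1)) \<longleftrightarrow> (\<forall>\<^sub>F n in \<U>. x n + v n \<le> twins_code n)" for x y
    by (subst Los[where D = "\<lambda>_. False"]) (simp_all add: env_def le_iff_add eq_commute)
  have 2: "msat0 (?e x y) (Exi 5 (Succ (Var 0 \<^bold>+ Var 5) \<^bold>= Var 3)) \<longleftrightarrow> (\<forall>\<^sub>F n in \<U>. x n < y n)" for x y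
    by (subst Los[where D = "\<lambda>_. False"]) (simp_all add: env_def less_iff_Suc_add eq_commute)
  have 3: "ev (\<lambda>n. agree n 0) (?e x y) \<longleftrightarrow> agrees k x y" for x y
    unfolding agrees_def
  proof (rule ev_fv_cong)
    show "?e x y i = ((env x twins_code k)(3 := y)) i" if "i \<in> fv (agree n 0)" for n i
      using that fv_agree[of n 0] by (auto simp: env_def)
  qed
  show ?thesis
    unfolding has_twins_def twins_def
    by (simp add: ev_Exi[where v = 0] ev_Exi[where v = 3] ev_Con ev_standard 1 2 3
        del: sat.simps fun_upd_apply One_nat_def)
qed

text \<open>
  For standard \<open>k\<close> there are only finitely many patterns of truth values of the first \<open>k\<close> formulae, so two
  standard numbers share one.
\<close>

lemma has_twins_standard: "has_twins (\<lambda>_. K) (\<lambda>_. 0)"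
proof -
  define f where "f x = {j. j < K \<and> msat0 (env (\<lambda>_. x) twins_code (\<lambda>_. K)) (theta j)}" for x
  have "range f \<subseteq> Pow {..<K}" by (auto simp: f_def)
  then have "finite (range f)" by (rule finite_subset) simp
  then have "\<not> inj f" using finite_imageD[of f UNIV] infinite_UNIV_nat by blast
  then obtain x y where "f x = f y" "x \<noteq> y" by (auto simp: inj_def)
  then obtain x y where xy: "f x = f y" "x < y" by (metis linorder_neqE_nat)
  have "agrees (\<lambda>_. K) (\<lambda>_. x) (\<lambda>_. y)"
    unfolding agrees_def
  proof (rule ev_agree_standard)
    fix j assume "j < K"
    then have "msat0 (env (\<lambda>_. x) twins_code (\<lambda>_. K)) (theta j) \<longleftrightarrow> msat0 (env (\<lambda>_. y) twins_code (\<lambda>_. K)) (theta j)"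
      using xy(1) unfolding f_def by blast
    then show "msat0 ((env (\<lambda>_. x) twins_code (\<lambda>_. K))(3 := \<lambda>_. y)) (chi j)"
      by (simp add: msat_chi env_def)
  qed (simp add: env_def)
  moreover have "\<forall>\<^sub>F n in \<U>. x + 0 \<le> twins_code n"
    using U_ge[of x] by eventually_elim (use le_fcode_twins order_trans in \<open>auto simp: twins_code_def\<close>)
  ultimately show ?thesis unfolding has_twins_iff using xy(2)
    by (intro exI[of _ "\<lambda>_. x"] exI[of _ "\<lambda>_. y"]) simp
qed

text \<open>
  Otherwise the elements \<open>k\<close> with twins would be exactly the standard ones, a set that contains zero,
  is closed under successor and omits the identity sequence.
\<close>

lemma has_twins_nonstandard: "\<exists>k. has_twins k (\<lambda>_. 0) \<and> (\<forall>j. \<not> k \<approx> (\<lambda>_. j))"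
proof (rule ccontr)
  assume contra: "\<not> ?thesis"
  let ?e = "(env 0 twins_code 0)(4 := \<lambda>_. 0)"
  have upd: "?e(2 := k) = (env 0 twins_code k)(4 := \<lambda>_. 0)" for k
    by (auto simp: env_def)
  have "ev twins (?e(2 := k))" for k
  proof (rule ev_induct)
    show "ev twins (?e(2 := \<lambda>_. 0))"
      unfolding upd using has_twins_standard[of 0] by (simp add: has_twins_def)
    fix k assume "ev twins (?e(2 := k))"
    then obtain j where j: "k \<approx> (\<lambda>_. j)" using contra unfolding upd has_twins_def by blast
    have "ev twins ((env 0 twins_code (\<lambda>_. Suc j))(4 := \<lambda>_. 0))"
      using has_twins_standard[of "Suc j"] by (simp add: has_twins_def)
    moreover have "(\<lambda>n. fcode (inst ((env 0 twins_code (\<lambda>_. Suc j))(4 := \<lambda>_. 0)) n (twins n)))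
        \<approx> (\<lambda>n. fcode (inst ((env 0 twins_code (\<lambda>n. Suc (k n)))(4 := \<lambda>_. 0)) n (twins n)))"
      using j unfolding eqU_def
    proof eventually_elim
      case (elim n)
      have "(\<lambda>i. ((env 0 twins_code (\<lambda>_. Suc j))(4 := \<lambda>_. 0)) i n) = (\<lambda>i. ((env 0 twins_code (\<lambda>n. Suc (k n)))(4 := \<lambda>_. 0)) i n)"
        using elim by (auto simp: env_def)
      then show ?case unfolding inst_def by metis
    qed
    ultimately show "ev twins (?e(2 := \<lambda>n. Suc (k n)))"
      unfolding upd ev_def using respects_eqU_iff[OF resp] by blast
  qed simp
  then have "has_twins (\<lambda>n. n) (\<lambda>_. 0)" unfolding upd has_twins_def .
  then obtain j where "\<forall>\<^sub>F n in \<U>. n = j" using contra unfolding eqU_def by blast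
  then have "\<forall>\<^sub>F n :: nat in \<U>. False"
    using U_ge[of "Suc j"] by eventually_elim simp
  then show False by simp
qed

text \<open>
  The least number principle for a set that is only known to be the extension of a formula: the
  induction runs over the distance \<open>v\<close> from the bound.
\<close>

lemma has_twins_greatest:
  assumes "has_twins k (\<lambda>_. 0)"
  shows "\<exists>v. has_twins k v \<and> \<not> has_twins k (\<lambda>n. Suc (v n))"
proof (rule ccontr)
  assume "\<not> ?thesis"
  then have step: "has_twins k (\<lambda>n. Suc (v n))" if "has_twins k v" for v using that by blast
  have "ev twins ((env 0 twins_code k)(4 := v))" for v
    by (rule ev_induct) (use assms step in \<open>auto simp: has_twins_def simp del: fun_upd_apply\<close>)
  then have "has_twins k (\<lambda>n. Suc (twins_code n))" by (simp add: has_twins_def)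
  then obtain x where "\<forall>\<^sub>F n in \<U>. x n + Suc (twins_code n) \<le> twins_code n" unfolding has_twins_iff by blast
  then have "\<forall>\<^sub>F n in \<U>. False" by (rule eventually_mono) simp
  then show False by simp
qed

end

subsection \<open>Definability of the instances\<close>

text \<open>
  In variable \<open>6\<close>, the code of the sentence obtained from the formula coded by variable \<open>1\<close> when the
  values of the variables \<open>1\<close>, \<open>2\<close>, \<open>4\<close> are substituted for its free variables \<open>1\<close>, \<open>2\<close>, \<open>4\<close>. The first
  substitution puts the numeral of a code into the formula with this code, which is what allows the
  formulae \<^const>\<open>theta\<close> to speak about the code of \<^const>\<open>twins\<close>.
\<close>

definition code_fm :: fm where
  "code_fm = Exi 10 (Exi 11 (Exi 12 (Exi 13 (Exi 14
    (Num (Var 1) (Var 10) \<^bold>\<and> Sub (Var 1) (cVar (numeral_tm 1)) (Var 10) (Var 11) \<^bold>\<and>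
     Num (Var 2) (Var 12) \<^bold>\<and> Sub (Var 11) (cVar (numeral_tm 2)) (Var 12) (Var 13) \<^bold>\<and>
     Num (Var 4) (Var 14) \<^bold>\<and> Sub (Var 13) (cVar (numeral_tm 4)) (Var 14) (Var 6))))))"

lemma nsat_code_fm:
  fixes d :: "nat \<Rightarrow> nat"
  assumes "d 1 = fcode p" "arithmetical p"
  shows "nsat d code_fm \<longleftrightarrow> d 6 = fcode (subst1 (subst1 (subst1 p 1 (numeral_tm (d 1))) 2 (numeral_tm (d 2))) 4 (numeral_tm (d 4)))"
proof -
  have sub: "nsat e (Sub x (cVar (numeral_tm i)) s y) \<longleftrightarrow> c = fcode (subst1 q i (numeral_tm m))"
    if "tval e x = fcode q" "arithmetical q" "tval e s = tcode (numeral_tm m)" "tval e y = c" for e x i s y q m c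
    using that sat_Sub[of e x q "cVar (numeral_tm i)" i s "numeral_tm m"] by simp
  let ?p1 = "subst1 p 1 (numeral_tm (d 1))"
  let ?p2 = "subst1 ?p1 2 (numeral_tm (d 2))"
  let ?p3 = "subst1 ?p2 4 (numeral_tm (d 4))"
  have "nsat (d(10 := a, 11 := b, 12 := c, 13 := f, 14 := h))
    (Num (Var 1) (Var 10) \<^bold>\<and> Sub (Var 1) (cVar (numeral_tm 1)) (Var 10) (Var 11) \<^bold>\<and>
     Num (Var 2) (Var 12) \<^bold>\<and> Sub (Var 11) (cVar (numeral_tm 2)) (Var 12) (Var 13) \<^bold>\<and>
     Num (Var 4) (Var 14) \<^bold>\<and> Sub (Var 13) (cVar (numeral_tm 4)) (Var 14) (Var 6)) \<longleftrightarrow>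
    a = tcode (numeral_tm (d 1)) \<and> b = fcode ?p1 \<and> c = tcode (numeral_tm (d 2)) \<and> f = fcode ?p2 \<and>
    h = tcode (numeral_tm (d 4)) \<and> d 6 = fcode ?p3" (is "nsat ?e _ \<longleftrightarrow> _") for a b c f h
    by (intro sat_conI'; (rule sub)?; simp add: assms del: numeral_tm.simps One_nat_def)
  then show ?thesis unfolding code_fm_def sat.simps(5) by (simp del: sat.simps One_nat_def)
qed

context truth_model
begin

lemma inst_twins:
  "inst ((env 0 twins_code k)(4 := v)) n (twins n) =
    subst1 (subst1 (subst1 (twins n) 1 (numeral_tm (twins_code n))) 2 (numeral_tm (k n))) 4 (numeral_tm (v n))"
  unfolding inst_def
  by (simp add: subst_subst ground_subst_comp del: fun_upd_apply,
      rule subst_cong) (use fv_twins[of n] in \<open>auto simp: env_def substt_closed\<close>)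

lemma nsat_code_fm_env:
  "nsat (\<lambda>i. ((env x twins_code k)(4 := v, 6 := c)) i n) code_fm \<longleftrightarrow>
    c n = fcode (inst ((env 0 twins_code k)(4 := v)) n (twins n))"
  unfolding inst_twins
  using nsat_code_fm[of "\<lambda>i. ((env x twins_code k)(4 := v, 6 := c)) i n" "twins n"]
  by (simp add: env_def twins_code_def del: numeral_tm.simps One_nat_def)

text \<open>
  Let \<open>x < y\<close> be twins with \<open>x\<close> least. That some twins have a lower member below \<open>x\<close> is expressed by the
  truth of a sentence whose code is definable from \<open>x\<close>, so it has the same truth value for \<open>y\<close>. It fails
  for \<open>x\<close>, but it holds for \<open>y\<close>, because \<open>x\<close> is below \<open>y\<close>.
\<close>

theorem no_invariant_truth:
  assumes inv: "\<And>e e' i. same_type e e' \<Longrightarrow> T (e i) \<Longrightarrow> T (e' i)"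
  shows False
proof -
  obtain k where k: "has_twins k (\<lambda>_. 0)" "\<And>j. \<not> k \<approx> (\<lambda>_. j)"
    using has_twins_nonstandard by blast
  \<comment> \<open>\<open>g - v\<close> is the least \<open>x\<close> with a twin, where \<open>g\<close> is \<open>twins_code\<close>\<close>
  obtain v where v: "has_twins k v" "\<not> has_twins k (\<lambda>n. Suc (v n))"
    using has_twins_greatest[OF k(1)] by blast
  obtain x y where xy: "\<forall>\<^sub>F n in \<U>. x n + v n \<le> twins_code n" "\<forall>\<^sub>F n in \<U>. x n < y n" "agrees k x y"
    using v(1) unfolding has_twins_iff by blast
  have sum: "\<forall>\<^sub>F n in \<U>. Suc (v n) + x n = Suc (twins_code n)"
  proof -
    have "\<not> (\<forall>\<^sub>F n in \<U>. x n + Suc (v n) \<le> twins_code n)"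
      using v(2) xy(2,3) unfolding has_twins_iff by blast
    then have "\<forall>\<^sub>F n in \<U>. \<not> x n + Suc (v n) \<le> twins_code n" by (subst U_not)
    with xy(1) show ?thesis by eventually_elim simp
  qed
  have "same_type (env x twins_code k) (env y twins_code k)"
  proof (rule same_type_env)
    fix j
    have "msat0 ((env x twins_code k)(3 := y)) (chi j)"
      by (rule ev_agree_nonstandard) (use k(2) xy(3) in \<open>simp_all add: env_def agrees_def\<close>)
    then show "msat0 (env x twins_code k) (theta j) \<longleftrightarrow> msat0 (env y twins_code k) (theta j)"
      by (simp add: msat_chi env_def)
  qed
  (* for y in place of x, the back-and-forth property provides the counterparts of the
     index g + 1 - x and of the code of the corresponding instance *)
  then obtain v' where "same_type ((env x twins_code k)(4 := \<lambda>n. Suc (v n))) ((env y twins_code k)(4 := v'))"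
    using same_type_extend by blast
  then obtain c' where same: "same_type
      ((env x twins_code k)(4 := \<lambda>n. Suc (v n), 6 := \<lambda>n. fcode (inst ((env 0 twins_code k)(4 := \<lambda>n. Suc (v n))) n (twins n))))
      ((env y twins_code k)(4 := v', 6 := c'))" (is "same_type ?e ?e'")
    using same_type_extend by blast
  have "msat0 ?e (Var 4 \<^bold>+ Var 0 \<^bold>= Succ (Var 1))"
    using sum by (simp add: eqU_def env_def)
  then have "msat0 ?e' (Var 4 \<^bold>+ Var 0 \<^bold>= Succ (Var 1))"
    using same_typeD[OF same, of "Var 4 \<^bold>+ Var 0 \<^bold>= Succ (Var 1)"] by simp
  then have sum': "\<forall>\<^sub>F n in \<U>. v' n + y n = Suc (twins_code n)" by (simp add: eqU_def env_def)
  have arith: "arithmetical code_fm" by (simp add: code_fm_def)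
  have "msat0 ?e code_fm"
    unfolding Los[OF arith, where D = "\<lambda>_. False"] nsat_code_fm_env by simp
  then have "msat0 ?e' code_fm" using same_typeD[OF same arith] by blast
  then have "c' \<approx> (\<lambda>n. fcode (inst ((env 0 twins_code k)(4 := v')) n (twins n)))"
    unfolding Los[OF arith, where D = "\<lambda>_. False"] nsat_code_fm_env eqU_def .
  then have "T c' \<longleftrightarrow> has_twins k v'"
    unfolding has_twins_def ev_def by (rule respects_eqU_iff[OF resp])
  moreover have "has_twins k v'"
    unfolding has_twins_iff
  proof (intro exI conjI)
    show "\<forall>\<^sub>F n in \<U>. x n + v' n \<le> twins_code n" using sum' xy(2) by eventually_elim simp
  qed (use xy in auto)
  ultimately have "T (?e' 6)" by simp
  then have "T (?e 6)" using inv[OF same_type_sym[OF same]] by blast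
  then show False using v(2) by (simp add: has_twins_def ev_def)
qed

end

theorem corollary27:
  "\<not> relatively_truth_defines (PT_minus \<union> {INT_tot}) (PT_minus \<union> {INT_all})"
proof
  assume "relatively_truth_defines (PT_minus \<union> {INT_tot}) (PT_minus \<union> {INT_all})"
  then obtain n p where fv: "fv p = {n}"
    and prov: "\<And>\<Theta>. \<Theta> \<in> PT_minus \<union> {INT_all} \<Longrightarrow> PT_minus \<union> {INT_tot} \<turnstile> replace_truth n p \<Theta>"
    unfolding relatively_truth_defines_def by blast
  define T where "T x \<longleftrightarrow> msat Tmin ((\<lambda>_. 0)(n := x)) p" for x
  have T: "T (e i) \<longleftrightarrow> msat Tmin e (subst1 p n (Var i))" for e i
    unfolding T_def sat_subst1 by (rule sat_cong) (use fv in auto)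
  have sat: "msat T e \<Theta>" if "\<Theta> \<in> PT_minus \<union> {INT_all}" for e \<Theta>
  proof -
    have "msat Tmin e (replace_truth n p \<Theta>)"
      by (rule msat_soundness[OF prov[OF that] respects_Tmin]) (use Tmin_PT_minus Tmin_INT_tot in auto)
    moreover have "msat Tmin d p = msat Tmin d' p" if "d n = d' n" for d d'
      by (rule sat_cong) (use fv that in auto)
    ultimately show ?thesis
      using sat_replace_truth[where E = "(\<approx>)" and n = n and T = Tmin and p = p and d = "\<lambda>_. 0"]
      unfolding T_def by blast
  qed
  interpret truth_model T
  proof
    show "respects_eqU T"
      unfolding respects_eqU_def T_def
    proof (intro allI impI)
      fix x y :: "nat \<Rightarrow> nat"
      assume "x \<approx> y" "msat Tmin ((\<lambda>_. 0)(n := x)) p"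
      then show "msat Tmin ((\<lambda>_. 0)(n := y)) p"
        using msat_eqU[OF respects_Tmin, of p "(\<lambda>_. 0)(n := x)" "(\<lambda>_. 0)(n := y)"] by simp
    qed
  qed (use sat in auto)
  show False
  proof (rule no_invariant_truth)
    fix e e' i assume "same_type e e'" "T (e i)"
    then show "T (e' i)" using same_type_Tmin[of e e'] T by simp
  qed
qed

end
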